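(* Let $G$, $(\gamma)$, $\mathbf P$, $f$, $\Phi,\Phi_1,\Phi_0$ be as in the context, let $u$ be an admissible control with corresponding state $x$, and let $\psi=(\psi_1,\dots,\psi_n)$ be the co-state associated with $(x,u)$, i.e. $$\psi_j(s,t)=\iint_{E(s,t)}F_i(\sigma,\tau)R^i_j(\sigma,\tau,s,t)\,dA(\sigma,\tau)+\int_{\gamma(s,t)}F_{1,i}(\sigma,\tau)R^i_j(\sigma,\tau,s,t)\,d\mu(\sigma,\tau)+\sum_{r=1}^N F_{0,i}(P_r)R^i_j(P_r,s,t)\,\chi\big((s,t)\in W(P_r)\big).$$ Assume that all functions involved are continuously differentiable sufficiently many times. Then in the regular part $G_R$ of the domain $G$ the co-state satisfies, for $i=1,\dots,n$, the hyperbolic equation $$\frac{\partial^2\psi_i(s,t)}{\partial s\,\partial t}=\frac{\partial H}{\partial x^i}-\frac{D}{Ds}\frac{\partial H}{\partial p^i}-\frac{D}{Dt}\frac{\partial H}{\partial q^i},$$ where $H(s,t,x,p,q,\psi,u)=\Phi(s,t,x,p,q,u)+\psi_jf^j(s,t,x,p,q,u)$ and all partial derivatives of $H$ are evaluated at $(s,t,x(s,t),x_s(s,t),x_t(s,t),\psi(s,t),u(s,t))$.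
   Context: Geometry. $G$ is a domain in the first quadrant ($s\ge0,t\ge0$) of the $st$-plane bounded by the segment $[0,a]$ of the $s$-axis, the segment $[0,b]$ of the $t$-axis and a continuous, piecewise $C^2$ curve $(\gamma)$ from $(a,0)$ to $(0,b)$ (the points of $(\gamma)$ belong to $G$) which is a non-increasing graph (possibly with vertical or horizontal segments), with at most finitely many points at which the normal field has jump discontinuities; every smooth segment of $(\gamma)$ can be represented as $s=\vartheta_1(t)$ or as $t=\vartheta_2(s)$. $\mu$ is arc length on $(\gamma)$ measured from $(a,0)$. $\mathbf P=\{P_0=(a,0),P_1,\dots,P_N,P_{N+1}=(0,b)\}$ is a finite set of points of $(\gamma)$, numbered in order of increasing $\mu$, called vertices, containing all jump points of the normal (and possibly further points). $s(P),t(P)$ are the coordinates of $P$. The regular part of $G$ is $G_R=\{(s,t)\in G: s\ne s(P_r),\ t\ne t(P_r)\ \forall r=0,\dots,N+1\}$. $(n_1,n_2)$ is the outward unit normal on the smooth part of $(\gamma)$; the tangential derivative is $\varphi_\mu=-n_2\varphi_s+n_1\varphi_t$. $W(s,t)=\{(\sigma,\tau):0\le\sigma\le s,0\le\tau\le t\}$, $E(s,t)=\{(\sigma,\tau)\in G:(s,t)\in W(\sigma,\tau)\}$, $\gamma(s,t)=(\gamma)\cap E(s,t)$; $\chi(\cdot)$ is $1$ if the statement is true and $0$ otherwise. Control problem. The state $x(s,t)\in\mathbb R^n$ solves $x_{st}=f(s,t,x,x_s,x_t,u)$ in $G$, $x(s,0)=x_1(s)$ for $0\le s\le a$, $x(0,t)=x_2(t)$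 for $0\le t\le b$, with $x_1,x_2$ continuous, $x_1(0)=x_2(0)$; $f=f(s,t,x,p,q,u)$ is Lipschitz in $(x,p,q)$ and continuous in $u$ ($p,q$ are the slots of $x_s,x_t$). The control $u(s,t)\in\mathbb R^m$ takes values in the box $\mathbf U=\{\underline u^j\le u^j\le\overline u^j\}$. The cost is $$J=\iint_G\Phi(s,t,x,x_s,x_t,u)\,dA+\int_{(\gamma)}\Phi_1(s,t,x,x_\mu)\,d\mu+\sum_{P\in\mathbf P}\Phi_0(P,x(P)),$$ with $\Phi=\Phi(s,t,x,p,q,u)$, $\Phi_1=\Phi_1(s,t,x,\eta)$ ($\eta$ is the slot of $x_\mu$). Conventions. Coordinates are superscripts; repeated sub/superscripts are summed. $\frac{D}{Ds},\frac{D}{Dt},\frac{D}{D\mu}$ are total derivatives, i.e. derivatives with respect to $s$, $t$, $\mu$ of the composite function obtained after inserting $x(s,t),x_s,x_t,\psi(s,t),u(s,t)$ (respectively $x,x_\mu$ on $(\gamma)$). Derivatives of $f,\Phi,\Phi_1$ below are evaluated along $(x,u)$. Auxiliary functions. $F_i=\Phi_{x^i}-\frac{D}{Ds}\Phi_{p^i}-\frac{D}{Dt}\Phi_{q^i}$ on $G$; $F_{1,i}=n_1\Phi_{p^i}+n_2\Phi_{q^i}+\Phi_{1,x^i}-\frac{D}{D\mu}\Phi_{1,\eta^i}$ on $(\gamma)\setminus\mathbf P$; $F_{0,i}(P_r)=\Phi_{0,x^i}(P_r,x(P_r))-V_r(\Phi_{1,\eta^i})$, where $V_r(\varphi)$ is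 the jump of $\varphi$ at $P_r$ along $(\gamma)$, i.e. the limit as $\mu$ decreases to its value at $P_r$ minus the limit as $\mu$ increases to it. Riemann function. $R^i_j(s,t,\sigma,\tau)$, defined for $(\sigma,\tau)\in W(s,t)$ (and taken to be $0$ otherwise), is the matrix-valued Riemann function of the linearized equation: $\partial_s\partial_tR^i_j=f^i_{x^k}(s,t)R^k_j+f^i_{p^k}(s,t)\partial_sR^k_j+f^i_{q^k}(s,t)\partial_tR^k_j$ for $s>\sigma,t>\tau$; $\partial_sR^i_j(s,\tau,\sigma,\tau)=f^i_{q^k}(s,\tau)R^k_j(s,\tau,\sigma,\tau)$; $\partial_tR^i_j(\sigma,t,\sigma,\tau)=f^i_{p^k}(\sigma,t)R^k_j(\sigma,t,\sigma,\tau)$; $R^i_j(\sigma,\tau,\sigma,\tau)=\delta^i_j$. It equivalently solves the adjoint problem in its last two arguments: $\partial_s\partial_tR^i_j(\sigma,\tau,s,t)=f^k_{x^j}(s,t)R^i_k-\frac{D}{Ds}[f^k_{p^j}(s,t)R^i_k]-\frac{D}{Dt}[f^k_{q^j}(s,t)R^i_k]$ for $s<\sigma,t<\tau$; $\partial_tR^i_j(\sigma,\tau,\sigma,t)=-f^k_{p^j}(\sigma,t)R^i_k(\sigma,\tau,\sigma,t)$; $\partial_sR^i_j(\sigma,\tau,s,\tau)=-f^k_{q^j}(s,\tau)R^i_k(\sigma,\tau,s,\tau)$; $R^i_j(\sigma,\tau,\sigma,\tau)=\delta^i_j$.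
   Formalization: Each arc of (γ) between consecutive vertices is assumed vertical, horizontal, or a C² graph both as s=ϑ1(t) and t=ϑ2(s), so points where the tangent becomes axis-parallel must belong to P; otherwise ψ can jump or have infinite derivatives inside G_R. *)

theory Defs
  imports "HOL-Analysis.Analysis"
begin

section \<open>Continuous differentiability of finite order\<close>

primrec Ck_open :: "nat \<Rightarrow> ('a::euclidean_space \<Rightarrow> 'b::real_normed_vector) \<Rightarrow> 'a set \<Rightarrow> bool" where
  "Ck_open 0 \<phi> S \<longleftrightarrow> continuous_on S \<phi>"
| "Ck_open (Suc k) \<phi> S \<longleftrightarrow>
     \<phi> differentiable_on S \<and> (\<forall>v. Ck_open k (\<lambda>z. frechet_derivative \<phi> (at z) v) S)"

text \<open>On a set that need not be open (a closed domain, an arc), a function is of class \<open>C\<^sup>k\<close>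
  if it agrees there with a function of class \<open>C\<^sup>k\<close> on an open superset.\<close>

definition Ck_on :: "nat \<Rightarrow> ('a::euclidean_space \<Rightarrow> 'b::real_normed_vector) \<Rightarrow> 'a set \<Rightarrow> bool" where
  "Ck_on k \<phi> S \<longleftrightarrow>
     (\<exists>\<Omega> \<phi>'. open \<Omega> \<and> S \<subseteq> \<Omega> \<and> Ck_open k \<phi>' \<Omega> \<and> (\<forall>z\<in>S. \<phi>' z = \<phi> z))"


section \<open>Geometry\<close>

definition W :: "real \<times> real \<Rightarrow> (real \<times> real) set" where
  "W z = {(\<sigma>, \<tau>). 0 \<le> \<sigma> \<and> \<sigma> \<le> fst z \<and> 0 \<le> \<tau> \<and> \<tau> \<le> snd z}"

text \<open>The curve is given by its arc length parametrization \<open>g\<close>, and \<open>mu r\<close> is the arc length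
  parameter of the vertex \<open>P\<^sub>r = g (mu r)\<close>, so \<open>mu (Suc N)\<close> is the total length.
  Between consecutive vertices the curve is \<open>C\<^sup>2\<close> up to the end points, hence every jump point
  of the normal is a vertex.

  The last clause is the representability of the smooth segments as \<open>s = \<theta>\<^sub>1(t)\<close> or
  \<open>t = \<theta>\<^sub>2(s)\<close>: a segment is vertical, or horizontal, or both representations are \<open>C\<^sup>2\<close>
  away from its end points.  Consequently a non-vertex point never has an axis-parallel
  tangent unless its whole segment is axis-parallel.  This cannot be dropped: if, say, a vertical
  piece \<open>s = c\<close> of the curve carries no vertex, then the curve integral in the co-state has a jump
  across the line \<open>s = c\<close> inside the regular part.\<close>

definition boundary_curve ::
  "real \<Rightarrow> real \<Rightarrow> nat \<Rightarrow> (nat \<Rightarrow> real) \<Rightarrow> (real \<Rightarrow> real \<times> real) \<Rightarrow> bool" where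
  "boundary_curve a b N mu g \<longleftrightarrow>
     0 < a \<and> 0 < b \<and>
     mu 0 = 0 \<and> (\<forall>r\<le>N. mu r < mu (Suc r)) \<and>
     continuous_on {0..mu (Suc N)} g \<and> g 0 = (a, 0) \<and> g (mu (Suc N)) = (0, b) \<and>
     (\<forall>\<mu>\<in>{0<..<mu (Suc N)}. 0 < fst (g \<mu>) \<and> 0 < snd (g \<mu>)) \<and>
     (\<forall>\<mu>\<in>{0..mu (Suc N)}. \<forall>\<nu>\<in>{0..mu (Suc N)}. \<mu> \<le> \<nu> \<longrightarrow>
        fst (g \<nu>) \<le> fst (g \<mu>) \<and> snd (g \<mu>) \<le> snd (g \<nu>)) \<and>
     (\<forall>r\<le>N. Ck_on 2 g {mu r..mu (Suc r)} \<and>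
        (\<forall>\<mu>\<in>{mu r<..<mu (Suc r)}. norm (vector_derivative g (at \<mu>)) = 1) \<and>
        ((\<exists>c. \<forall>\<mu>\<in>{mu r<..<mu (Suc r)}. fst (g \<mu>) = c) \<or>
         (\<exists>c. \<forall>\<mu>\<in>{mu r<..<mu (Suc r)}. snd (g \<mu>) = c) \<or>
         (\<exists>\<theta>1 \<theta>2 :: real \<Rightarrow> real.
            Ck_on 2 \<theta>1 ((\<lambda>\<mu>. snd (g \<mu>)) ` {mu r<..<mu (Suc r)}) \<and>
            Ck_on 2 \<theta>2 ((\<lambda>\<mu>. fst (g \<mu>)) ` {mu r<..<mu (Suc r)}) \<and>
            (\<forall>\<mu>\<in>{mu r<..<mu (Suc r)}.
               fst (g \<mu>) = \<theta>1 (snd (g \<mu>)) \<and> snd (g \<mu>) = \<theta>2 (fst (g \<mu>))))))"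

text \<open>As the curve is non-increasing, the closed region between it and the axes consists of the
  points of the quadrant that are dominated by a point of the curve.\<close>

definition region :: "nat \<Rightarrow> (nat \<Rightarrow> real) \<Rightarrow> (real \<Rightarrow> real \<times> real) \<Rightarrow> (real \<times> real) set" where
  "region N mu g = (\<Union>\<mu>\<in>{0..mu (Suc N)}. W (g \<mu>))"

definition regular_part ::
  "nat \<Rightarrow> (nat \<Rightarrow> real) \<Rightarrow> (real \<Rightarrow> real \<times> real) \<Rightarrow> (real \<times> real) set" where
  "regular_part N mu g =
     {z \<in> region N mu g. \<forall>r\<le>Suc N. fst z \<noteq> fst (g (mu r)) \<and> snd z \<noteq> snd (g (mu r))}"

definition E :: "(real \<times> real) set \<Rightarrow> real \<times> real \<Rightarrow> (real \<times> real) set" where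
  "E G z = {\<zeta> \<in> G. z \<in> W \<zeta>}"

text \<open>The curve runs from \<open>(a,0)\<close> to \<open>(0,b)\<close>, with the region on its left; the outward unit normal
  is therefore the unit tangent rotated clockwise.\<close>

definition n1 :: "(real \<Rightarrow> real \<times> real) \<Rightarrow> real \<Rightarrow> real" where
  "n1 g \<mu> = snd (vector_derivative g (at \<mu>))"

definition n2 :: "(real \<Rightarrow> real \<times> real) \<Rightarrow> real \<Rightarrow> real" where
  "n2 g \<mu> = - fst (vector_derivative g (at \<mu>))"


section \<open>Derivatives\<close>

text \<open>Partial derivatives with respect to \<open>s\<close> and \<open>t\<close> are taken within \<open>G\<close>, so they are one-sided at
  boundary points.  The only points of \<open>G\<close> where one of these derivatives may fail to make sense,
  because a section of \<open>G\<close> degenerates, are the corners \<open>(a,0)\<close> and \<open>(0,b)\<close>.  Applied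
  to a composite function they are the total derivatives \<open>D/Ds\<close> and \<open>D/Dt\<close>.\<close>

definition pds :: "(real \<times> real) set \<Rightarrow> (real \<times> real \<Rightarrow> 'b::real_normed_vector) \<Rightarrow> real \<times> real \<Rightarrow> 'b" where
  "pds G \<phi> z = vector_derivative (\<lambda>\<sigma>. \<phi> (\<sigma>, snd z)) (at (fst z) within {\<sigma>. (\<sigma>, snd z) \<in> G})"

definition pdt :: "(real \<times> real) set \<Rightarrow> (real \<times> real \<Rightarrow> 'b::real_normed_vector) \<Rightarrow> real \<times> real \<Rightarrow> 'b" where
  "pdt G \<phi> z = vector_derivative (\<lambda>\<tau>. \<phi> (fst z, \<tau>)) (at (snd z) within {\<tau>. (fst z, \<tau>) \<in> G})"

definition s_differentiable ::
  "(real \<times> real) set \<Rightarrow> (real \<times> real \<Rightarrow> 'b::real_normed_vector) \<Rightarrow> real \<times> real \<Rightarrow> bool" where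
  "s_differentiable G \<phi> z \<longleftrightarrow>
     (\<lambda>\<sigma>. \<phi> (\<sigma>, snd z)) differentiable (at (fst z) within {\<sigma>. (\<sigma>, snd z) \<in> G})"

definition t_differentiable ::
  "(real \<times> real) set \<Rightarrow> (real \<times> real \<Rightarrow> 'b::real_normed_vector) \<Rightarrow> real \<times> real \<Rightarrow> bool" where
  "t_differentiable G \<phi> z \<longleftrightarrow>
     (\<lambda>\<tau>. \<phi> (fst z, \<tau>)) differentiable (at (snd z) within {\<tau>. (fst z, \<tau>) \<in> G})"

definition coord_deriv :: "'n::finite \<Rightarrow> (real^'n \<Rightarrow> real) \<Rightarrow> real^'n \<Rightarrow> real" where
  "coord_deriv i \<phi> y = deriv (\<lambda>h. \<phi> (y + h *\<^sub>R axis i 1)) 0"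

type_synonym ('n, 'm) jet = "real \<times> real \<times> (real^'n) \<times> (real^'n) \<times> (real^'n) \<times> (real^'m)"

definition D_x :: "'n::finite \<Rightarrow> (('n,'m::finite) jet \<Rightarrow> real) \<Rightarrow> ('n,'m) jet \<Rightarrow> real" where
  "D_x i \<phi> = (\<lambda>(s, t, y, p, q, v). coord_deriv i (\<lambda>y'. \<phi> (s, t, y', p, q, v)) y)"

definition D_p :: "'n::finite \<Rightarrow> (('n,'m::finite) jet \<Rightarrow> real) \<Rightarrow> ('n,'m) jet \<Rightarrow> real" where
  "D_p i \<phi> = (\<lambda>(s, t, y, p, q, v). coord_deriv i (\<lambda>p'. \<phi> (s, t, y, p', q, v)) p)"

definition D_q :: "'n::finite \<Rightarrow> (('n,'m::finite) jet \<Rightarrow> real) \<Rightarrow> ('n,'m) jet \<Rightarrow> real" where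
  "D_q i \<phi> = (\<lambda>(s, t, y, p, q, v). coord_deriv i (\<lambda>q'. \<phi> (s, t, y, p, q', v)) q)"

type_synonym 'n bjet = "real \<times> real \<times> (real^'n) \<times> (real^'n)"

definition B_x :: "'n::finite \<Rightarrow> ('n bjet \<Rightarrow> real) \<Rightarrow> 'n bjet \<Rightarrow> real" where
  "B_x i \<phi> = (\<lambda>(s, t, y, \<eta>). coord_deriv i (\<lambda>y'. \<phi> (s, t, y', \<eta>)) y)"

definition B_eta :: "'n::finite \<Rightarrow> ('n bjet \<Rightarrow> real) \<Rightarrow> 'n bjet \<Rightarrow> real" where
  "B_eta i \<phi> = (\<lambda>(s, t, y, \<eta>). coord_deriv i (\<lambda>\<eta>'. \<phi> (s, t, y, \<eta>')) \<eta>)"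


section \<open>State and control\<close>

definition jet :: "(real \<times> real) set \<Rightarrow> (real \<times> real \<Rightarrow> real^'n::finite) \<Rightarrow>
    (real \<times> real \<Rightarrow> real^'m::finite) \<Rightarrow> real \<times> real \<Rightarrow> ('n,'m) jet" where
  "jet G x u z = (fst z, snd z, x z, pds G x z, pdt G x z, u z)"

text \<open>The last component is the tangential derivative
  \<open>x\<^sub>\<mu> = - n\<^sub>2 x\<^sub>s + n\<^sub>1 x\<^sub>t\<close>.\<close>

definition bjet :: "(real \<times> real) set \<Rightarrow> (real \<Rightarrow> real \<times> real) \<Rightarrow>
    (real \<times> real \<Rightarrow> real^'n::finite) \<Rightarrow> real \<Rightarrow> 'n bjet" where
  "bjet G g x \<mu> = (fst (g \<mu>), snd (g \<mu>), x (g \<mu>),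
     - n2 g \<mu> *\<^sub>R pds G x (g \<mu>) + n1 g \<mu> *\<^sub>R pdt G x (g \<mu>))"

definition is_state :: "real \<Rightarrow> real \<Rightarrow> (real \<times> real) set \<Rightarrow> (('n::finite,'m::finite) jet \<Rightarrow> real^'n) \<Rightarrow>
    (real \<Rightarrow> real^'n) \<Rightarrow> (real \<Rightarrow> real^'n) \<Rightarrow> (real \<times> real \<Rightarrow> real^'m) \<Rightarrow> (real \<times> real \<Rightarrow> real^'n) \<Rightarrow> bool" where
  "is_state a b G f x1 x2 u x \<longleftrightarrow>
     (\<forall>z\<in>G - {(a, 0), (0, b)}. pds G (pdt G x) z = f (jet G x u z)) \<and>
     (\<forall>s\<in>{0..a}. x (s, 0) = x1 s) \<and> (\<forall>t\<in>{0..b}. x (0, t) = x2 t)"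


section \<open>Riemann function\<close>

text \<open>\<open>R (s,t) (\<sigma>,\<tau>) $ i $ j\<close> is \<open>R\<^sup>i\<^sub>j(s,t,\<sigma>,\<tau>)\<close>; \<open>fx i k\<close>, \<open>fp i k\<close>, \<open>fq i k\<close> are the
  coefficients \<open>f\<^sup>i\<close> differentiated with respect to \<open>x\<^sup>k\<close>, \<open>p\<^sup>k\<close>, \<open>q\<^sup>k\<close> along the state and control.
  The first four clauses after the vanishing condition are the Goursat problem in the first two
  arguments, the remaining ones the (equivalent) adjoint problem in the last two.\<close>

definition is_riemann :: "real \<Rightarrow> real \<Rightarrow> (real \<times> real) set \<Rightarrow>
    ('n::finite \<Rightarrow> 'n \<Rightarrow> real \<times> real \<Rightarrow> real) \<Rightarrow> ('n \<Rightarrow> 'n \<Rightarrow> real \<times> real \<Rightarrow> real) \<Rightarrow>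
    ('n \<Rightarrow> 'n \<Rightarrow> real \<times> real \<Rightarrow> real) \<Rightarrow> (real \<times> real \<Rightarrow> real \<times> real \<Rightarrow> real^'n^'n) \<Rightarrow> bool" where
  "is_riemann a b G fx fp fq R \<longleftrightarrow>
     (\<forall>z\<in>G. \<forall>\<zeta>. \<zeta> \<notin> W z \<longrightarrow> R z \<zeta> = 0) \<and>
     (\<forall>z\<in>G. R z z = mat 1) \<and>
     (\<forall>s t \<sigma> \<tau> i j. (s, t) \<in> G \<and> 0 \<le> \<sigma> \<and> \<sigma> < s \<and> 0 \<le> \<tau> \<and> \<tau> < t \<longrightarrow>
        pds G (pdt G (\<lambda>z. R z (\<sigma>, \<tau>) $ i $ j)) (s, t) =
          (\<Sum>k\<in>UNIV. fx i k (s, t) * R (s, t) (\<sigma>, \<tau>) $ k $ j) +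
          (\<Sum>k\<in>UNIV. fp i k (s, t) * pds G (\<lambda>z. R z (\<sigma>, \<tau>) $ k $ j) (s, t)) +
          (\<Sum>k\<in>UNIV. fq i k (s, t) * pdt G (\<lambda>z. R z (\<sigma>, \<tau>) $ k $ j) (s, t))) \<and>
     (\<forall>s \<sigma> \<tau> i j. (s, \<tau>) \<in> G - {(a, 0), (0, b)} \<and> 0 \<le> \<sigma> \<and> \<sigma> \<le> s \<longrightarrow>
        ((\<lambda>s'. R (s', \<tau>) (\<sigma>, \<tau>) $ i $ j) has_real_derivative
          (\<Sum>k\<in>UNIV. fq i k (s, \<tau>) * R (s, \<tau>) (\<sigma>, \<tau>) $ k $ j))
          (at s within {s'. \<sigma> \<le> s' \<and> (s', \<tau>) \<in> G})) \<and>
     (\<forall>t \<sigma> \<tau> i j. (\<sigma>, t) \<in> G - {(a, 0), (0, b)} \<and> 0 \<le> \<tau> \<and> \<tau> \<le> t \<longrightarrow>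
        ((\<lambda>t'. R (\<sigma>, t') (\<sigma>, \<tau>) $ i $ j) has_real_derivative
          (\<Sum>k\<in>UNIV. fp i k (\<sigma>, t) * R (\<sigma>, t) (\<sigma>, \<tau>) $ k $ j))
          (at t within {t'. \<tau> \<le> t' \<and> (\<sigma>, t') \<in> G})) \<and>
     (\<forall>s t \<sigma> \<tau> i j. (\<sigma>, \<tau>) \<in> G \<and> 0 \<le> s \<and> s < \<sigma> \<and> 0 \<le> t \<and> t < \<tau> \<longrightarrow>
        pds G (pdt G (\<lambda>z. R (\<sigma>, \<tau>) z $ i $ j)) (s, t) =
          (\<Sum>k\<in>UNIV. fx k j (s, t) * R (\<sigma>, \<tau>) (s, t) $ i $ k) -
          pds G (\<lambda>z. \<Sum>k\<in>UNIV. fp k j z * R (\<sigma>, \<tau>) z $ i $ k) (s, t) -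
          pdt G (\<lambda>z. \<Sum>k\<in>UNIV. fq k j z * R (\<sigma>, \<tau>) z $ i $ k) (s, t)) \<and>
     (\<forall>t \<sigma> \<tau> i j. (\<sigma>, \<tau>) \<in> G \<and> 0 \<le> t \<and> t \<le> \<tau> \<and> (\<sigma>, t) \<notin> {(a, 0), (0, b)} \<longrightarrow>
        ((\<lambda>t'. R (\<sigma>, \<tau>) (\<sigma>, t') $ i $ j) has_real_derivative
          - (\<Sum>k\<in>UNIV. fp k j (\<sigma>, t) * R (\<sigma>, \<tau>) (\<sigma>, t) $ i $ k))
          (at t within {0..\<tau>})) \<and>
     (\<forall>s \<sigma> \<tau> i j. (\<sigma>, \<tau>) \<in> G \<and> 0 \<le> s \<and> s \<le> \<sigma> \<and> (s, \<tau>) \<notin> {(a, 0), (0, b)} \<longrightarrow>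
        ((\<lambda>s'. R (\<sigma>, \<tau>) (s', \<tau>) $ i $ j) has_real_derivative
          - (\<Sum>k\<in>UNIV. fq k j (s, \<tau>) * R (\<sigma>, \<tau>) (s, \<tau>) $ i $ k))
          (at s within {0..\<sigma>}))"

definition riemann_function :: "real \<Rightarrow> real \<Rightarrow> (real \<times> real) set \<Rightarrow> (('n::finite,'m::finite) jet \<Rightarrow> real^'n) \<Rightarrow>
    (real \<times> real \<Rightarrow> real^'n) \<Rightarrow> (real \<times> real \<Rightarrow> real^'m) \<Rightarrow>
    (real \<times> real \<Rightarrow> real \<times> real \<Rightarrow> real^'n^'n) \<Rightarrow> bool" where
  "riemann_function a b G f x u R \<longleftrightarrow>
     is_riemann a b G
       (\<lambda>i k z. D_x k (\<lambda>w. f w $ i) (jet G x u z))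
       (\<lambda>i k z. D_p k (\<lambda>w. f w $ i) (jet G x u z))
       (\<lambda>i k z. D_q k (\<lambda>w. f w $ i) (jet G x u z)) R"


section \<open>Co-state and Hamiltonian\<close>

definition F :: "(real \<times> real) set \<Rightarrow> (('n::finite,'m::finite) jet \<Rightarrow> real) \<Rightarrow>
    (real \<times> real \<Rightarrow> real^'n) \<Rightarrow> (real \<times> real \<Rightarrow> real^'m) \<Rightarrow> 'n \<Rightarrow> real \<times> real \<Rightarrow> real" where
  "F G \<Phi> x u i z = D_x i \<Phi> (jet G x u z)
     - pds G (\<lambda>\<zeta>. D_p i \<Phi> (jet G x u \<zeta>)) z
     - pdt G (\<lambda>\<zeta>. D_q i \<Phi> (jet G x u \<zeta>)) z"

text \<open>Functions on the curve are written as functions of the arc length parameter.\<close>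

definition F1 :: "(real \<times> real) set \<Rightarrow> (real \<Rightarrow> real \<times> real) \<Rightarrow> (('n::finite,'m::finite) jet \<Rightarrow> real) \<Rightarrow>
    ('n bjet \<Rightarrow> real) \<Rightarrow> (real \<times> real \<Rightarrow> real^'n) \<Rightarrow> (real \<times> real \<Rightarrow> real^'m) \<Rightarrow> 'n \<Rightarrow> real \<Rightarrow> real" where
  "F1 G g \<Phi> \<Phi>1 x u i \<mu> =
     n1 g \<mu> * D_p i \<Phi> (jet G x u (g \<mu>)) + n2 g \<mu> * D_q i \<Phi> (jet G x u (g \<mu>))
     + B_x i \<Phi>1 (bjet G g x \<mu>) - deriv (\<lambda>\<nu>. B_eta i \<Phi>1 (bjet G g x \<nu>)) \<mu>"

definition jump :: "(real \<Rightarrow> real) \<Rightarrow> real \<Rightarrow> real" where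
  "jump \<phi> \<mu> = Lim (at_right \<mu>) \<phi> - Lim (at_left \<mu>) \<phi>"

definition F0 :: "(real \<times> real) set \<Rightarrow> (real \<Rightarrow> real \<times> real) \<Rightarrow> (nat \<Rightarrow> real) \<Rightarrow> ('n::finite bjet \<Rightarrow> real) \<Rightarrow>
    (real \<times> real \<Rightarrow> real^'n \<Rightarrow> real) \<Rightarrow> (real \<times> real \<Rightarrow> real^'n) \<Rightarrow> 'n \<Rightarrow> nat \<Rightarrow> real" where
  "F0 G g mu \<Phi>1 \<Phi>0 x i r =
     coord_deriv i (\<Phi>0 (g (mu r))) (x (g (mu r)))
     - jump (\<lambda>\<mu>. B_eta i \<Phi>1 (bjet G g x \<mu>)) (mu r)"

definition costate :: "nat \<Rightarrow> (nat \<Rightarrow> real) \<Rightarrow> (real \<Rightarrow> real \<times> real) \<Rightarrow> (('n::finite,'m::finite) jet \<Rightarrow> real) \<Rightarrow>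
    ('n bjet \<Rightarrow> real) \<Rightarrow> (real \<times> real \<Rightarrow> real^'n \<Rightarrow> real) \<Rightarrow>
    (real \<times> real \<Rightarrow> real^'n) \<Rightarrow> (real \<times> real \<Rightarrow> real^'m) \<Rightarrow>
    (real \<times> real \<Rightarrow> real \<times> real \<Rightarrow> real^'n^'n) \<Rightarrow> real \<times> real \<Rightarrow> real^'n" where
  "costate N mu g \<Phi> \<Phi>1 \<Phi>0 x u R z =
     (let G = region N mu g in
      \<chi> j. (LINT \<zeta>:E G z|lborel. (\<Sum>i\<in>UNIV. F G \<Phi> x u i \<zeta> * R \<zeta> z $ i $ j))
         + (LINT \<mu>:{\<mu> \<in> {0..mu (Suc N)}. g \<mu> \<in> E G z}|lborel.
              (\<Sum>i\<in>UNIV. F1 G g \<Phi> \<Phi>1 x u i \<mu> * R (g \<mu>) z $ i $ j))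
         + (\<Sum>r=1..N. (\<Sum>i\<in>UNIV. F0 G g mu \<Phi>1 \<Phi>0 x i r * R (g (mu r)) z $ i $ j)
              * of_bool (z \<in> W (g (mu r)))))"

definition H :: "(('n::finite,'m::finite) jet \<Rightarrow> real) \<Rightarrow> (('n,'m) jet \<Rightarrow> real^'n) \<Rightarrow>
    real^'n \<Rightarrow> ('n,'m) jet \<Rightarrow> real" where
  "H \<Phi> f \<psi> w = \<Phi> w + (\<Sum>j\<in>UNIV. \<psi> $ j * f w $ j)"

end

theory Submission
  imports Defs
begin

text \<open>The co-state is a superposition of source terms \<open>\<integral> w R(\<zeta>, z)\<close> over those sources \<open>\<zeta>\<close> (spread
  over the region, over the curve, or sitting at a vertex) that dominate \<open>z = (s, t)\<close>, and the
  equation is linear, so it suffices to treat each kind of source separately.  When \<open>z\<close> moves, the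
  integrand changes and so do the edges \<open>\<sigma> = s\<close> and \<open>\<tau> = t\<close> of the domain of integration.
  Differentiating the integrand reproduces the adjoint equation of \<open>R\<close> in its second argument; the
  edge terms combine by the adjoint conditions on the characteristics.  What is left is the corner
  term \<open>F R(z, z) = F\<close> of the interior sources; curve and vertices leave nothing, because
  away from the vertex lines the end points of the arc \<open>\<gamma>(s, t)\<close> depend differentiably on \<open>s\<close> alone
  and on \<open>t\<close> alone, respectively.\<close>

section \<open>Integrals over a moving domain\<close>

text \<open>The obstacle is that \<open>R\<close> is cut off to 0 outside \<open>W \<zeta>\<close>,
  so the integrand jumps across two moving edges, and difference quotients of the raw integrand are
  in general not dominated by an integrable function. Moreover the equation is claimed at points of
  the curve too, so every derivative is taken within a section of the closed set \<open>G\<close>,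
  and smoothness is available only through extensions to open supersets. The two variables are
  treated unequally: the \<open>t\<close>-derivative has to exist on a neighbourhood of the point in
  \<open>G\<close>, because it is differentiated again in \<open>s\<close>, while the
  \<open>s\<close>-derivatives are needed at the point alone. The contribution of the edge
  \<open>\<tau> = t\<close> is then differentiated once more in \<open>s\<close>. For a curve source
  this edge is one point that does not move with \<open>s\<close>; for interior sources it is a
  horizontal line of sources, again cut off at \<open>\<sigma> = s\<close>, and the end of this line
  produces the corner term. The vertex lines are excluded because there a cut-off can switch on a
  point mass or a whole axis-parallel arc at once.\<close>

lemma has_real_derivative_integral_lipschitz:
  fixes e :: "'w \<Rightarrow> real \<Rightarrow> real"
  assumes s0: "s0 \<in> S"
    and int: "\<And>s. s \<in> S \<Longrightarrow> integrable M (\<lambda>\<omega>. e \<omega> s)"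
    and B: "integrable M B"
    and lip: "\<And>\<omega> s. \<omega> \<in> space M \<Longrightarrow> s \<in> S \<Longrightarrow> \<bar>e \<omega> s - e \<omega> s0\<bar> \<le> B \<omega> * \<bar>s - s0\<bar>"
    and der: "AE \<omega> in M. (e \<omega> has_real_derivative e' \<omega>) (at s0 within S)"
    and e': "e' \<in> borel_measurable M"
  shows "((\<lambda>s. \<integral>\<omega>. e \<omega> s \<partial>M) has_real_derivative (\<integral>\<omega>. e' \<omega> \<partial>M)) (at s0 within S)"
  unfolding has_field_derivative_iff tendsto_at_iff_sequentially
proof (intro allI impI)
  fix X :: "nat \<Rightarrow> real"
  assume X: "\<forall>i. X i \<in> S - {s0}" and Xlim: "X \<longlonglongrightarrow> s0"
  \<comment> \<open>The Lipschitz estimate bounds these difference quotients by \<open>B\<close> for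
    every \<open>i\<close>, so dominated convergence applies; the sequential form of the limit makes
    it available for derivatives within an arbitrary \<open>S\<close>.\<close>
  let ?q = "\<lambda>i \<omega>. (e \<omega> (X i) - e \<omega> s0) / (X i - s0)"
  have "(\<lambda>i. \<integral>\<omega>. ?q i \<omega> \<partial>M) \<longlonglongrightarrow> (\<integral>\<omega>. e' \<omega> \<partial>M)"
  proof (rule integral_dominated_convergence[where w = B])
    show "?q i \<in> borel_measurable M" for i
      using X int s0 by (intro borel_measurable_divide borel_measurable_diff) auto
    show "AE \<omega> in M. (\<lambda>i. ?q i \<omega>) \<longlonglongrightarrow> e' \<omega>"
      using der
    proof eventually_elim
      case (elim \<omega>)
      then show ?case
        using X Xlim unfolding has_field_derivative_iff tendsto_at_iff_sequentially
        by (auto simp: o_def)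
    qed
    show "AE \<omega> in M. norm (?q i \<omega>) \<le> B \<omega>" for i
    proof (rule AE_I2)
      fix \<omega> assume "\<omega> \<in> space M"
      moreover have "X i \<in> S" "X i \<noteq> s0" using X by auto
      ultimately show "norm (?q i \<omega>) \<le> B \<omega>"
        using lip[of \<omega> "X i"] by (simp add: abs_divide divide_simps)
    qed
  qed (use B e' in auto)
  moreover have "(\<integral>\<omega>. ?q i \<omega> \<partial>M) = ((\<integral>\<omega>. e \<omega> (X i) \<partial>M) - (\<integral>\<omega>. e \<omega> s0 \<partial>M)) / (X i - s0)" for i
    using X int s0 by (subst Bochner_Integration.integral_diff[symmetric]) auto
  ultimately show "((\<lambda>y. ((\<integral>\<omega>. e \<omega> y \<partial>M) - (\<integral>\<omega>. e \<omega> s0 \<partial>M)) / (y - s0)) \<circ> X) \<longlonglongrightarrow> (\<integral>\<omega>. e' \<omega> \<partial>M)"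
    by (simp only: o_def)
qed

text \<open>Subtracting the diagonal value \<open>k \<omega> (h \<omega>)\<close> makes the truncated integrand Lipschitz in
  \<open>s\<close>, so the moving boundary only enters through the integral of the diagonal values.\<close>

lemma has_real_derivative_moving_domain:
  fixes k :: "'w \<Rightarrow> real \<Rightarrow> real" and h :: "'w \<Rightarrow> real"
  assumes s0: "s0 \<in> S"
    and h: "h \<in> borel_measurable M"
    and int: "\<And>s. s \<in> S \<Longrightarrow> integrable M (\<lambda>\<omega>. if s \<le> h \<omega> then k \<omega> s else 0)"
    and intd: "\<And>s. s \<in> S \<Longrightarrow> integrable M (\<lambda>\<omega>. if s \<le> h \<omega> then k \<omega> (h \<omega>) else 0)"
    and B: "integrable M B" "\<And>\<omega>. 0 \<le> B \<omega>"
    and lip: "\<And>\<omega> s s'. \<omega> \<in> space M \<Longrightarrow> s \<in> S \<union> {h \<omega>} \<Longrightarrow> s' \<in> S \<union> {h \<omega>} \<Longrightarrow> s \<le> h \<omega> \<Longrightarrow> s' \<le> h \<omega>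
      \<Longrightarrow> \<bar>k \<omega> s - k \<omega> s'\<bar> \<le> B \<omega> * \<bar>s - s'\<bar>"
    and der: "AE \<omega> in M. s0 < h \<omega> \<longrightarrow> (k \<omega> has_real_derivative k' \<omega>) (at s0 within S)"
    and null: "AE \<omega> in M. h \<omega> \<noteq> s0"
    and k': "(\<lambda>\<omega>. if s0 \<le> h \<omega> then k' \<omega> else 0) \<in> borel_measurable M"
    and D: "((\<lambda>s. \<integral>\<omega>. (if s \<le> h \<omega> then k \<omega> (h \<omega>) else 0) \<partial>M) has_real_derivative D) (at s0 within S)"
  shows "((\<lambda>s. \<integral>\<omega>. (if s \<le> h \<omega> then k \<omega> s else 0) \<partial>M) has_real_derivative
      (\<integral>\<omega>. (if s0 \<le> h \<omega> then k' \<omega> else 0) \<partial>M) + D) (at s0 within S)"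
proof -
  define e where "e \<omega> s = (if s \<le> h \<omega> then k \<omega> s - k \<omega> (h \<omega>) else 0)" for \<omega> s
  have e_eq: "e \<omega> s = (if s \<le> h \<omega> then k \<omega> s else 0) - (if s \<le> h \<omega> then k \<omega> (h \<omega>) else 0)" for \<omega> s
    by (simp add: e_def)
  have "((\<lambda>s. \<integral>\<omega>. e \<omega> s \<partial>M) has_real_derivative (\<integral>\<omega>. (if s0 \<le> h \<omega> then k' \<omega> else 0) \<partial>M)) (at s0 within S)"
  proof (rule has_real_derivative_integral_lipschitz[where B = B])
    show "integrable M (\<lambda>\<omega>. e \<omega> s)" if "s \<in> S" for s
      unfolding e_eq using int[OF that] intd[OF that] by (rule Bochner_Integration.integrable_diff)
    show "\<bar>e \<omega> s - e \<omega> s0\<bar> \<le> B \<omega> * \<bar>s - s0\<bar>" if "\<omega> \<in> space M" "s \<in> S" for \<omega> s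
    proof -
      \<comment> \<open>When the edge \<open>h \<omega>\<close> separates \<open>s\<close> from
        \<open>s0\<close>, only one of the two values is present, and it is an increment from the
        edge, over a distance of at most \<open>\<bar>s - s0\<bar>\<close>. This is why
        \<open>lip\<close> also admits \<open>h \<omega>\<close> as an argument.\<close>
      consider "s \<le> h \<omega>" "s0 \<le> h \<omega>" | "s \<le> h \<omega>" "h \<omega> < s0" | "h \<omega> < s" "s0 \<le> h \<omega>" | "h \<omega> < s" "h \<omega> < s0"
        by linarith
      then show ?thesis
      proof cases
        case 1
        then show ?thesis using lip[of \<omega> s s0] that s0 by (simp add: e_def)
      next
        case 2
        then have "\<bar>k \<omega> s - k \<omega> (h \<omega>)\<bar> \<le> B \<omega> * \<bar>s - h \<omega>\<bar>"
          using lip[of \<omega> s "h \<omega>"] that by simp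
        also have "\<dots> \<le> B \<omega> * \<bar>s - s0\<bar>" using 2 B by (intro mult_left_mono) auto
        finally show ?thesis using 2 by (simp add: e_def)
      next
        case 3
        then have "\<bar>k \<omega> s0 - k \<omega> (h \<omega>)\<bar> \<le> B \<omega> * \<bar>s0 - h \<omega>\<bar>"
          using lip[of \<omega> s0 "h \<omega>"] that s0 by simp
        also have "\<dots> \<le> B \<omega> * \<bar>s - s0\<bar>" using 3 B by (intro mult_left_mono) auto
        finally show ?thesis using 3 by (simp add: e_def)
      next
        case 4
        then show ?thesis using B by (simp add: e_def)
      qed
    qed
    show "AE \<omega> in M. (e \<omega> has_real_derivative (if s0 \<le> h \<omega> then k' \<omega> else 0)) (at s0 within S)"
      using der null
    proof eventually_elim
      case (elim \<omega>)
      show ?case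
      proof (cases "s0 < h \<omega>")
        case True
        then have "((\<lambda>s. k \<omega> s - k \<omega> (h \<omega>)) has_real_derivative k' \<omega>) (at s0 within S)"
          using elim by (auto intro!: derivative_eq_intros)
        then have "(e \<omega> has_real_derivative k' \<omega>) (at s0 within S)"
          by (rule has_field_derivative_transform_within[where d = "h \<omega> - s0"])
            (use True s0 in \<open>auto simp: e_def dist_real_def\<close>)
        then show ?thesis using True by simp
      next
        case False
        with elim have lt: "h \<omega> < s0" by simp
        have "((\<lambda>s. 0::real) has_real_derivative 0) (at s0 within S)" by simp
        then have "(e \<omega> has_real_derivative 0) (at s0 within S)"
          by (rule has_field_derivative_transform_within[where d = "s0 - h \<omega>"])
            (use lt s0 in \<open>auto simp: e_def dist_real_def\<close>)
        then show ?thesis using lt by simp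
      qed
    qed
  qed (use s0 B k' in auto)
  from DERIV_add[OF this D]
  have "((\<lambda>s. (\<integral>\<omega>. e \<omega> s \<partial>M) + (\<integral>\<omega>. (if s \<le> h \<omega> then k \<omega> (h \<omega>) else 0) \<partial>M)) has_real_derivative
      (\<integral>\<omega>. (if s0 \<le> h \<omega> then k' \<omega> else 0) \<partial>M) + D) (at s0 within S)" .
  then show ?thesis
  proof (rule has_field_derivative_transform_within[where d = 1])
    fix s assume "s \<in> S"
    then show "(\<integral>\<omega>. e \<omega> s \<partial>M) + (\<integral>\<omega>. (if s \<le> h \<omega> then k \<omega> (h \<omega>) else 0) \<partial>M)
        = (\<integral>\<omega>. (if s \<le> h \<omega> then k \<omega> s else 0) \<partial>M)"
      unfolding e_eq using int intd by (subst Bochner_Integration.integral_diff) auto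
  qed (use s0 in auto)
qed

section \<open>Kernels on pairs of a source and a dominated point\<close>

definition kernel_domain :: "(real \<times> real) set \<Rightarrow> ((real \<times> real) \<times> (real \<times> real)) set" where
  "kernel_domain G = {(\<zeta>, z). \<zeta> \<in> G \<and> z \<in> W \<zeta>}"

lemma mem_W_iff: "z \<in> W \<zeta> \<longleftrightarrow> 0 \<le> fst z \<and> fst z \<le> fst \<zeta> \<and> 0 \<le> snd z \<and> snd z \<le> snd \<zeta>"
  by (cases z) (auto simp: W_def)

lemma mem_E_iff: "\<zeta> \<in> E G z \<longleftrightarrow> \<zeta> \<in> G \<and> 0 \<le> fst z \<and> fst z \<le> fst \<zeta> \<and> 0 \<le> snd z \<and> snd z \<le> snd \<zeta>"
  by (auto simp: E_def mem_W_iff)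

lemma closed_W_rel: "closed {p :: (real \<times> real) \<times> (real \<times> real). snd p \<in> W (fst p)}"
  unfolding mem_W_iff
  by (intro closed_Collect_conj closed_Collect_le continuous_intros)

text \<open>Continuity of \<open>R\<close> is only available on these pairs, since it drops to the
  default 0 beyond them; their compactness then yields uniform bounds on the kernels. A point of
  \<open>W \<zeta>\<close> lies between the origin and \<open>\<zeta>\<close>, so both components
  stay in a bounded set.\<close>

lemma compact_kernel_domain:
  assumes "compact G" shows "compact (kernel_domain G)"
proof -
  obtain C where C: "\<And>z. z \<in> G \<Longrightarrow> norm z \<le> C"
    using compact_imp_bounded[OF assms] bounded_iff by blast
  have "kernel_domain G = (G \<times> cbox (-C, -C) (C, C)) \<inter> {p. snd p \<in> W (fst p)}"
  proof -
    have "fst z \<le> C \<and> snd z \<le> C" if "z \<in> G" for z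
      using C[OF that] norm_fst_le[of "fst z" "snd z"] norm_snd_le[of "snd z" "fst z"] by auto
    then show ?thesis
      by (force simp: kernel_domain_def mem_W_iff cbox_Pair_eq)
  qed
  then show ?thesis
    using compact_Times[OF assms compact_cbox] closed_W_rel by (auto intro: compact_Int_closed)
qed

lemma closed_E: assumes "compact G" shows "closed (E G z)"
proof -
  have "E G z = G \<inter> {\<zeta>. z \<in> W \<zeta>}" by (auto simp: E_def)
  moreover have "closed {\<zeta>. z \<in> W \<zeta>}"
    unfolding mem_W_iff by (intro closed_Collect_conj closed_Collect_le continuous_intros)
  ultimately show ?thesis using assms compact_imp_closed by auto
qed

lemma kernel_bounded:
  fixes K :: "real \<times> real \<Rightarrow> real \<times> real \<Rightarrow> real"
  assumes "compact G" "continuous_on (kernel_domain G) (\<lambda>(\<zeta>, z). K \<zeta> z)"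
  obtains C where "0 \<le> C" "\<And>\<zeta> z. \<zeta> \<in> G \<Longrightarrow> z \<in> W \<zeta> \<Longrightarrow> \<bar>K \<zeta> z\<bar> \<le> C"
proof -
  have "bounded ((\<lambda>(\<zeta>, z). K \<zeta> z) ` kernel_domain G)"
    using assms compact_kernel_domain compact_continuous_image compact_imp_bounded by blast
  then obtain C where "\<forall>y\<in>(\<lambda>(\<zeta>, z). K \<zeta> z) ` kernel_domain G. \<bar>y\<bar> \<le> C"
    unfolding bounded_iff by auto
  then have C: "\<bar>K \<zeta> z\<bar> \<le> C" if "\<zeta> \<in> G" "z \<in> W \<zeta>" for \<zeta> z
    using that by (cases \<zeta>, cases z) (auto simp: kernel_domain_def)
  show thesis by (rule that[of "\<bar>C\<bar>"]) (use C in \<open>force+\<close>)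
qed

text \<open>Two choices of \<open>c\<close> matter later: the constant \<open>z\<close>, and
  \<open>z\<close> with one coordinate replaced by that of the source, which gives the diagonal
  values on an edge.\<close>

lemma continuous_on_kernel_section:
  fixes K :: "real \<times> real \<Rightarrow> real \<times> real \<Rightarrow> real"
  assumes K: "continuous_on (kernel_domain G) (\<lambda>(\<zeta>, z). K \<zeta> z)"
    and c: "continuous_on UNIV c" "\<And>\<zeta>. \<zeta> \<in> E G z \<Longrightarrow> c \<zeta> \<in> W \<zeta>"
  shows "continuous_on (E G z) (\<lambda>\<zeta>. K \<zeta> (c \<zeta>))"
proof -
  have "continuous_on (E G z) (\<lambda>\<zeta>. (\<zeta>, c \<zeta>))"
    by (intro continuous_intros continuous_on_subset[OF c(1)]) auto
  moreover have "(\<lambda>\<zeta>. (\<zeta>, c \<zeta>)) ` E G z \<subseteq> kernel_domain G"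
    using c(2) by (fastforce simp: kernel_domain_def E_def)
  ultimately have "continuous_on (E G z) (\<lambda>\<zeta>. (\<lambda>(\<zeta>, z). K \<zeta> z) (\<zeta>, c \<zeta>))"
    by (rule continuous_on_compose2[OF K])
  then show ?thesis by simp
qed

text \<open>Cut off to the closed set \<open>E G z\<close>, the kernel is Borel and bounded, so
  integrability comes from the weight. This leaves the measure \<open>M\<close> free: it will be
  Lebesgue measure on the plane or on a line, or a point mass.\<close>

lemma integrable_layer:
  fixes K :: "real \<times> real \<Rightarrow> real \<times> real \<Rightarrow> real"
  assumes G: "compact G" and K: "continuous_on (kernel_domain G) (\<lambda>(\<zeta>, z). K \<zeta> z)"
    and \<pi>: "\<pi> \<in> borel_measurable M" and w: "integrable M w"
    and c: "continuous_on UNIV c" "\<And>\<zeta>. \<zeta> \<in> E G z \<Longrightarrow> c \<zeta> \<in> W \<zeta>"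
  shows "integrable M (\<lambda>\<omega>. if \<pi> \<omega> \<in> E G z then w \<omega> * K (\<pi> \<omega>) (c (\<pi> \<omega>)) else 0)"
proof -
  obtain C where C: "0 \<le> C" "\<And>\<zeta> z. \<zeta> \<in> G \<Longrightarrow> z \<in> W \<zeta> \<Longrightarrow> \<bar>K \<zeta> z\<bar> \<le> C"
    using kernel_bounded[OF G K] by blast
  define \<kappa> where "\<kappa> \<zeta> = (if \<zeta> \<in> E G z then K \<zeta> (c \<zeta>) else 0)" for \<zeta>
  have "continuous_on (E G z) (\<lambda>\<zeta>. K \<zeta> (c \<zeta>))"
    by (rule continuous_on_kernel_section[OF K c])
  then have [measurable]: "\<kappa> \<in> borel_measurable borel"
    unfolding \<kappa>_def by (intro borel_measurable_continuous_on_if closed_E[OF G] borel_closed) auto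
  have [measurable]: "\<pi> \<in> borel_measurable M" "w \<in> borel_measurable M" using \<pi> w by auto
  have "integrable M (\<lambda>\<omega>. w \<omega> * \<kappa> (\<pi> \<omega>))"
  proof (rule Bochner_Integration.integrable_bound[where f = "\<lambda>\<omega>. C * \<bar>w \<omega>\<bar>"])
    have "\<bar>\<kappa> \<zeta>\<bar> \<le> C" for \<zeta> using C c by (auto simp: \<kappa>_def E_def)
    then show "AE \<omega> in M. norm (w \<omega> * \<kappa> (\<pi> \<omega>)) \<le> norm (C * \<bar>w \<omega>\<bar>)"
      using C(1) by (intro AE_I2) (simp add: abs_mult mult.commute[of C] mult_left_mono)
  qed (use w in auto)
  moreover have "w \<omega> * \<kappa> (\<pi> \<omega>) = (if \<pi> \<omega> \<in> E G z then w \<omega> * K (\<pi> \<omega>) (c (\<pi> \<omega>)) else 0)" for \<omega>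
    by (simp add: \<kappa>_def)
  ultimately show ?thesis by simp
qed

text \<open>The moving-domain rule with the abscissa of the source as edge; the uniform bound on
  \<open>Ks\<close> makes the integrand Lipschitz in \<open>s\<close> with constant
  \<open>C * \<bar>w \<omega>\<bar>\<close>. The derivative \<open>D\<close> of the diagonal part
  stays a hypothesis because it depends on how the sources are distributed.\<close>

lemma layer_s_derivative:
  fixes K Ks :: "real \<times> real \<Rightarrow> real \<times> real \<Rightarrow> real"
  assumes G: "compact G" "\<And>z. z \<in> G \<Longrightarrow> 0 \<le> fst z \<and> 0 \<le> snd z"
    and K: "continuous_on (kernel_domain G) (\<lambda>(\<zeta>, z). K \<zeta> z)"
    and Ks: "continuous_on (kernel_domain G) (\<lambda>(\<zeta>, z). Ks \<zeta> z)"
    and der: "\<And>\<zeta> z. \<zeta> \<in> G \<Longrightarrow> z \<in> W \<zeta> \<Longrightarrow>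
      ((\<lambda>s. K \<zeta> (s, snd z)) has_real_derivative Ks \<zeta> z) (at (fst z) within {0..fst \<zeta>})"
    and \<pi>: "\<pi> \<in> borel_measurable M" and w: "integrable M w"
    and z: "(s0, t) \<in> G"
    and null: "AE \<omega> in M. fst (\<pi> \<omega>) \<noteq> s0"
    and slice: "((\<lambda>s. \<integral>\<omega>. (if \<pi> \<omega> \<in> E G (s, t) then w \<omega> * K (\<pi> \<omega>) (fst (\<pi> \<omega>), t) else 0) \<partial>M)
      has_real_derivative D) (at s0 within {s. (s, t) \<in> G})"
  shows "((\<lambda>s. \<integral>\<omega>. (if \<pi> \<omega> \<in> E G (s, t) then w \<omega> * K (\<pi> \<omega>) (s, t) else 0) \<partial>M)
      has_real_derivative (\<integral>\<omega>. (if \<pi> \<omega> \<in> E G (s0, t) then w \<omega> * Ks (\<pi> \<omega>) (s0, t) else 0) \<partial>M) + D)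
      (at s0 within {s. (s, t) \<in> G})"
proof -
  define S where "S = {s. (s, t) \<in> G}"
  have S: "s \<in> S \<Longrightarrow> 0 \<le> s" and t: "0 \<le> t" and s0: "s0 \<in> S" and S_iff: "s \<in> S \<longleftrightarrow> (s, t) \<in> G" for s
    using G(2) z by (force simp: S_def)+
  \<comment> \<open>Only the edge \<open>\<sigma> = s\<close> moves here. The condition from the
    other edge is fixed and is absorbed into the integrand, so that the cut-off becomes
    \<open>s \<le> h \<omega>\<close> alone.\<close>
  define A where "A \<omega> \<longleftrightarrow> \<pi> \<omega> \<in> G \<and> t \<le> snd (\<pi> \<omega>)" for \<omega>
  define k where "k \<omega> s = (if A \<omega> then w \<omega> * K (\<pi> \<omega>) (s, t) else 0)" for \<omega> s
  define k' where "k' \<omega> = (if A \<omega> then w \<omega> * Ks (\<pi> \<omega>) (s0, t) else 0)" for \<omega>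
  define h where "h \<omega> = fst (\<pi> \<omega>)" for \<omega>
  have k_eq: "(if s \<le> h \<omega> then k \<omega> s else 0) = (if \<pi> \<omega> \<in> E G (s, t) then w \<omega> * K (\<pi> \<omega>) (s, t) else 0)"
    and kd_eq: "(if s \<le> h \<omega> then k \<omega> (h \<omega>) else 0) = (if \<pi> \<omega> \<in> E G (s, t) then w \<omega> * K (\<pi> \<omega>) (fst (\<pi> \<omega>), t) else 0)"
    if "s \<in> S" for s \<omega>
    using S[OF that] t by (auto simp: k_def A_def h_def mem_E_iff)
  have k'_eq: "(if s0 \<le> h \<omega> then k' \<omega> else 0) = (if \<pi> \<omega> \<in> E G (s0, t) then w \<omega> * Ks (\<pi> \<omega>) (s0, t) else 0)" for \<omega>
    using S[OF s0] t by (auto simp: k'_def A_def h_def mem_E_iff)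
  obtain C where C: "0 \<le> C" "\<And>\<zeta> z. \<zeta> \<in> G \<Longrightarrow> z \<in> W \<zeta> \<Longrightarrow> \<bar>Ks \<zeta> z\<bar> \<le> C"
    using kernel_bounded[OF G(1) Ks] by blast
  have "((\<lambda>s. \<integral>\<omega>. (if s \<le> h \<omega> then k \<omega> s else 0) \<partial>M) has_real_derivative
      (\<integral>\<omega>. (if s0 \<le> h \<omega> then k' \<omega> else 0) \<partial>M) + D) (at s0 within S)"
  proof (rule has_real_derivative_moving_domain[where B = "\<lambda>\<omega>. C * \<bar>w \<omega>\<bar>"])
    show "h \<in> borel_measurable M" unfolding h_def
      by (rule measurable_compose[OF \<pi>]) (intro borel_measurable_continuous_onI continuous_intros)
    show "integrable M (\<lambda>\<omega>. if s \<le> h \<omega> then k \<omega> s else 0)" if "s \<in> S" for s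
      unfolding k_eq[OF that] using S[OF that] t
      by (intro integrable_layer[OF G(1) K \<pi> w]) (auto simp: mem_E_iff mem_W_iff)
    show "integrable M (\<lambda>\<omega>. if s \<le> h \<omega> then k \<omega> (h \<omega>) else 0)" if "s \<in> S" for s
      unfolding kd_eq[OF that] using S[OF that] t
      by (intro integrable_layer[OF G(1) K \<pi> w, where c = "\<lambda>\<zeta>. (fst \<zeta>, t)"])
         (auto simp: mem_E_iff mem_W_iff intro!: continuous_intros)
    show "\<bar>k \<omega> s - k \<omega> s'\<bar> \<le> C * \<bar>w \<omega>\<bar> * \<bar>s - s'\<bar>"
      if "\<omega> \<in> space M" "s \<in> S \<union> {h \<omega>}" "s' \<in> S \<union> {h \<omega>}" "s \<le> h \<omega>" "s' \<le> h \<omega>" for \<omega> s s'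
    proof (cases "A \<omega>")
      case True
      then have Gw: "\<pi> \<omega> \<in> G" "t \<le> snd (\<pi> \<omega>)" by (auto simp: A_def)
      have "0 \<le> h \<omega>" using G(2)[OF Gw(1)] by (simp add: h_def)
      then have ss: "s \<in> {0..fst (\<pi> \<omega>)}" "s' \<in> {0..fst (\<pi> \<omega>)}" using that S by (auto simp: h_def)
      \<comment> \<open>Mean value estimate in the second argument; the interval is convex and
        reaches up to the edge, so the diagonal value is covered as well.\<close>
      have "norm (K (\<pi> \<omega>) (s, t) - K (\<pi> \<omega>) (s', t)) \<le> C * norm (s - s')"
      proof (rule field_differentiable_bound[where S = "{0..fst (\<pi> \<omega>)}" and f' = "\<lambda>s. Ks (\<pi> \<omega>) (s, t)"])
        show "((\<lambda>s. K (\<pi> \<omega>) (s, t)) has_real_derivative Ks (\<pi> \<omega>) (x, t)) (at x within {0..fst (\<pi> \<omega>)})"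
          if "x \<in> {0..fst (\<pi> \<omega>)}" for x
          using der[OF Gw(1), of "(x, t)"] that Gw t by (simp add: mem_W_iff)
        show "norm (Ks (\<pi> \<omega>) (x, t)) \<le> C" if "x \<in> {0..fst (\<pi> \<omega>)}" for x
          using C(2)[OF Gw(1), of "(x, t)"] that Gw t by (simp add: mem_W_iff)
      qed (use ss in auto)
      then have "\<bar>w \<omega>\<bar> * \<bar>K (\<pi> \<omega>) (s, t) - K (\<pi> \<omega>) (s', t)\<bar> \<le> \<bar>w \<omega>\<bar> * (C * \<bar>s - s'\<bar>)"
        by (intro mult_left_mono) auto
      then show ?thesis using True by (simp add: k_def abs_mult[symmetric] algebra_simps)
    next
      case False
      then show ?thesis using C by (simp add: k_def)
    qed
    show "AE \<omega> in M. s0 < h \<omega> \<longrightarrow> (k \<omega> has_real_derivative k' \<omega>) (at s0 within S)"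
    proof (intro AE_I2 impI)
      fix \<omega> assume lt: "s0 < h \<omega>"
      show "(k \<omega> has_real_derivative k' \<omega>) (at s0 within S)"
      proof (cases "A \<omega>")
        case True
        then have Gw: "\<pi> \<omega> \<in> G" "t \<le> snd (\<pi> \<omega>)" by (auto simp: A_def)
        have "((\<lambda>s. K (\<pi> \<omega>) (s, t)) has_real_derivative Ks (\<pi> \<omega>) (s0, t)) (at s0 within {0..fst (\<pi> \<omega>)})"
          using der[OF Gw(1), of "(s0, t)"] Gw t lt S[OF s0] by (simp add: mem_W_iff h_def)
        \<comment> \<open>Near \<open>s0 < fst (\<pi> \<omega>)\<close> the upper bound of the
          interval is inactive, so the derivative carries over to the section of
          \<open>G\<close>.\<close>
        then have "((\<lambda>s. K (\<pi> \<omega>) (s, t)) has_real_derivative Ks (\<pi> \<omega>) (s0, t)) (at s0 within S \<inter> {..<fst (\<pi> \<omega>)})"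
          by (rule has_field_derivative_subset) (use S in auto)
        also have "at s0 within S \<inter> {..<fst (\<pi> \<omega>)} = at s0 within S"
          by (rule at_within_nhd[where S = "{..<fst (\<pi> \<omega>)}"]) (use lt in \<open>auto simp: h_def\<close>)
        finally show ?thesis using True unfolding k_def[abs_def] k'_def
          by (auto intro!: derivative_eq_intros)
      next
        case False
        then show ?thesis by (simp add: k_def[abs_def] k'_def)
      qed
    qed
    show "(\<lambda>\<omega>. if s0 \<le> h \<omega> then k' \<omega> else 0) \<in> borel_measurable M"
      unfolding k'_eq using S[OF s0] t
      by (intro borel_measurable_integrable integrable_layer[OF G(1) Ks \<pi> w]) (auto simp: mem_E_iff mem_W_iff)
    show "((\<lambda>s. \<integral>\<omega>. (if s \<le> h \<omega> then k \<omega> (h \<omega>) else 0) \<partial>M) has_real_derivative D) (at s0 within S)"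
      by (rule has_field_derivative_transform_within[OF slice[folded S_def], where d = 1])
        (use s0 kd_eq in auto)
  qed (use s0 w C null in \<open>auto simp: h_def\<close>)
  then show ?thesis unfolding S_def[symmetric] k'_eq
    by (rule has_field_derivative_transform_within[where d = 1]) (use s0 k_eq in auto)
qed

lemma continuous_on_kernel_swap:
  fixes K :: "real \<times> real \<Rightarrow> real \<times> real \<Rightarrow> real"
  assumes "continuous_on (kernel_domain G) (\<lambda>(\<zeta>, z). K \<zeta> z)"
  shows "continuous_on (kernel_domain (prod.swap ` G)) (\<lambda>(\<zeta>, z). K (prod.swap \<zeta>) (prod.swap z))"
proof -
  have "continuous_on (kernel_domain (prod.swap ` G))
      (\<lambda>p. (\<lambda>(\<zeta>, z). K \<zeta> z) (prod.swap (fst p), prod.swap (snd p)))"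
    unfolding prod.swap_def
    by (rule continuous_on_compose2[OF assms])
      (auto simp: kernel_domain_def mem_W_iff intro!: continuous_intros)
  then show ?thesis by (simp add: case_prod_unfold)
qed

text \<open>Reflection in the diagonal: swapping the coordinates of sources and points preserves
  \<open>z \<in> W \<zeta>\<close> and exchanges the two edges, so the rule for \<open>s\<close>
  applied to the mirrored region gives this one.\<close>

lemma layer_t_derivative:
  fixes K Kt :: "real \<times> real \<Rightarrow> real \<times> real \<Rightarrow> real"
  assumes G: "compact G" "\<And>z. z \<in> G \<Longrightarrow> 0 \<le> fst z \<and> 0 \<le> snd z"
    and K: "continuous_on (kernel_domain G) (\<lambda>(\<zeta>, z). K \<zeta> z)"
    and Kt: "continuous_on (kernel_domain G) (\<lambda>(\<zeta>, z). Kt \<zeta> z)"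
    and der: "\<And>\<zeta> z. \<zeta> \<in> G \<Longrightarrow> z \<in> W \<zeta> \<Longrightarrow>
      ((\<lambda>t. K \<zeta> (fst z, t)) has_real_derivative Kt \<zeta> z) (at (snd z) within {0..snd \<zeta>})"
    and \<pi>: "\<pi> \<in> borel_measurable M" and w: "integrable M w"
    and z: "(s, t0) \<in> G"
    and null: "AE \<omega> in M. snd (\<pi> \<omega>) \<noteq> t0"
    and slice: "((\<lambda>t. \<integral>\<omega>. (if \<pi> \<omega> \<in> E G (s, t) then w \<omega> * K (\<pi> \<omega>) (s, snd (\<pi> \<omega>)) else 0) \<partial>M)
      has_real_derivative D) (at t0 within {t. (s, t) \<in> G})"
  shows "((\<lambda>t. \<integral>\<omega>. (if \<pi> \<omega> \<in> E G (s, t) then w \<omega> * K (\<pi> \<omega>) (s, t) else 0) \<partial>M)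
      has_real_derivative (\<integral>\<omega>. (if \<pi> \<omega> \<in> E G (s, t0) then w \<omega> * Kt (\<pi> \<omega>) (s, t0) else 0) \<partial>M) + D)
      (at t0 within {t. (s, t) \<in> G})"
proof -
  have G_swap: "prod.swap z \<in> prod.swap ` G \<longleftrightarrow> z \<in> G" "(a, b) \<in> prod.swap ` G \<longleftrightarrow> (b, a) \<in> G" for z :: "real \<times> real" and a b
    by (cases z) force+
  have E_swap: "prod.swap \<zeta> \<in> E (prod.swap ` G) (a, b) \<longleftrightarrow> \<zeta> \<in> E G (b, a)" for \<zeta> a b
    by (auto simp: mem_E_iff G_swap)
  have "compact (prod.swap ` G)"
    using G(1) unfolding prod.swap_def by (intro compact_continuous_image continuous_intros)
  moreover have "(\<lambda>\<omega>. prod.swap (\<pi> \<omega>)) \<in> borel_measurable M"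
    unfolding prod.swap_def
    by (rule measurable_compose[OF \<pi>]) (intro borel_measurable_continuous_onI continuous_intros)
  ultimately have "((\<lambda>t. \<integral>\<omega>. (if prod.swap (\<pi> \<omega>) \<in> E (prod.swap ` G) (t, s)
        then w \<omega> * K (prod.swap (prod.swap (\<pi> \<omega>))) (prod.swap (t, s)) else 0) \<partial>M)
      has_real_derivative (\<integral>\<omega>. (if prod.swap (\<pi> \<omega>) \<in> E (prod.swap ` G) (t0, s)
        then w \<omega> * Kt (prod.swap (prod.swap (\<pi> \<omega>))) (prod.swap (t0, s)) else 0) \<partial>M) + D)
      (at t0 within {t. (t, s) \<in> prod.swap ` G})"
  proof (intro layer_s_derivative[where K = "\<lambda>\<zeta> z. K (prod.swap \<zeta>) (prod.swap z)"
        and Ks = "\<lambda>\<zeta> z. Kt (prod.swap \<zeta>) (prod.swap z)"]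
      continuous_on_kernel_swap K Kt w)
    show "0 \<le> fst z \<and> 0 \<le> snd z" if "z \<in> prod.swap ` G" for z
      using that G(2) by auto
    show "((\<lambda>s. K (prod.swap \<zeta>) (prod.swap (s, snd z))) has_real_derivative Kt (prod.swap \<zeta>) (prod.swap z))
        (at (fst z) within {0..fst \<zeta>})" if "\<zeta> \<in> prod.swap ` G" "z \<in> W \<zeta>" for \<zeta> z
      using der[of "prod.swap \<zeta>" "prod.swap z"] that by (auto simp: mem_W_iff)
    show "(t0, s) \<in> prod.swap ` G" using z by (simp add: G_swap)
    show "AE \<omega> in M. fst (prod.swap (\<pi> \<omega>)) \<noteq> t0" using null by simp
    show "((\<lambda>t. \<integral>\<omega>. (if prod.swap (\<pi> \<omega>) \<in> E (prod.swap ` G) (t, s)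
        then w \<omega> * K (prod.swap (prod.swap (\<pi> \<omega>))) (prod.swap (fst (prod.swap (\<pi> \<omega>)), s)) else 0) \<partial>M)
      has_real_derivative D) (at t0 within {t. (t, s) \<in> prod.swap ` G})"
      using slice by (simp add: E_swap G_swap cong: if_cong)
  qed
  then show ?thesis by (simp add: E_swap G_swap cong: if_cong)
qed

text \<open>The fundamental theorem followed by the chain rule. Continuity of
  \<open>\<kappa>\<close> is asked at the end point only, because the weight on the curve may jump
  at vertices; the outer derivative is taken within the image of \<open>S\<close> under
  \<open>m\<close>, so that one-sided sections are allowed.\<close>

lemma has_real_derivative_upper_limit:
  fixes \<kappa> m :: "real \<Rightarrow> real"
  assumes \<kappa>: "set_integrable lborel {A..B} \<kappa>"
    and cont: "continuous (at (m s0) within {A..B}) \<kappa>"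
    and m: "(m has_real_derivative m') (at s0 within S)" "\<And>s. s \<in> S \<Longrightarrow> m s \<in> {A..B}" "s0 \<in> S"
  shows "((\<lambda>s. LINT \<mu>:{A..m s}|lborel. \<kappa> \<mu>) has_real_derivative \<kappa> (m s0) * m') (at s0 within S)"
proof -
  have "((\<lambda>u. integral {A..u} \<kappa>) has_vector_derivative \<kappa> (m s0)) (at (m s0) within {A..B} - {})"
    by (rule integral_has_vector_derivative_continuous_at)
      (use set_borel_integral_eq_integral(1)[OF \<kappa>] m cont in auto)
  then have "((\<lambda>u. integral {A..u} \<kappa>) has_real_derivative \<kappa> (m s0)) (at (m s0) within m ` S)"
    using m(2) by (auto simp: has_real_derivative_iff_has_vector_derivative
        intro: has_vector_derivative_within_subset)
  from DERIV_image_chain[OF this m(1)]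
  have "((\<lambda>s. integral {A..m s} \<kappa>) has_real_derivative \<kappa> (m s0) * m') (at s0 within S)"
    by (simp add: o_def)
  then show ?thesis
  proof (rule has_field_derivative_transform_within[OF _ zero_less_one m(3)])
    fix s assume "s \<in> S"
    then have "set_integrable lborel {A..m s} \<kappa>"
      using m(2) by (intro set_integrable_subset[OF \<kappa>]) auto
    then show "integral {A..m s} \<kappa> = (LINT \<mu>:{A..m s}|lborel. \<kappa> \<mu>)"
      by (simp add: set_borel_integral_eq_integral)
  qed
qed

lemma has_real_derivative_lower_limit:
  fixes \<kappa> m :: "real \<Rightarrow> real"
  assumes \<kappa>: "set_integrable lborel {A..B} \<kappa>"
    and cont: "continuous (at (m s0) within {A..B}) \<kappa>"
    and m: "(m has_real_derivative m') (at s0 within S)" "\<And>s. s \<in> S \<Longrightarrow> m s \<in> {A..B}" "s0 \<in> S"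
  shows "((\<lambda>s. LINT \<mu>:{m s..B}|lborel. \<kappa> \<mu>) has_real_derivative - (\<kappa> (m s0) * m')) (at s0 within S)"
proof -
  have "((\<lambda>s. (LINT \<mu>:{A..B}|lborel. \<kappa> \<mu>) - (LINT \<mu>:{A..m s}|lborel. \<kappa> \<mu>))
      has_real_derivative 0 - \<kappa> (m s0) * m') (at s0 within S)"
    by (intro DERIV_diff DERIV_const has_real_derivative_upper_limit[where B = B] assms)
  then have "((\<lambda>s. LINT \<mu>:{m s..B}|lborel. \<kappa> \<mu>) has_real_derivative 0 - \<kappa> (m s0) * m') (at s0 within S)"
  proof (rule has_field_derivative_transform_within[OF _ zero_less_one m(3)])
    fix s assume s: "s \<in> S"
    have "set_integrable lborel {A..m s} \<kappa>" "set_integrable lborel {m s..B} \<kappa>"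
      using m(2)[OF s] by (auto intro: set_integrable_subset[OF \<kappa>])
    moreover have "integral {A..m s} \<kappa> + integral {m s..B} \<kappa> = integral {A..B} \<kappa>"
      using m(2)[OF s] set_borel_integral_eq_integral(1)[OF \<kappa>]
      by (intro Henstock_Kurzweil_Integration.integral_combine) auto
    ultimately show "(LINT \<mu>:{A..B}|lborel. \<kappa> \<mu>) - (LINT \<mu>:{A..m s}|lborel. \<kappa> \<mu>) = (LINT \<mu>:{m s..B}|lborel. \<kappa> \<mu>)"
      using \<kappa> by (simp add: set_borel_integral_eq_integral)
  qed
  then show ?thesis by simp
qed

section \<open>Area integrals over moving half-planes\<close>

lemma integrable_bounded_support:
  fixes f :: "'a::euclidean_space \<Rightarrow> real"
  assumes "f \<in> borel_measurable borel" "\<And>z. \<bar>f z\<bar> \<le> C" "\<And>z. z \<notin> cbox p q \<Longrightarrow> f z = 0"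
  shows "integrable lborel f"
  by (rule integrableI_bounded_set[where A = "cbox p q" and B = C])
    (use assms in \<open>auto simp: emeasure_lborel_cbox_eq\<close>)

text \<open>By Fubini the area integral is the integral of the line integrals \<open>Q\<close> from
  \<open>s\<close> on, so the point is continuity of \<open>Q\<close> at \<open>s0\<close>.
  Dominated convergence gives it even if \<open>f\<close> jumps, provided \<open>f\<close> is
  continuous at almost every point of the line \<open>\<sigma> = s0\<close>.\<close>

lemma half_plane_derivative_fst:
  fixes f :: "real \<times> real \<Rightarrow> real"
  assumes f: "f \<in> borel_measurable borel" "\<And>z. \<bar>f z\<bar> \<le> C" "\<And>z. z \<notin> cbox p q \<Longrightarrow> f z = 0"
    and cont: "AE t in lborel. isCont f (s0, t)"
  shows "((\<lambda>s. \<integral>z. (if s \<le> fst z then f z else 0) \<partial>lborel) has_real_derivative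
      - (\<integral>t. f (s0, t) \<partial>lborel)) (at s0)"
proof -
  have [measurable]: "f \<in> borel_measurable (borel \<Otimes>\<^sub>M borel)" "f \<in> borel_measurable (lborel \<Otimes>\<^sub>M lborel)"
    using f(1) by (simp_all add: borel_prod[symmetric] cong: measurable_cong_sets)
  define Q where "Q s = (\<integral>t. f (s, t) \<partial>lborel)" for s
  have int: "integrable (lborel \<Otimes>\<^sub>M lborel) f"
    unfolding lborel_prod using f by (rule integrable_bounded_support)
  have outside: "f (s, t) = 0" if "s \<notin> {fst p..fst q} \<or> t \<notin> {snd p..snd q}" for s t
    using that f(3)[of "(s, t)"] by (cases p, cases q) (auto simp: cbox_Pair_eq)
  have Q_int: "integrable lborel Q"
    unfolding Q_def using lborel_pair.integrable_fst'[OF int] .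
  have Q_cont: "isCont Q s0"
    unfolding continuous_at_sequentially o_def
  proof (intro allI impI)
    fix X assume X: "X \<longlonglongrightarrow> s0"
    show "(\<lambda>n. Q (X n)) \<longlonglongrightarrow> Q s0"
      unfolding Q_def
    proof (rule integral_dominated_convergence[where w = "\<lambda>t. C * indicator {snd p..snd q} t"])
      show "AE t in lborel. (\<lambda>n. f (X n, t)) \<longlonglongrightarrow> f (s0, t)"
        using cont
      proof eventually_elim
        case (elim t)
        show ?case by (rule isCont_tendsto_compose[OF elim]) (intro tendsto_Pair X tendsto_const)
      qed
      show "AE t in lborel. norm (f (X n, t)) \<le> C * indicator {snd p..snd q} t" for n
        using f(2)[of "(X n, t)" for t] outside[of "X n"] by (intro AE_I2) (auto simp: indicator_def)
      show "integrable lborel (\<lambda>t. C * indicator {snd p..snd q} t)"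
        by (intro integrable_mult_right integrable_real_indicator) (auto simp: emeasure_lborel_Icc_eq)
    qed measurable
  qed
  define A where "A = s0 - 1"
  \<comment> \<open>\<open>B\<close> lies beyond the support, so cutting off there changes nothing,
    and at least 1 beyond \<open>s0\<close>, so the limit \<open>s\<close> can move to both sides of
    \<open>s0\<close> within \<open>{A..B}\<close>.\<close>
  define B where "B = max (fst q) (s0 + 1)"
  have Q0: "Q s = 0" if "s > B" for s
    using that outside[of s] by (simp add: Q_def B_def)
  have "((\<lambda>s. LINT x:{s..B}|lborel. Q x) has_real_derivative - (Q s0 * 1)) (at s0 within {s0 - 1<..<s0 + 1})"
  proof (rule has_real_derivative_lower_limit)
    show "set_integrable lborel {A..B} Q"
      unfolding set_integrable_def using Q_int by (intro integrable_mult_indicator) auto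
  qed (use Q_cont in \<open>auto simp: A_def B_def intro: continuous_at_imp_continuous_at_within\<close>)
  then have "((\<lambda>s. LINT x:{s..B}|lborel. Q x) has_real_derivative - Q s0) (at s0)"
    by (simp add: at_within_open[of s0 "{s0 - 1<..<s0 + 1}"])
  then have "((\<lambda>s. \<integral>z. (if s \<le> fst z then f z else 0) \<partial>lborel) has_real_derivative - Q s0) (at s0)"
  proof (rule has_field_derivative_transform_within[OF _ zero_less_one UNIV_I])
    fix s
    have "integrable (lborel \<Otimes>\<^sub>M lborel) (\<lambda>z. if s \<le> fst z then f z else 0)"
      by (rule Bochner_Integration.integrable_bound[OF int]) auto
    from lborel_pair.integral_fst'[OF this]
    have "(\<integral>z. (if s \<le> fst z then f z else 0) \<partial>lborel) = (\<integral>x. (\<integral>t. (if s \<le> x then f (x, t) else 0) \<partial>lborel) \<partial>lborel)"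
      by (simp add: lborel_prod)
    also have "\<dots> = (\<integral>x. (if s \<le> x then Q x else 0) \<partial>lborel)"
      by (intro Bochner_Integration.integral_cong) (simp_all add: Q_def)
    also have "\<dots> = (LINT x:{s..B}|lborel. Q x)"
      unfolding set_lebesgue_integral_def
      by (intro Bochner_Integration.integral_cong) (use Q0 in \<open>auto simp: indicator_def\<close>)
    finally show "(LINT x:{s..B}|lborel. Q x) = (\<integral>z. (if s \<le> fst z then f z else 0) \<partial>lborel)" ..
  qed
  then show ?thesis by (simp add: Q_def)
qed

text \<open>Follows from the case of vertical lines, since Lebesgue measure on the plane is
  invariant under swapping the coordinates.\<close>

lemma half_plane_derivative_snd:
  fixes f :: "real \<times> real \<Rightarrow> real"
  assumes f: "f \<in> borel_measurable borel" "\<And>z. \<bar>f z\<bar> \<le> C" "\<And>z. z \<notin> cbox p q \<Longrightarrow> f z = 0"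
    and cont: "AE s in lborel. isCont f (s, t0)"
  shows "((\<lambda>t. \<integral>z. (if t \<le> snd z then f z else 0) \<partial>lborel) has_real_derivative
      - (\<integral>s. f (s, t0) \<partial>lborel)) (at t0)"
proof -
  have swap: "continuous_on UNIV (prod.swap :: real \<times> real \<Rightarrow> _)"
    unfolding prod.swap_def by (intro continuous_intros)
  have [measurable]: "(\<lambda>z. f (prod.swap z)) \<in> borel_measurable borel"
    by (rule measurable_compose[OF borel_measurable_continuous_onI[OF swap] f(1)])
  have [measurable]: "f \<in> borel_measurable (lborel \<Otimes>\<^sub>M lborel)"
    using f(1) by (simp add: borel_prod[symmetric] cong: measurable_cong_sets)
  have "((\<lambda>t. \<integral>z. (if t \<le> fst z then f (prod.swap z) else 0) \<partial>lborel) has_real_derivative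
      - (\<integral>s. f (prod.swap (t0, s)) \<partial>lborel)) (at t0)"
  proof (rule half_plane_derivative_fst[where C = C and p = "prod.swap p" and q = "prod.swap q"])
    show "f (prod.swap z) = 0" if "z \<notin> cbox (prod.swap p) (prod.swap q)" for z
      using that f(3)[of "prod.swap z"] by (cases p, cases q, cases z) (auto simp: cbox_Pair_eq)
    show "AE s in lborel. isCont (\<lambda>z. f (prod.swap z)) (t0, s)"
      using cont
    proof eventually_elim
      case (elim s)
      have "isCont (prod.swap :: real \<times> real \<Rightarrow> _) (t0, s)"
        unfolding prod.swap_def by (intro continuous_intros)
      then show ?case by (rule isCont_o2[where g = f]) (simp add: elim)
    qed
  qed (use f(2) in auto)
  moreover have "(\<integral>z. (if t \<le> fst z then f (prod.swap z) else 0) \<partial>lborel)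
      = (\<integral>z. (if t \<le> snd z then f z else 0) \<partial>lborel)" for t
  proof -
    have "(\<integral>z. (case z of (x, y) \<Rightarrow> if t \<le> snd (y, x) then f (y, x) else 0) \<partial>(lborel \<Otimes>\<^sub>M lborel))
       = (\<integral>z. (if t \<le> snd z then f z else 0) \<partial>(lborel \<Otimes>\<^sub>M lborel))"
      by (rule lborel_pair.integral_product_swap) measurable
    then show ?thesis by (simp add: lborel_prod case_prod_unfold prod.swap_def cong: if_cong)
  qed
  ultimately show ?thesis by simp
qed

section \<open>Superposition of source terms\<close>

text \<open>The coefficient arguments are values at \<open>z0\<close>: \<open>fps\<close> and \<open>fqt\<close> stand for
  \<open>D/Ds f\<^sub>p\<close> and \<open>D/Dt f\<^sub>q\<close>, so the last clause is
  \<open>T\<^sub>s\<^sub>t = \<phi> + f\<^sub>x T - D/Ds (f\<^sub>p T) - D/Dt (f\<^sub>q T)\<close> with the product rule carried out.\<close>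

definition adjoint_solution :: "(real \<times> real) set \<Rightarrow> real \<times> real \<Rightarrow>
    ('n::finite \<Rightarrow> 'n \<Rightarrow> real) \<Rightarrow> ('n \<Rightarrow> 'n \<Rightarrow> real) \<Rightarrow> ('n \<Rightarrow> 'n \<Rightarrow> real) \<Rightarrow> ('n \<Rightarrow> 'n \<Rightarrow> real) \<Rightarrow>
    ('n \<Rightarrow> 'n \<Rightarrow> real) \<Rightarrow> ('n \<Rightarrow> real \<times> real \<Rightarrow> real) \<Rightarrow> ('n \<Rightarrow> real) \<Rightarrow> bool" where
  "adjoint_solution G z0 fx fp fps fq fqt T \<phi> \<longleftrightarrow> (\<exists>Tt Ts Tst.
     (\<forall>\<^sub>F z in nhds z0. z \<in> G \<longrightarrow> (\<forall>j.
        ((\<lambda>t. T j (fst z, t)) has_real_derivative Tt j z) (at (snd z) within {t. (fst z, t) \<in> G}))) \<and>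
     (\<forall>j. ((\<lambda>s. T j (s, snd z0)) has_real_derivative Ts j) (at (fst z0) within {s. (s, snd z0) \<in> G})) \<and>
     (\<forall>j. ((\<lambda>s. Tt j (s, snd z0)) has_real_derivative Tst j) (at (fst z0) within {s. (s, snd z0) \<in> G})) \<and>
     (\<forall>j. Tst j = \<phi> j + (\<Sum>k\<in>UNIV. fx k j * T k z0)
        - (\<Sum>k\<in>UNIV. fps k j * T k z0 + fp k j * Ts k)
        - (\<Sum>k\<in>UNIV. fqt k j * T k z0 + fq k j * Tt k z0)))"

lemma adjoint_solution_zero: "adjoint_solution G z0 fx fp fps fq fqt (\<lambda>_ _. 0) (\<lambda>_. 0)"
  unfolding adjoint_solution_def
  by (intro exI[of _ "\<lambda>_ _. 0"] exI[of _ "\<lambda>_. 0"]) auto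

lemma adjoint_solution_add:
  assumes "adjoint_solution G z0 fx fp fps fq fqt T \<phi>" "adjoint_solution G z0 fx fp fps fq fqt T' \<phi>'"
  shows "adjoint_solution G z0 fx fp fps fq fqt (\<lambda>j z. T j z + T' j z) (\<lambda>j. \<phi> j + \<phi>' j)"
proof -
  from assms obtain Tt Ts Tst Tt' Ts' Tst' where
    T: "\<forall>\<^sub>F z in nhds z0. z \<in> G \<longrightarrow> (\<forall>j.
        ((\<lambda>t. T j (fst z, t)) has_real_derivative Tt j z) (at (snd z) within {t. (fst z, t) \<in> G}))"
     "\<And>j. ((\<lambda>s. T j (s, snd z0)) has_real_derivative Ts j) (at (fst z0) within {s. (s, snd z0) \<in> G})"
     "\<And>j. ((\<lambda>s. Tt j (s, snd z0)) has_real_derivative Tst j) (at (fst z0) within {s. (s, snd z0) \<in> G})"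
     "\<And>j. Tst j = \<phi> j + (\<Sum>k\<in>UNIV. fx k j * T k z0)
        - (\<Sum>k\<in>UNIV. fps k j * T k z0 + fp k j * Ts k)
        - (\<Sum>k\<in>UNIV. fqt k j * T k z0 + fq k j * Tt k z0)"
   and T': "\<forall>\<^sub>F z in nhds z0. z \<in> G \<longrightarrow> (\<forall>j.
        ((\<lambda>t. T' j (fst z, t)) has_real_derivative Tt' j z) (at (snd z) within {t. (fst z, t) \<in> G}))"
     "\<And>j. ((\<lambda>s. T' j (s, snd z0)) has_real_derivative Ts' j) (at (fst z0) within {s. (s, snd z0) \<in> G})"
     "\<And>j. ((\<lambda>s. Tt' j (s, snd z0)) has_real_derivative Tst' j) (at (fst z0) within {s. (s, snd z0) \<in> G})"
     "\<And>j. Tst' j = \<phi>' j + (\<Sum>k\<in>UNIV. fx k j * T' k z0)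
        - (\<Sum>k\<in>UNIV. fps k j * T' k z0 + fp k j * Ts' k)
        - (\<Sum>k\<in>UNIV. fqt k j * T' k z0 + fq k j * Tt' k z0)"
    unfolding adjoint_solution_def by blast
  show ?thesis unfolding adjoint_solution_def
  proof (intro exI conjI allI)
    show "\<forall>\<^sub>F z in nhds z0. z \<in> G \<longrightarrow> (\<forall>j. ((\<lambda>t. T j (fst z, t) + T' j (fst z, t))
        has_real_derivative Tt j z + Tt' j z) (at (snd z) within {t. (fst z, t) \<in> G}))"
      using T(1) T'(1) by eventually_elim (auto intro: DERIV_add)
    show "((\<lambda>s. T j (s, snd z0) + T' j (s, snd z0)) has_real_derivative Ts j + Ts' j)
        (at (fst z0) within {s. (s, snd z0) \<in> G})" for j
      using T(2) T'(2) by (rule DERIV_add)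
    show "((\<lambda>s. Tt j (s, snd z0) + Tt' j (s, snd z0)) has_real_derivative Tst j + Tst' j)
        (at (fst z0) within {s. (s, snd z0) \<in> G})" for j
      using T(3) T'(3) by (rule DERIV_add)
    show "Tst j + Tst' j = \<phi> j + \<phi>' j + (\<Sum>k\<in>UNIV. fx k j * (T k z0 + T' k z0))
        - (\<Sum>k\<in>UNIV. fps k j * (T k z0 + T' k z0) + fp k j * (Ts k + Ts' k))
        - (\<Sum>k\<in>UNIV. fqt k j * (T k z0 + T' k z0) + fq k j * (Tt k z0 + Tt' k z0))" for j
      unfolding T(4) T'(4) by (simp add: sum.distrib algebra_simps)
  qed
qed

lemma adjoint_solution_sum:
  assumes "finite A" "\<And>a. a \<in> A \<Longrightarrow> adjoint_solution G z0 fx fp fps fq fqt (T a) (\<phi> a)"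
  shows "adjoint_solution G z0 fx fp fps fq fqt (\<lambda>j z. \<Sum>a\<in>A. T a j z) (\<lambda>j. \<Sum>a\<in>A. \<phi> a j)"
  using assms
  by (induction A rule: finite_induct) (auto intro: adjoint_solution_zero adjoint_solution_add)

text \<open>\<open>r j\<close> is meant to be one row of the Riemann function, with the upper index
  fixed and the source as first argument. In the adjoint problem the summation runs over the lower
  index, so each row satisfies a closed system by itself. The differential equation is imposed at
  \<open>z0\<close> only, for sources strictly dominating it in both coordinates; on the two edges
  through \<open>z0\<close> first-order conditions take its place.\<close>

locale adjoint_kernel =
  fixes G :: "(real \<times> real) set"
    and r rs rt rst :: "'n::finite \<Rightarrow> real \<times> real \<Rightarrow> real \<times> real \<Rightarrow> real"
    and z0 :: "real \<times> real" and fx fp fps fq fqt :: "'n \<Rightarrow> 'n \<Rightarrow> real"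
  assumes compact: "compact G" and nonneg: "\<And>z. z \<in> G \<Longrightarrow> 0 \<le> fst z \<and> 0 \<le> snd z"
    and cont: "\<And>j. continuous_on (kernel_domain G) (\<lambda>(\<zeta>, z). r j \<zeta> z)"
      "\<And>j. continuous_on (kernel_domain G) (\<lambda>(\<zeta>, z). rs j \<zeta> z)"
      "\<And>j. continuous_on (kernel_domain G) (\<lambda>(\<zeta>, z). rt j \<zeta> z)"
      "\<And>j. continuous_on (kernel_domain G) (\<lambda>(\<zeta>, z). rst j \<zeta> z)"
    and r_s: "\<And>j \<zeta> z. \<zeta> \<in> G \<Longrightarrow> z \<in> W \<zeta> \<Longrightarrow>
      ((\<lambda>s. r j \<zeta> (s, snd z)) has_real_derivative rs j \<zeta> z) (at (fst z) within {0..fst \<zeta>})"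
    and r_t: "\<And>j \<zeta> z. \<zeta> \<in> G \<Longrightarrow> z \<in> W \<zeta> \<Longrightarrow>
      ((\<lambda>t. r j \<zeta> (fst z, t)) has_real_derivative rt j \<zeta> z) (at (snd z) within {0..snd \<zeta>})"
    and rt_s: "\<And>j \<zeta> z. \<zeta> \<in> G \<Longrightarrow> z \<in> W \<zeta> \<Longrightarrow>
      ((\<lambda>s. rt j \<zeta> (s, snd z)) has_real_derivative rst j \<zeta> z) (at (fst z) within {0..fst \<zeta>})"
    and z0: "z0 \<in> G"
    and pde: "\<And>j \<zeta>. \<zeta> \<in> E G z0 \<Longrightarrow> fst z0 < fst \<zeta> \<Longrightarrow> snd z0 < snd \<zeta> \<Longrightarrow> rst j \<zeta> z0 =
        (\<Sum>k\<in>UNIV. fx k j * r k \<zeta> z0)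
        - (\<Sum>k\<in>UNIV. fps k j * r k \<zeta> z0 + fp k j * rs k \<zeta> z0)
        - (\<Sum>k\<in>UNIV. fqt k j * r k \<zeta> z0 + fq k j * rt k \<zeta> z0)"
    and edge_s: "\<And>j \<zeta>. \<zeta> \<in> E G z0 \<Longrightarrow> fst \<zeta> = fst z0 \<Longrightarrow> rt j \<zeta> z0 = - (\<Sum>k\<in>UNIV. fp k j * r k \<zeta> z0)"
    and edge_t: "\<And>j \<zeta>. \<zeta> \<in> E G z0 \<Longrightarrow> snd \<zeta> = snd z0 \<Longrightarrow> rs j \<zeta> z0 = - (\<Sum>k\<in>UNIV. fq k j * r k \<zeta> z0)"
begin

text \<open>A source term is a weight \<open>w\<close> carried by points \<open>\<pi> \<omega>\<close>.  The two lower edges of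
  \<open>E G z\<close> move with \<open>z\<close>; \<open>\<alpha> K\<close> is the contribution of the edge \<open>\<sigma> = s\<close> at \<open>z0\<close> for the kernel
  \<open>K\<close>, and \<open>\<beta>\<close> that of the edge \<open>\<tau> = t\<close> for the Riemann function.  The edge conditions of the
  adjoint problem turn \<open>\<alpha> r\<^sub>t\<close> and \<open>\<beta>\<^sub>s\<close> into exactly the edge terms of
  \<open>D/Ds (f\<^sub>p T)\<close> and \<open>D/Dt (f\<^sub>q T)\<close>.\<close>

lemma adjoint_solution_layer:
  fixes \<alpha> :: "(real \<times> real \<Rightarrow> real \<times> real \<Rightarrow> real) \<Rightarrow> real"
  assumes \<pi>: "\<pi> \<in> borel_measurable M" and w: "integrable M w"
    and null_s: "AE \<omega> in M. fst (\<pi> \<omega>) \<noteq> fst z0"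
    and null_t: "\<forall>\<^sub>F z in nhds z0. z \<in> G \<longrightarrow> (AE \<omega> in M. snd (\<pi> \<omega>) \<noteq> snd z)"
    and slice_s: "\<And>K. continuous_on (kernel_domain G) (\<lambda>(\<zeta>, z). K \<zeta> z) \<Longrightarrow>
      ((\<lambda>s. \<integral>\<omega>. (if \<pi> \<omega> \<in> E G (s, snd z0) then w \<omega> * K (\<pi> \<omega>) (fst (\<pi> \<omega>), snd z0) else 0) \<partial>M)
        has_real_derivative - \<alpha> K) (at (fst z0) within {s. (s, snd z0) \<in> G})"
    and \<alpha>_rt: "\<And>j. \<alpha> (rt j) = - (\<Sum>k\<in>UNIV. fp k j * \<alpha> (r k))"
    and slice_t: "\<forall>\<^sub>F z in nhds z0. z \<in> G \<longrightarrow> (\<forall>j.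
      ((\<lambda>t. \<integral>\<omega>. (if \<pi> \<omega> \<in> E G (fst z, t) then w \<omega> * r j (\<pi> \<omega>) (fst z, snd (\<pi> \<omega>)) else 0) \<partial>M)
        has_real_derivative - \<beta> j z) (at (snd z) within {t. (fst z, t) \<in> G}))"
    and \<beta>_s: "\<And>j. ((\<lambda>s. \<beta> j (s, snd z0)) has_real_derivative
        - \<phi> j - (\<Sum>k\<in>UNIV. fq k j * \<beta> k z0)) (at (fst z0) within {s. (s, snd z0) \<in> G})"
  shows "adjoint_solution G z0 fx fp fps fq fqt
    (\<lambda>j z. \<integral>\<omega>. (if \<pi> \<omega> \<in> E G z then w \<omega> * r j (\<pi> \<omega>) z else 0) \<partial>M) \<phi>"
proof -
  define I where "I K z = (\<integral>\<omega>. (if \<pi> \<omega> \<in> E G z then w \<omega> * K (\<pi> \<omega>) z else 0) \<partial>M)" for K z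
  have z0': "(fst z0, snd z0) \<in> G" "(fst z0, snd z0) = z0" using z0 by auto
  have int: "integrable M (\<lambda>\<omega>. if \<pi> \<omega> \<in> E G z then w \<omega> * K (\<pi> \<omega>) z else 0)"
    if "continuous_on (kernel_domain G) (\<lambda>(\<zeta>, z). K \<zeta> z)" for K z
    by (rule integrable_layer[OF compact that \<pi> w, where c = "\<lambda>_. z"]) (auto simp: E_def)
  have I_rst: "I (rst j) z0 = (\<Sum>k\<in>UNIV. fx k j * I (r k) z0)
        - (\<Sum>k\<in>UNIV. fps k j * I (r k) z0 + fp k j * I (rs k) z0)
        - (\<Sum>k\<in>UNIV. fqt k j * I (r k) z0 + fq k j * I (rt k) z0)" for j
  proof -
    let ?i = "\<lambda>K \<omega>. if \<pi> \<omega> \<in> E G z0 then w \<omega> * K (\<pi> \<omega>) z0 else 0"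
    have "I (rst j) z0 = (\<integral>\<omega>. (\<Sum>k\<in>UNIV. fx k j * ?i (r k) \<omega>)
        - (\<Sum>k\<in>UNIV. fps k j * ?i (r k) \<omega> + fp k j * ?i (rs k) \<omega>)
        - (\<Sum>k\<in>UNIV. fqt k j * ?i (r k) \<omega> + fq k j * ?i (rt k) \<omega>) \<partial>M)"
      unfolding I_def
    proof (rule integral_cong_AE)
      show "(\<lambda>\<omega>. ?i (rst j) \<omega>) \<in> borel_measurable M"
        using int[OF cont(4)] by (rule borel_measurable_integrable)
      show "(\<lambda>\<omega>. (\<Sum>k\<in>UNIV. fx k j * ?i (r k) \<omega>)
        - (\<Sum>k\<in>UNIV. fps k j * ?i (r k) \<omega> + fp k j * ?i (rs k) \<omega>)
        - (\<Sum>k\<in>UNIV. fqt k j * ?i (r k) \<omega> + fq k j * ?i (rt k) \<omega>)) \<in> borel_measurable M"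
        by (intro borel_measurable_diff borel_measurable_sum borel_measurable_add borel_measurable_times
            borel_measurable_const borel_measurable_integrable[OF int] cont)
      have "AE \<omega> in M. snd (\<pi> \<omega>) \<noteq> snd z0" using null_t z0 by (auto dest: eventually_nhds_x_imp_x)
      with null_s show "AE \<omega> in M. ?i (rst j) \<omega> = (\<Sum>k\<in>UNIV. fx k j * ?i (r k) \<omega>)
        - (\<Sum>k\<in>UNIV. fps k j * ?i (r k) \<omega> + fp k j * ?i (rs k) \<omega>)
        - (\<Sum>k\<in>UNIV. fqt k j * ?i (r k) \<omega> + fq k j * ?i (rt k) \<omega>)"
      proof eventually_elim
        case (elim \<omega>)
        show ?case
        proof (cases "\<pi> \<omega> \<in> E G z0")
          case True
          with elim have "fst z0 < fst (\<pi> \<omega>)" "snd z0 < snd (\<pi> \<omega>)" by (auto simp: mem_E_iff)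
          with True show ?thesis
            by (simp add: pde[OF True] sum_distrib_left algebra_simps)
        next
          case False
          then show ?thesis by simp
        qed
      qed
    qed
    also have "\<dots> = (\<Sum>k\<in>UNIV. fx k j * I (r k) z0)
        - (\<Sum>k\<in>UNIV. fps k j * I (r k) z0 + fp k j * I (rs k) z0)
        - (\<Sum>k\<in>UNIV. fqt k j * I (r k) z0 + fq k j * I (rt k) z0)"
      unfolding I_def
      by (simp add: int cont Bochner_Integration.integral_diff Bochner_Integration.integral_sum
          Bochner_Integration.integral_add Bochner_Integration.integrable_diff
          Bochner_Integration.integrable_add Bochner_Integration.integrable_sum
          Bochner_Integration.integrable_mult_right)
    finally show ?thesis .
  qed
  \<comment> \<open>Needed on a neighbourhood of \<open>z0\<close> in \<open>G\<close>, because this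
    derivative is itself differentiated in \<open>s\<close> below.\<close>
  have Tt: "\<forall>\<^sub>F z in nhds z0. z \<in> G \<longrightarrow> (\<forall>j. ((\<lambda>t. I (r j) (fst z, t)) has_real_derivative
      I (rt j) z - \<beta> j z) (at (snd z) within {t. (fst z, t) \<in> G}))"
    using null_t slice_t
  proof eventually_elim
    case (elim z)
    show ?case
    proof (intro impI allI)
      fix j assume "z \<in> G"
      then have "((\<lambda>t. I (r j) (fst z, t)) has_real_derivative
      I (rt j) (fst z, snd z) + - \<beta> j z) (at (snd z) within {t. (fst z, t) \<in> G})"
        unfolding I_def
        by (intro layer_t_derivative compact nonneg cont r_t \<pi> w) (use elim in auto)
      then show "((\<lambda>t. I (r j) (fst z, t)) has_real_derivative
          I (rt j) z - \<beta> j z) (at (snd z) within {t. (fst z, t) \<in> G})" by simp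
    qed
  qed
  have Ts: "((\<lambda>s. I (r j) (s, snd z0)) has_real_derivative I (rs j) z0 - \<alpha> (r j))
      (at (fst z0) within {s. (s, snd z0) \<in> G})" for j
  proof -
    have "((\<lambda>s. I (r j) (s, snd z0)) has_real_derivative I (rs j) (fst z0, snd z0) + - \<alpha> (r j))
      (at (fst z0) within {s. (s, snd z0) \<in> G})"
      unfolding I_def
      by (intro layer_s_derivative compact nonneg cont r_s \<pi> w slice_s null_s z0')
    then show ?thesis by simp
  qed
  \<comment> \<open>The integral of \<open>rt\<close> is again a superposition over moving edges,
    now with kernel \<open>rt\<close>; this is why \<open>slice_s\<close> is required for every
    continuous kernel and not just for \<open>r\<close>.\<close>
  have Tst: "((\<lambda>s. I (rt j) (s, snd z0) - \<beta> j (s, snd z0)) has_real_derivative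
      I (rst j) z0 - \<alpha> (rt j) - (- \<phi> j - (\<Sum>k\<in>UNIV. fq k j * \<beta> k z0)))
      (at (fst z0) within {s. (s, snd z0) \<in> G})" for j
  proof (rule DERIV_diff[OF _ \<beta>_s])
    have "((\<lambda>s. I (rt j) (s, snd z0)) has_real_derivative I (rst j) (fst z0, snd z0) + - \<alpha> (rt j))
      (at (fst z0) within {s. (s, snd z0) \<in> G})"
      unfolding I_def
      by (intro layer_s_derivative compact nonneg cont rt_s \<pi> w slice_s null_s z0')
    then show "((\<lambda>s. I (rt j) (s, snd z0)) has_real_derivative I (rst j) z0 - \<alpha> (rt j))
      (at (fst z0) within {s. (s, snd z0) \<in> G})" by simp
  qed
  \<comment> \<open>By \<open>\<alpha>_rt\<close> the term \<open>- \<alpha> (rt j)\<close> becomes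
    the sum of \<open>fp k j * \<alpha> (r k)\<close>, which completes \<open>I (rs k)\<close> to
    the \<open>s\<close>-derivative \<open>I (rs k) - \<alpha> (r k)\<close>; likewise the terms
    \<open>fq k j * \<beta> k z0\<close> complete \<open>I (rt k)\<close> to the
    \<open>t\<close>-derivative \<open>I (rt k) - \<beta> k z0\<close>.\<close>
  have "adjoint_solution G z0 fx fp fps fq fqt (\<lambda>j. I (r j)) \<phi>"
    unfolding adjoint_solution_def
  proof (intro exI conjI allI)
    show "\<forall>\<^sub>F z in nhds z0. z \<in> G \<longrightarrow> (\<forall>j. ((\<lambda>t. I (r j) (fst z, t)) has_real_derivative
      I (rt j) z - \<beta> j z) (at (snd z) within {t. (fst z, t) \<in> G}))" by (rule Tt)
  qed (rule Ts Tst | simp add: I_rst \<alpha>_rt sum.distrib sum_subtractf sum_negf algebra_simps)+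
  then show ?thesis unfolding I_def .
qed

end

section \<open>Functions of class C1\<close>

text \<open>In contrast to \<open>Ck_open\<close>, which speaks of one direction at a time, the
  derivative is one operator-valued map; this makes the chain and product rules direct.\<close>

definition C1_on :: "('a::euclidean_space \<Rightarrow> 'b::real_normed_vector) \<Rightarrow> 'a set \<Rightarrow> bool" where
  "C1_on \<phi> S \<longleftrightarrow> (\<exists>\<phi>'. (\<forall>z\<in>S. (\<phi> has_derivative blinfun_apply (\<phi>' z)) (at z)) \<and> continuous_on S \<phi>')"

lemma Ck_open_imp_continuous_on: "Ck_open k \<phi> S \<Longrightarrow> continuous_on S \<phi>"
  by (cases k) (auto intro: differentiable_imp_continuous_on)

lemma Ck_open_Suc_has_derivative:
  assumes "Ck_open (Suc k) \<phi> S" "open S" "z \<in> S"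
  shows "(\<phi> has_derivative frechet_derivative \<phi> (at z)) (at z)"
proof -
  have "\<phi> differentiable (at z within S)" using assms by (simp add: differentiable_on_def)
  then have "\<phi> differentiable (at z)" using at_within_open[OF assms(3,2)] by simp
  then show ?thesis by (simp only: frechet_derivative_works)
qed

text \<open>The domain is finite-dimensional, so continuity of the derivative in each basis
  direction amounts to continuity in operator norm.\<close>

lemma Ck_open_Suc_imp_C1_on:
  assumes "Ck_open (Suc k) \<phi> S" "open S"
  shows "C1_on \<phi> S"
proof -
  define \<phi>' where "\<phi>' z = Blinfun (frechet_derivative \<phi> (at z))" for z
  have \<phi>': "blinfun_apply (\<phi>' z) = frechet_derivative \<phi> (at z)" if "z \<in> S" for z
    unfolding \<phi>'_def
    using has_derivative_bounded_linear[OF Ck_open_Suc_has_derivative[OF assms that]] by (rule bounded_linear_Blinfun_apply)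
  have "continuous_on S \<phi>'"
  proof (rule continuous_on_blinfun_componentwise)
    fix i :: 'a
    have "continuous_on S (\<lambda>z. frechet_derivative \<phi> (at z) i)"
      using assms(1) by (auto intro: Ck_open_imp_continuous_on)
    then show "continuous_on S (\<lambda>z. blinfun_apply (\<phi>' z) i)"
      by (rule continuous_on_eq) (simp add: \<phi>')
  qed
  then show ?thesis unfolding C1_on_def
    by (intro exI[of _ \<phi>']) (use Ck_open_Suc_has_derivative[OF assms] in \<open>simp add: \<phi>'\<close>)
qed

lemma Ck_open_2_imp_C1_on:
  assumes "Ck_open 2 \<phi> S" "open S"
  shows "C1_on \<phi> S" "C1_on (\<lambda>z. frechet_derivative \<phi> (at z) v) S"
proof -
  have *: "Ck_open (Suc 1) \<phi> S" using assms by (simp add: numeral_2_eq_2)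
  then show "C1_on \<phi> S" using assms(2) by (rule Ck_open_Suc_imp_C1_on)
  have "Ck_open (Suc 0) (\<lambda>z. frechet_derivative \<phi> (at z) v) S"
    using * unfolding One_nat_def Ck_open.simps(2)[of "Suc 0"] by blast
  then show "C1_on (\<lambda>z. frechet_derivative \<phi> (at z) v) S" using assms(2) by (rule Ck_open_Suc_imp_C1_on)
qed

lemma C1_on_has_derivative:
  assumes "C1_on \<phi> S" "z \<in> S"
  shows "(\<phi> has_derivative frechet_derivative \<phi> (at z)) (at z)"
proof -
  have "\<phi> differentiable (at z)" using assms by (auto simp: C1_on_def differentiable_def)
  then show ?thesis by (simp only: frechet_derivative_works)
qed

lemma C1_on_continuous_derivative:
  assumes "C1_on \<phi> S" shows "continuous_on S (\<lambda>z. frechet_derivative \<phi> (at z) v)"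
proof -
  obtain \<phi>' where \<phi>': "\<And>z. z \<in> S \<Longrightarrow> (\<phi> has_derivative blinfun_apply (\<phi>' z)) (at z)" "continuous_on S \<phi>'"
    using assms unfolding C1_on_def by blast
  have "continuous_on S (\<lambda>z. blinfun_apply (\<phi>' z) v)" by (intro continuous_intros \<phi>'(2))
  then show ?thesis
    by (rule continuous_on_eq) (simp add: frechet_derivative_at[OF \<phi>'(1), symmetric])
qed

lemma C1_on_imp_continuous_on: "C1_on \<phi> S \<Longrightarrow> continuous_on S \<phi>"
  unfolding C1_on_def
  by (auto intro!: continuous_at_imp_continuous_on dest: bspec has_derivative_continuous)

lemma C1_on_subset: "C1_on \<phi> S \<Longrightarrow> T \<subseteq> S \<Longrightarrow> C1_on \<phi> T"
  unfolding C1_on_def by (meson continuous_on_subset subsetD)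

lemma C1_on_bounded_linear: "bounded_linear \<phi> \<Longrightarrow> C1_on \<phi> S"
  unfolding C1_on_def
  by (intro exI[of _ "\<lambda>_. Blinfun \<phi>"])
    (simp add: bounded_linear_Blinfun_apply bounded_linear_imp_has_derivative continuous_on_const)

lemma C1_on_add:
  assumes "C1_on \<phi> S" "C1_on \<psi> S" shows "C1_on (\<lambda>z. \<phi> z + \<psi> z) S"
proof -
  obtain \<phi>' \<psi>' where "\<And>z. z \<in> S \<Longrightarrow> (\<phi> has_derivative blinfun_apply (\<phi>' z)) (at z)" "continuous_on S \<phi>'"
    "\<And>z. z \<in> S \<Longrightarrow> (\<psi> has_derivative blinfun_apply (\<psi>' z)) (at z)" "continuous_on S \<psi>'"
    using assms unfolding C1_on_def by blast
  then show ?thesis unfolding C1_on_def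
    by (intro exI[of _ "\<lambda>z. \<phi>' z + \<psi>' z"])
      (auto simp: plus_blinfun.rep_eq intro!: has_derivative_add continuous_on_add)
qed

lemma C1_on_compose:
  fixes \<phi> :: "'a::euclidean_space \<Rightarrow> 'b::euclidean_space"
  assumes "C1_on \<phi> S" "C1_on \<psi> T" "\<And>z. z \<in> S \<Longrightarrow> \<phi> z \<in> T"
  shows "C1_on (\<lambda>z. \<psi> (\<phi> z)) S"
proof -
  obtain \<phi>' \<psi>' where \<phi>': "\<And>z. z \<in> S \<Longrightarrow> (\<phi> has_derivative blinfun_apply (\<phi>' z)) (at z)" "continuous_on S \<phi>'"
    and \<psi>': "\<And>z. z \<in> T \<Longrightarrow> (\<psi> has_derivative blinfun_apply (\<psi>' z)) (at z)" "continuous_on T \<psi>'"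
    using assms unfolding C1_on_def by blast
  have "continuous_on S (\<lambda>z. \<psi>' (\<phi> z))"
    using assms by (intro continuous_on_compose2[OF \<psi>'(2)] C1_on_imp_continuous_on) auto
  then have "continuous_on S (\<lambda>z. \<psi>' (\<phi> z) o\<^sub>L \<phi>' z)"
    using \<phi>'(2) by (rule bounded_bilinear.continuous_on[OF bounded_bilinear_blinfun_compose])
  moreover have "((\<lambda>z. \<psi> (\<phi> z)) has_derivative blinfun_apply (\<psi>' (\<phi> z) o\<^sub>L \<phi>' z)) (at z)" if "z \<in> S" for z
    using has_derivative_compose[OF \<phi>'(1)[OF that] \<psi>'(1)[OF assms(3)[OF that]]]
    by (simp add: blinfun_apply_blinfun_compose[abs_def] o_def)
  ultimately show ?thesis unfolding C1_on_def
    by (intro exI[of _ "\<lambda>z. \<psi>' (\<phi> z) o\<^sub>L \<phi>' z"]) simp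
qed

lemma C1_on_linear_compose:
  fixes \<phi> :: "'a::euclidean_space \<Rightarrow> 'b::euclidean_space"
  assumes "bounded_linear h" "C1_on \<phi> S" shows "C1_on (\<lambda>z. h (\<phi> z)) S"
  using C1_on_compose[OF assms(2) C1_on_bounded_linear[OF assms(1), of UNIV]] by simp

lemma C1_on_Pair:
  fixes \<phi> :: "'a::euclidean_space \<Rightarrow> 'b::euclidean_space" and \<psi> :: "'a \<Rightarrow> 'c::euclidean_space"
  assumes "C1_on \<phi> S" "C1_on \<psi> S" shows "C1_on (\<lambda>z. (\<phi> z, \<psi> z)) S"
proof -
  have "C1_on (\<lambda>z. (\<phi> z, 0) + (0, \<psi> z)) S"
    by (intro C1_on_add C1_on_linear_compose[OF _ assms(1), of "\<lambda>y. (y, 0)"]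
        C1_on_linear_compose[OF _ assms(2), of "\<lambda>y. (0, y)"] bounded_linear_Pair bounded_linear_ident bounded_linear_zero)
  then show ?thesis by simp
qed

lemma C1_on_scaleR:
  fixes \<phi> :: "'a::euclidean_space \<Rightarrow> real"
  assumes "C1_on \<phi> S" "C1_on \<psi> S" shows "C1_on (\<lambda>z. \<phi> z *\<^sub>R \<psi> z) S"
proof -
  obtain \<phi>' \<psi>' where \<phi>': "\<And>z. z \<in> S \<Longrightarrow> (\<phi> has_derivative blinfun_apply (\<phi>' z)) (at z)" "continuous_on S \<phi>'"
    and \<psi>': "\<And>z. z \<in> S \<Longrightarrow> (\<psi> has_derivative blinfun_apply (\<psi>' z)) (at z)" "continuous_on S \<psi>'"
    using assms unfolding C1_on_def by blast
  have "continuous_on S (\<lambda>z. blinfun_scaleR_left (\<psi> z))"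
    by (rule bounded_linear.continuous_on[OF bounded_linear_blinfun_scaleR_left C1_on_imp_continuous_on[OF assms(2)]])
  then have "continuous_on S (\<lambda>z. blinfun_scaleR_left (\<psi> z) o\<^sub>L \<phi>' z)"
    using \<phi>'(2) by (rule bounded_bilinear.continuous_on[OF bounded_bilinear_blinfun_compose])
  with continuous_on_scaleR[OF C1_on_imp_continuous_on[OF assms(1)] \<psi>'(2)]
  have "continuous_on S (\<lambda>z. \<phi> z *\<^sub>R \<psi>' z + (blinfun_scaleR_left (\<psi> z) o\<^sub>L \<phi>' z))"
    by (rule continuous_on_add)
  moreover have "((\<lambda>z. \<phi> z *\<^sub>R \<psi> z) has_derivative
      blinfun_apply (\<phi> z *\<^sub>R \<psi>' z + (blinfun_scaleR_left (\<psi> z) o\<^sub>L \<phi>' z))) (at z)" if "z \<in> S" for z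
    using has_derivative_scaleR[OF \<phi>'(1)[OF that] \<psi>'(1)[OF that]]
    by (simp add: plus_blinfun.rep_eq scaleR_blinfun.rep_eq)
  ultimately show ?thesis unfolding C1_on_def
    by (intro exI[of _ "\<lambda>z. \<phi> z *\<^sub>R \<psi>' z + (blinfun_scaleR_left (\<psi> z) o\<^sub>L \<phi>' z)"]) simp
qed

section \<open>Partial derivatives read off total derivatives\<close>

lemma has_derivative_fst_line:
  assumes "(\<phi> has_derivative D) (at (s, t))"
  shows "((\<lambda>s. \<phi> (s, t)) has_vector_derivative D (1, 0)) (at s)"
proof -
  have "((\<lambda>s. (s, t)) has_derivative (\<lambda>h. (h, 0))) (at s)"
    by (intro has_derivative_Pair has_derivative_ident has_derivative_const)
  from has_derivative_compose[OF this assms]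
  have "((\<lambda>s. \<phi> (s, t)) has_derivative (\<lambda>h. D (h, 0))) (at s)" .
  moreover have "D (h, 0) = h *\<^sub>R D (1, 0)" for h :: real
    using linear_scale[OF has_derivative_linear[OF assms], of h "(1, 0)"] by simp
  then have "(\<lambda>h. D (h, 0)) = (\<lambda>h. h *\<^sub>R D (1, 0))" by (rule ext)
  ultimately show ?thesis unfolding has_vector_derivative_def by (rule subst[rotated])
qed

lemma has_derivative_snd_line:
  assumes "(\<phi> has_derivative D) (at (s, t))"
  shows "((\<lambda>t. \<phi> (s, t)) has_vector_derivative D (0, 1)) (at t)"
proof -
  have "((\<lambda>t. (s, t)) has_derivative (\<lambda>h. (0, h))) (at t)"
    by (intro has_derivative_Pair has_derivative_ident has_derivative_const)
  from has_derivative_compose[OF this assms]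
  have "((\<lambda>t. \<phi> (s, t)) has_derivative (\<lambda>h. D (0, h))) (at t)" .
  moreover have "D (0, h) = h *\<^sub>R D (0, 1)" for h :: real
    using linear_scale[OF has_derivative_linear[OF assms], of h "(0, 1)"] by simp
  then have "(\<lambda>h. D (0, h)) = (\<lambda>h. h *\<^sub>R D (0, 1))" by (rule ext)
  ultimately show ?thesis unfolding has_vector_derivative_def by (rule subst[rotated])
qed

text \<open>\<open>e\<close> inserts \<open>y\<close> into a longer argument list and
  \<open>l\<close> is its linear part. Since \<open>\<phi>\<close> has to match
  \<open>\<Phi>\<close> only along one line, partial derivatives of a function known on a set that
  is not open can be taken from a smooth extension.\<close>

lemma coord_deriv_eq:
  assumes "(\<Phi> has_derivative D) (at (e y))" "bounded_linear l" "\<And>h. e (y + h *\<^sub>R axis i 1) = e y + l (h *\<^sub>R axis i 1)"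
    and "\<And>h. \<phi> (y + h *\<^sub>R axis i 1) = \<Phi> (e (y + h *\<^sub>R axis i 1))"
  shows "((\<lambda>h. \<phi> (y + h *\<^sub>R axis i 1)) has_real_derivative D (l (axis i 1))) (at 0)"
    "coord_deriv i \<phi> y = D (l (axis i 1))"
proof -
  have l: "l (h *\<^sub>R axis i 1) = h *\<^sub>R l (axis i 1)" for h :: real
    using assms(2) by (rule linear_simps)
  have "((\<lambda>h. e y + h *\<^sub>R l (axis i 1)) has_derivative (\<lambda>h. h *\<^sub>R l (axis i 1))) (at 0)"
    by (auto intro!: derivative_eq_intros)
  moreover have "(\<Phi> has_derivative D) (at (e y + 0 *\<^sub>R l (axis i 1)))" using assms(1) by simp
  ultimately have "((\<lambda>h. \<Phi> (e y + h *\<^sub>R l (axis i 1))) has_derivative (\<lambda>h. D (h *\<^sub>R l (axis i 1)))) (at 0)"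
    by (rule has_derivative_compose)
  moreover have "D (h *\<^sub>R l (axis i 1)) = D (l (axis i 1)) * h" for h :: real
    using linear_scale[OF has_derivative_linear[OF assms(1)], of h] by simp
  ultimately show *: "((\<lambda>h. \<phi> (y + h *\<^sub>R axis i 1)) has_real_derivative D (l (axis i 1))) (at 0)"
    by (simp add: has_field_derivative_def assms(3,4) l[symmetric])
  show "coord_deriv i \<phi> y = D (l (axis i 1))"
    unfolding coord_deriv_def using * by (rule DERIV_imp_deriv)
qed

section \<open>The boundary curve\<close>

text \<open>If a level off the vertex values were taken at two parameters, monotonicity would make
  \<open>c\<close> constant in between, against \<open>c' \<noteq> 0\<close>. Hence \<open>c\<close>
  has an inverse at these levels, continuous by monotonicity and differentiable by the inverse
  function rule.\<close>

lemma monotone_crossing_inverse: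
  fixes c c' :: "real \<Rightarrow> real" and L :: real and V :: "real set"
  defines "Q \<equiv> {c L<..<c 0} - c ` V"
  assumes L: "0 < L" and cont: "continuous_on {0..L} c"
    and anti: "\<And>\<mu> \<nu>. 0 \<le> \<mu> \<Longrightarrow> \<mu> \<le> \<nu> \<Longrightarrow> \<nu> \<le> L \<Longrightarrow> c \<nu> \<le> c \<mu>"
    and V: "finite V" "0 \<in> V" "L \<in> V"
    and der: "\<And>\<mu>. \<mu> \<in> {0..L} - V \<Longrightarrow> (c has_real_derivative c' \<mu>) (at \<mu>)"
    and nz: "\<And>\<mu>. \<mu> \<in> {0..L} - V \<Longrightarrow> c \<mu> \<notin> c ` V \<Longrightarrow> c' \<mu> \<noteq> 0"
  obtains m where "\<And>s. s \<in> Q \<Longrightarrow> m s \<in> {0..L} - V" "\<And>s. s \<in> Q \<Longrightarrow> c (m s) = s"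
    "\<And>s \<mu>. s \<in> Q \<Longrightarrow> \<mu> \<in> {0..L} \<Longrightarrow> s \<le> c \<mu> \<longleftrightarrow> \<mu> \<le> m s"
    "\<And>s \<mu>. s \<in> Q \<Longrightarrow> \<mu> \<in> {0..L} \<Longrightarrow> c \<mu> \<le> s \<longleftrightarrow> m s \<le> \<mu>"
    "\<And>s. s \<in> Q \<Longrightarrow> (m has_real_derivative inverse (c' (m s))) (at s)"
proof -
  have ex: "\<exists>x. x \<in> {0..L} - V \<and> c x = s" if "s \<in> Q" for s
  proof -
    have "\<exists>x\<ge>0. x \<le> L \<and> c x = s"
      using that L cont by (intro IVT2') (auto simp: Q_def)
    then show ?thesis using that by (auto simp: Q_def)
  qed
  define m where "m s = (SOME x. x \<in> {0..L} - V \<and> c x = s)" for s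
  have m: "m s \<in> {0..L} - V" "c (m s) = s" if "s \<in> Q" for s
    using someI_ex[OF ex[OF that]] by (auto simp: m_def)
  \<comment> \<open>A one-sided derivative on the plateau \<open>{x..y}\<close> suffices for the
    contradiction, so \<open>m s\<close> may be either of its ends.\<close>
  have nconst: False if "s \<in> Q" "x < y" "0 \<le> x" "y \<le> L" "m s = x \<or> m s = y" "c x = s" "c y = s" for s x y
  proof -
    have const: "c z = s" if "z \<in> {x..y}" for z
      using anti[of x z] anti[of z y] \<open>c x = s\<close> \<open>c y = s\<close> that \<open>0 \<le> x\<close> \<open>y \<le> L\<close> by auto
    have "(c has_real_derivative c' (m s)) (at (m s) within {x..y})"
      using der[OF m(1)[OF that(1)]] has_field_derivative_at_within by blast
    moreover have "(c has_real_derivative 0) (at (m s) within {x..y})"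
      by (rule has_field_derivative_transform_within[where d = 1 and f = "\<lambda>_. s"])
        (use const that in auto)
    moreover have "at (m s) within {x..y} \<noteq> bot"
      using that by (auto simp: trivial_limit_within islimpt_Icc)
    ultimately have "c' (m s) = 0"
      unfolding has_real_derivative_iff_has_vector_derivative
      by (metis vector_derivative_unique_within)
    moreover have "c (m s) \<notin> c ` V" using m(2) that(1) by (auto simp: Q_def)
    ultimately show False using nz m(1) that(1) by blast
  qed
  have gt: "s < c \<mu>" if "s \<in> Q" "\<mu> \<in> {0..L}" "\<mu> < m s" for s \<mu>
    using anti[of \<mu> "m s"] m[OF that(1)] that nconst[of s \<mu> "m s"] by force
  have lt: "c \<mu> < s" if "s \<in> Q" "\<mu> \<in> {0..L}" "m s < \<mu>" for s \<mu>
    using anti[of "m s" \<mu>] m[OF that(1)] that nconst[of s "m s" \<mu>] by force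
  have iff1: "s \<le> c \<mu> \<longleftrightarrow> \<mu> \<le> m s" and iff2: "c \<mu> \<le> s \<longleftrightarrow> m s \<le> \<mu>"
    if "s \<in> Q" "\<mu> \<in> {0..L}" for s \<mu>
    using gt[OF that] lt[OF that] m(2)[OF that(1)] by force+
  have "open Q"
    unfolding Q_def using V by (intro open_Diff open_greaterThanLessThan finite_imp_closed finite_imageI)
  have isCont: "isCont m s" if s: "s \<in> Q" for s
    unfolding isCont_def
  proof (rule tendstoI)
    fix e :: real assume e: "e > 0"
    have ms: "0 < m s" "m s < L" using m(1)[OF s] V by (auto simp: less_le)
    \<comment> \<open>\<open>x\<close> and \<open>y\<close> enclose \<open>m s\<close> at distance
      at most \<open>e / 2\<close>, clipped to \<open>{0..L}\<close>; as the levels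
      \<open>c y\<close> and \<open>c x\<close> lie strictly on either side of \<open>s\<close>,
      levels near \<open>s\<close> are crossed between \<open>x\<close> and
      \<open>y\<close>.\<close>
    define x where "x = max 0 (m s - e / 2)"
    define y where "y = min L (m s + e / 2)"
    have xy: "x \<in> {0..L}" "y \<in> {0..L}" "x < m s" "m s < y" using ms e by (auto simp: x_def y_def)
    have "\<forall>\<^sub>F s' in nhds s. s' \<in> Q \<inter> {c y<..<c x}"
      using \<open>open Q\<close> s gt[OF s xy(1,3)] lt[OF s xy(2,4)] by (intro eventually_nhds_in_open) auto
    then have "\<forall>\<^sub>F s' in nhds s. dist (m s') (m s) < e"
    proof eventually_elim
      case (elim s')
      then have "x \<le> m s'" "m s' \<le> y" using iff1[of s' x] iff2[of s' y] xy by auto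
      then show ?case using e by (auto simp: dist_real_def x_def y_def)
    qed
    then show "\<forall>\<^sub>F s' in at s. dist (m s') (m s) < e"
      by (simp add: eventually_at_filter eventually_mono)
  qed
  have m_der: "(m has_real_derivative inverse (c' (m s))) (at s)" if s: "s \<in> Q" for s
  proof -
    obtain e where e: "e > 0" "ball s e \<subseteq> Q" using \<open>open Q\<close> s by (rule openE)
    show ?thesis
    proof (rule DERIV_inverse_function[where f = c and a = "s - e" and b = "s + e"])
      show "c' (m s) \<noteq> 0" using nz[OF m(1)[OF s]] m(2)[OF s] s by (auto simp: Q_def)
      show "c (m y) = y" if "s - e < y" "y < s + e" for y
        using that e by (intro m) (auto simp: dist_real_def)
      show "(c has_real_derivative c' (m s)) (at (m s))" by (rule der[OF m(1)[OF s]])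
      show "isCont m s" by (rule isCont[OF s])
    qed (use e(1) in simp_all)
  qed
  show thesis
    by (rule that[of m]) (fact m iff1 iff2 m_der)+
qed

locale boundary_arc =
  fixes a b :: real and N :: nat and mu :: "nat \<Rightarrow> real" and g :: "real \<Rightarrow> real \<times> real"
  assumes curve: "boundary_curve a b N mu g"
begin

abbreviation "L \<equiv> mu (Suc N)"
abbreviation "G \<equiv> region N mu g"
abbreviation "V \<equiv> mu ` {..Suc N}"

lemma ab: "0 < a" "0 < b" and mu0: "mu 0 = 0"
  and g_cont: "continuous_on {0..L} g"
  and g_ends: "g 0 = (a, 0)" "g L = (0, b)"
  using curve unfolding boundary_curve_def by blast+

lemma mu_Suc: "r \<le> N \<Longrightarrow> mu r < mu (Suc r)"
  using curve unfolding boundary_curve_def by blast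

lemma g_pos: "0 < \<mu> \<Longrightarrow> \<mu> < L \<Longrightarrow> 0 < fst (g \<mu>) \<and> 0 < snd (g \<mu>)"
proof -
  have "\<forall>\<mu>\<in>{0<..<L}. 0 < fst (g \<mu>) \<and> 0 < snd (g \<mu>)"
    using curve unfolding boundary_curve_def by blast
  then show "0 < \<mu> \<Longrightarrow> \<mu> < L \<Longrightarrow> ?thesis" by simp
qed

lemma g_mono:
  assumes "0 \<le> \<mu>" "\<mu> \<le> \<nu>" "\<nu> \<le> L"
  shows "fst (g \<nu>) \<le> fst (g \<mu>) \<and> snd (g \<mu>) \<le> snd (g \<nu>)"
proof -
  have "\<forall>\<mu>\<in>{0..L}. \<forall>\<nu>\<in>{0..L}. \<mu> \<le> \<nu> \<longrightarrow>
        fst (g \<nu>) \<le> fst (g \<mu>) \<and> snd (g \<mu>) \<le> snd (g \<nu>)"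
    using curve unfolding boundary_curve_def by blast
  then show ?thesis using assms by simp
qed

lemma mu_mono: "r \<le> r' \<Longrightarrow> r' \<le> Suc N \<Longrightarrow> mu r \<le> mu r'"
proof (induction r' rule: dec_induct)
  case (step n)
  then show ?case using mu_Suc[of n] by force
qed auto

lemma L_pos: "0 < L"
  using mu_mono[of 0 N] mu_Suc[of N] mu0 by force

lemma mu_in: "r \<le> Suc N \<Longrightarrow> mu r \<in> {0..L}"
  using mu_mono[of 0 r] mu_mono[of r "Suc N"] mu0 by auto

lemma g_nonneg: "\<mu> \<in> {0..L} \<Longrightarrow> 0 \<le> fst (g \<mu>) \<and> 0 \<le> snd (g \<mu>)"
  using g_pos[of \<mu>] g_ends ab by (cases "\<mu> = 0 \<or> \<mu> = L") (auto simp: less_le)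

lemma g_le: "\<mu> \<in> {0..L} \<Longrightarrow> fst (g \<mu>) \<le> a \<and> snd (g \<mu>) \<le> b"
  using g_mono[of 0 \<mu>] g_mono[of \<mu> L] g_ends by auto

lemma mem_G_iff: "z \<in> G \<longleftrightarrow> (\<exists>\<mu>\<in>{0..L}. z \<in> W (g \<mu>))"
  by (auto simp: region_def)

lemma G_nonneg: "z \<in> G \<Longrightarrow> 0 \<le> fst z \<and> 0 \<le> snd z"
  by (auto simp: mem_G_iff mem_W_iff)

lemma G_le: "z \<in> G \<Longrightarrow> fst z \<le> a \<and> snd z \<le> b"
  using g_le by (force simp: mem_G_iff mem_W_iff)

lemma G_down: "\<zeta> \<in> G \<Longrightarrow> z \<in> W \<zeta> \<Longrightarrow> z \<in> G"
  by (force simp: mem_G_iff mem_W_iff)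

lemma g_in_G: "\<mu> \<in> {0..L} \<Longrightarrow> g \<mu> \<in> G"
  using g_nonneg by (auto simp: mem_G_iff mem_W_iff)

text \<open>Each rectangle \<open>W (g \<mu>)\<close> is the unit square scaled by the coordinates
  of \<open>g \<mu>\<close>, so the region is the continuous image of a compact box.\<close>

lemma compact_G: "compact G"
proof -
  have "G = (\<lambda>(\<mu>, x, y). (x * fst (g \<mu>), y * snd (g \<mu>))) ` ({0..L} \<times> {0..1} \<times> {0..1})" (is "_ = ?f ` _")
  proof
    show "?f ` ({0..L} \<times> {0..1} \<times> {0..1}) \<subseteq> G"
      using g_nonneg by (fastforce simp: mem_G_iff mem_W_iff intro: mult_left_le_one_le)
    show "G \<subseteq> ?f ` ({0..L} \<times> {0..1} \<times> {0..1})"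
    proof
      fix z assume "z \<in> G"
      then obtain \<mu> where \<mu>: "\<mu> \<in> {0..L}" "z \<in> W (g \<mu>)" by (auto simp: mem_G_iff)
      \<comment> \<open>For \<open>q = 0\<close> also \<open>p = 0\<close>, and the quotient
        \<open>p / q\<close> has the value 0, which still lies in \<open>{0..1}\<close>.\<close>
      have "\<exists>x\<in>{0..1}. p = x * q" if "0 \<le> p" "p \<le> q" for p q :: real
        using that by (intro bexI[of _ "p / q"]) (auto simp: divide_simps)
      then obtain x y where "x \<in> {0..1}" "y \<in> {0..1}" "fst z = x * fst (g \<mu>)" "snd z = y * snd (g \<mu>)"
        using \<mu>(2) by (metis mem_W_iff)
      then show "z \<in> ?f ` ({0..L} \<times> {0..1} \<times> {0..1})"
        using \<mu> by (intro image_eqI[of _ _ "(\<mu>, x, y)"]) (auto simp: prod_eq_iff)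
    qed
  qed
  moreover have "continuous_on ({0..L} \<times> {0..1} \<times> {0..1}) ?f"
    unfolding case_prod_unfold
    by (intro continuous_intros continuous_on_compose2[OF g_cont]) auto
  ultimately show ?thesis
    by (simp only:) (intro compact_continuous_image compact_Times compact_Icc)
qed

lemma in_segment:
  assumes "\<mu> \<in> {0..L} - V" obtains r where "r \<le> N" "mu r < \<mu>" "\<mu> < mu (Suc r)"
proof -
  define r where "r = (GREATEST r. r \<le> Suc N \<and> mu r < \<mu>)"
  have nv: "\<mu> \<noteq> mu k" if "k \<le> Suc N" for k using assms that by auto
  have ex: "0 \<le> Suc N \<and> mu 0 < \<mu>" using assms nv[of 0] mu0 by auto
  have r: "r \<le> Suc N \<and> mu r < \<mu>"
    unfolding r_def by (rule GreatestI_nat[where k = 0 and b = "Suc N"]) (use ex in auto)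
  have "r \<noteq> Suc N" using r assms by auto
  with r have rN: "r \<le> N" by auto
  have "\<not> mu (Suc r) < \<mu>"
  proof
    assume "mu (Suc r) < \<mu>"
    then have "Suc r \<le> r"
      unfolding r_def using rN by (intro Greatest_le_nat[where b = "Suc N"]) (auto simp: r_def)
    then show False by simp
  qed
  with nv[of "Suc r"] rN r show thesis by (intro that[of r]) auto
qed

lemma segment_not_vertex:
  assumes "r \<le> N" "mu r < \<mu>" "\<mu> < mu (Suc r)" shows "\<mu> \<in> {0..L} - V"
proof -
  have "\<mu> \<noteq> mu k" if "k \<le> Suc N" for k
    using mu_mono[of k r] mu_mono[of "Suc r" k] assms that by (cases "k \<le> r") force+
  moreover have "\<mu> \<in> {0..L}" using mu_in[of r] mu_in[of "Suc r"] assms by auto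
  ultimately show ?thesis by auto
qed

text \<open>The extension \<open>h\<close> supplies tangents up to the end points of a segment,
  where \<open>g\<close> may have a corner and its own derivative need not exist.\<close>

lemma segment_extension:
  assumes "r \<le> N"
  obtains \<Omega> h where "open \<Omega>" "{mu r..mu (Suc r)} \<subseteq> \<Omega>" "Ck_open 2 h \<Omega>"
    "\<And>\<mu>. \<mu> \<in> {mu r..mu (Suc r)} \<Longrightarrow> h \<mu> = g \<mu>"
    "\<And>\<mu>. \<mu> \<in> {mu r<..<mu (Suc r)} \<Longrightarrow>
       (g has_vector_derivative frechet_derivative h (at \<mu>) 1) (at \<mu>)"
proof -
  have "Ck_on 2 g {mu r..mu (Suc r)}" using curve assms unfolding boundary_curve_def by blast
  then obtain \<Omega> h where h: "open \<Omega>" "{mu r..mu (Suc r)} \<subseteq> \<Omega>" "Ck_open 2 h \<Omega>"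
    "\<forall>\<mu>\<in>{mu r..mu (Suc r)}. h \<mu> = g \<mu>" unfolding Ck_on_def by blast
  have "(g has_vector_derivative frechet_derivative h (at \<mu>) 1) (at \<mu>)"
    if \<mu>: "\<mu> \<in> {mu r<..<mu (Suc r)}" for \<mu>
  proof -
    have "(h has_derivative frechet_derivative h (at \<mu>)) (at \<mu>)"
      by (rule Ck_open_Suc_has_derivative[OF h(3)[unfolded numeral_2_eq_2] h(1)]) (use \<mu> h in auto)
    moreover then have "frechet_derivative h (at \<mu>) x = x *\<^sub>R frechet_derivative h (at \<mu>) 1" for x
      using has_derivative_linear linear_scale[of _ x 1] by fastforce
    ultimately have "(h has_vector_derivative frechet_derivative h (at \<mu>) 1) (at \<mu>)"
      unfolding has_vector_derivative_def by (metis (no_types, lifting) ext)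
    then show ?thesis
      by (rule has_vector_derivative_transform_within_open[where S = "{mu r<..<mu (Suc r)}"])
        (use \<mu> h in auto)
  qed
  with h show thesis using that by blast
qed

abbreviation "g' \<mu> \<equiv> vector_derivative g (at \<mu>)"

lemma g_deriv:
  assumes "\<mu> \<in> {0..L} - V" shows "(g has_vector_derivative g' \<mu>) (at \<mu>)"
proof -
  obtain r where r: "r \<le> N" "mu r < \<mu>" "\<mu> < mu (Suc r)" using in_segment[OF assms] .
  obtain \<Omega> h where "(g has_vector_derivative frechet_derivative h (at \<mu>) 1) (at \<mu>)"
    using segment_extension[OF r(1)] r by (metis greaterThanLessThan_iff)
  then show ?thesis using vector_derivative_at by fastforce
qed

lemma g_deriv_fst:
  assumes "\<mu> \<in> {0..L} - V" shows "((\<lambda>\<mu>. fst (g \<mu>)) has_real_derivative fst (g' \<mu>)) (at \<mu>)"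
proof -
  have "((\<lambda>\<mu>. fst (g \<mu>)) has_derivative (\<lambda>h. fst (h *\<^sub>R g' \<mu>))) (at \<mu>)"
    using g_deriv[OF assms] unfolding has_vector_derivative_def by (rule has_derivative_fst)
  moreover have "(\<lambda>h. fst (h *\<^sub>R g' \<mu>)) = (*) (fst (g' \<mu>))" by (auto simp: mult.commute)
  ultimately show ?thesis by (simp only: has_field_derivative_def)
qed

lemma g_deriv_snd:
  assumes "\<mu> \<in> {0..L} - V" shows "((\<lambda>\<mu>. snd (g \<mu>)) has_real_derivative snd (g' \<mu>)) (at \<mu>)"
proof -
  have "((\<lambda>\<mu>. snd (g \<mu>)) has_derivative (\<lambda>h. snd (h *\<^sub>R g' \<mu>))) (at \<mu>)"
    using g_deriv[OF assms] unfolding has_vector_derivative_def by (rule has_derivative_snd)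
  moreover have "(\<lambda>h. snd (h *\<^sub>R g' \<mu>)) = (*) (snd (g' \<mu>))" by (auto simp: mult.commute)
  ultimately show ?thesis by (simp only: has_field_derivative_def)
qed

text \<open>By continuity up to the end of the segment. Consequently an axis-parallel segment lies
  on a vertex line and is excluded wherever the coordinate in question is assumed regular.\<close>

lemma vertex_value_segment_end:
  assumes "r \<le> N" "mu r < \<mu>" "\<mu> < mu (Suc r)" "continuous_on {0..L} c"
    and "\<forall>\<nu>\<in>{mu r<..<mu (Suc r)}. c \<nu> = (k::real)"
  shows "c \<mu> \<in> c ` V"
proof -
  have sub: "{mu r..mu (Suc r)} \<subseteq> {0..L}" using mu_in[of r] mu_in[of "Suc r"] assms(1) by auto
  have "c (mu r) = k"
  proof (rule continuous_constant_on_closure[of "{mu r<..<mu (Suc r)}" c])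
    show "continuous_on (closure {mu r<..<mu (Suc r)}) c"
      using assms sub by (auto intro: continuous_on_subset)
    show "mu r \<in> closure {mu r<..<mu (Suc r)}" using assms by auto
  qed (use assms in auto)
  then show ?thesis using assms by auto
qed

text \<open>Chain rule for \<open>d = \<theta> \<circ> c\<close>: on a segment that is a graph over
  \<open>c\<close>, one vanishing tangent component forces the other to vanish, which unit speed
  will forbid.\<close>

lemma segment_graph_tangent:
  assumes r: "r \<le> N" "mu r < \<mu>" "\<mu> < mu (Suc r)"
    and \<theta>: "Ck_on 2 \<theta> (c ` {mu r<..<mu (Suc r)})" "\<forall>\<nu>\<in>{mu r<..<mu (Suc r)}. d \<nu> = \<theta> (c \<nu>)"
    and c: "(c has_real_derivative 0) (at \<mu>)" and d: "(d has_real_derivative d') (at \<mu>)"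
  shows "d' = (0::real)"
proof -
  obtain \<Omega> h where h: "open \<Omega>" "c ` {mu r<..<mu (Suc r)} \<subseteq> \<Omega>" "Ck_open 2 h \<Omega>"
      "\<forall>z\<in>c ` {mu r<..<mu (Suc r)}. h z = \<theta> z"
    using \<theta>(1) unfolding Ck_on_def by blast
  have "(h has_derivative frechet_derivative h (at (c \<mu>))) (at (c \<mu>))"
    by (rule Ck_open_Suc_has_derivative[OF h(3)[unfolded numeral_2_eq_2] h(1)]) (use r h in auto)
  from diff_chain_at[OF c[unfolded has_field_derivative_def] this]
  have "((\<lambda>\<nu>. h (c \<nu>)) has_derivative (\<lambda>x. 0)) (at \<mu>)"
    using linear_0[OF has_derivative_linear[OF \<open>(h has_derivative _) _\<close>]] by (simp add: o_def)
  then have "((\<lambda>\<nu>. h (c \<nu>)) has_real_derivative 0) (at \<mu>)"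
    by (simp add: has_field_derivative_def lambda_zero)
  then have "(d has_real_derivative 0) (at \<mu>)"
    by (rule has_field_derivative_transform_within_open[where S = "{mu r<..<mu (Suc r)}"])
      (use r h \<theta>(2) in auto)
  with d show ?thesis by (rule DERIV_unique)
qed

lemma norm_g':
  assumes "r \<le> N" "mu r < \<mu>" "\<mu> < mu (Suc r)" shows "norm (g' \<mu>) = 1"
proof -
  have "\<forall>\<mu>\<in>{mu r<..<mu (Suc r)}. norm (g' \<mu>) = 1"
    using curve assms(1) unfolding boundary_curve_def by blast
  then show ?thesis using assms by simp
qed

lemma segment_cases:
  assumes "r \<le> N"
  obtains (vertical) c where "\<forall>\<mu>\<in>{mu r<..<mu (Suc r)}. fst (g \<mu>) = c"
    | (horizontal) c where "\<forall>\<mu>\<in>{mu r<..<mu (Suc r)}. snd (g \<mu>) = c"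
    | (graph) \<theta>1 \<theta>2 where "Ck_on 2 \<theta>1 ((\<lambda>\<mu>. snd (g \<mu>)) ` {mu r<..<mu (Suc r)})"
        "Ck_on 2 \<theta>2 ((\<lambda>\<mu>. fst (g \<mu>)) ` {mu r<..<mu (Suc r)})"
        "\<forall>\<mu>\<in>{mu r<..<mu (Suc r)}. fst (g \<mu>) = \<theta>1 (snd (g \<mu>))"
        "\<forall>\<mu>\<in>{mu r<..<mu (Suc r)}. snd (g \<mu>) = \<theta>2 (fst (g \<mu>))"
proof -
  from curve assms have "(\<exists>c. \<forall>\<mu>\<in>{mu r<..<mu (Suc r)}. fst (g \<mu>) = c) \<or>
         (\<exists>c. \<forall>\<mu>\<in>{mu r<..<mu (Suc r)}. snd (g \<mu>) = c) \<or>
         (\<exists>\<theta>1 \<theta>2 :: real \<Rightarrow> real.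
            Ck_on 2 \<theta>1 ((\<lambda>\<mu>. snd (g \<mu>)) ` {mu r<..<mu (Suc r)}) \<and>
            Ck_on 2 \<theta>2 ((\<lambda>\<mu>. fst (g \<mu>)) ` {mu r<..<mu (Suc r)}) \<and>
            (\<forall>\<mu>\<in>{mu r<..<mu (Suc r)}.
               fst (g \<mu>) = \<theta>1 (snd (g \<mu>)) \<and> snd (g \<mu>) = \<theta>2 (fst (g \<mu>))))"
    unfolding boundary_curve_def by blast
  then show thesis using that by blast
qed

lemma deriv_constant_segment:
  assumes "mu r < \<mu>" "\<mu> < mu (Suc r)" "\<forall>\<nu>\<in>{mu r<..<mu (Suc r)}. d \<nu> = (k::real)"
  shows "(d has_real_derivative 0) (at \<mu>)"
  by (rule has_field_derivative_transform_within_open[where S = "{mu r<..<mu (Suc r)}" and f = "\<lambda>_. k"])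
    (use assms in auto)

text \<open>If this component vanished, each kind of segment would lead to a contradiction: a
  vertical one lies on a vertex line, and in the other two the second component vanishes too,
  contrary to unit speed.\<close>

lemma fst_g'_nonzero:
  assumes \<mu>: "\<mu> \<in> {0..L} - V" and nv: "fst (g \<mu>) \<notin> (\<lambda>\<mu>. fst (g \<mu>)) ` V"
  shows "fst (g' \<mu>) \<noteq> 0"
proof
  assume 0: "fst (g' \<mu>) = 0"
  obtain r where r: "r \<le> N" "mu r < \<mu>" "\<mu> < mu (Suc r)" using in_segment[OF \<mu>] .
  have "snd (g' \<mu>) = 0" using r(1)
  proof (cases rule: segment_cases)
    case (vertical c)
    have "continuous_on {0..L} (\<lambda>\<mu>. fst (g \<mu>))" by (intro continuous_on_fst g_cont)
    from vertex_value_segment_end[OF r this vertical] nv show ?thesis by blast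
  next
    case (horizontal c)
    show ?thesis
      using DERIV_unique[OF g_deriv_snd[OF \<mu>] deriv_constant_segment[OF r(2,3) horizontal]] .
  next
    case (graph \<theta>1 \<theta>2)
    show ?thesis
      using segment_graph_tangent[OF r graph(2,4) g_deriv_fst[OF \<mu>, unfolded 0] g_deriv_snd[OF \<mu>]] .
  qed
  with 0 have "g' \<mu> = 0" by (simp add: prod_eq_iff)
  then show False using norm_g'[OF r] by simp
qed

lemma snd_g'_nonzero:
  assumes \<mu>: "\<mu> \<in> {0..L} - V" and nv: "snd (g \<mu>) \<notin> (\<lambda>\<mu>. snd (g \<mu>)) ` V"
  shows "snd (g' \<mu>) \<noteq> 0"
proof
  assume 0: "snd (g' \<mu>) = 0"
  obtain r where r: "r \<le> N" "mu r < \<mu>" "\<mu> < mu (Suc r)" using in_segment[OF \<mu>] .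
  have "fst (g' \<mu>) = 0" using r(1)
  proof (cases rule: segment_cases)
    case (horizontal c)
    have "continuous_on {0..L} (\<lambda>\<mu>. snd (g \<mu>))" by (intro continuous_on_snd g_cont)
    from vertex_value_segment_end[OF r this horizontal] nv show ?thesis by blast
  next
    case (vertical c)
    show ?thesis
      using DERIV_unique[OF g_deriv_fst[OF \<mu>] deriv_constant_segment[OF r(2,3) vertical]] .
  next
    case (graph \<theta>1 \<theta>2)
    show ?thesis
      using segment_graph_tangent[OF r graph(1,3) g_deriv_snd[OF \<mu>, unfolded 0] g_deriv_fst[OF \<mu>]] .
  qed
  with 0 have "g' \<mu> = 0" by (simp add: prod_eq_iff)
  then show False using norm_g'[OF r] by simp
qed

text \<open>These sets are open, which keeps all points near a regular point regular, and they treat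
  the coordinates separately, so that the crossing with the curve depends on one coordinate
  only.\<close>

definition "regular_s = {0<..<a} - (\<lambda>\<mu>. fst (g \<mu>)) ` V"
definition "regular_t = {0<..<b} - (\<lambda>\<mu>. snd (g \<mu>)) ` V"

lemma open_regular: "open regular_s" "open regular_t"
  unfolding regular_s_def regular_t_def
  by (intro open_Diff open_greaterThanLessThan finite_imp_closed finite_imageI finite_atMost)+

lemma finite_V: "finite V" and zero_in_V: "0 \<in> V" and L_in_V: "L \<in> V"
  using mu0 by (simp, metis atMost_iff image_eqI le0, simp)

text \<open>\<open>m s\<close> is the parameter where the curve crosses the abscissa
  \<open>s\<close>. As \<open>fst (g \<mu>)\<close> does not increase along the curve, it is the
  upper end of the arc \<open>\<gamma>(s, t)\<close>, whatever \<open>t\<close> is.\<close>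

lemma s_inverse:
  obtains m m' where "\<And>s. s \<in> regular_s \<Longrightarrow> m s \<in> {0..L} - V" "\<And>s. s \<in> regular_s \<Longrightarrow> fst (g (m s)) = s"
    "\<And>s \<mu>. s \<in> regular_s \<Longrightarrow> \<mu> \<in> {0..L} \<Longrightarrow> s \<le> fst (g \<mu>) \<longleftrightarrow> \<mu> \<le> m s"
    "\<And>s \<mu>. s \<in> regular_s \<Longrightarrow> \<mu> \<in> {0..L} \<Longrightarrow> fst (g \<mu>) \<le> s \<longleftrightarrow> m s \<le> \<mu>"
    "\<And>s. s \<in> regular_s \<Longrightarrow> (m has_real_derivative m' s) (at s)"
proof -
  define c where "c \<mu> = fst (g \<mu>)" for \<mu>
  have Q: "regular_s = {c L<..<c 0} - c ` V"
    using g_ends by (auto simp: c_def regular_s_def)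
  have cont: "continuous_on {0..L} c"
    unfolding c_def by (intro continuous_on_fst g_cont)
  have anti: "c \<nu> \<le> c \<mu>" if "0 \<le> \<mu>" "\<mu> \<le> \<nu>" "\<nu> \<le> L" for \<mu> \<nu>
    using g_mono[OF that] by (simp add: c_def)
  have der: "(c has_real_derivative fst (g' \<mu>)) (at \<mu>)" if "\<mu> \<in> {0..L} - V" for \<mu>
    unfolding c_def[abs_def] using g_deriv_fst[OF that] .
  have nz: "fst (g' \<mu>) \<noteq> 0" if "\<mu> \<in> {0..L} - V" "c \<mu> \<notin> c ` V" for \<mu>
    using fst_g'_nonzero[OF that(1)] that(2) by (auto simp: image_iff c_def)
  obtain m where "\<And>s. s \<in> {c L<..<c 0} - c ` V \<Longrightarrow> m s \<in> {0..L} - V"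
    "\<And>s. s \<in> {c L<..<c 0} - c ` V \<Longrightarrow> c (m s) = s"
    "\<And>s \<mu>. s \<in> {c L<..<c 0} - c ` V \<Longrightarrow> \<mu> \<in> {0..L} \<Longrightarrow> s \<le> c \<mu> \<longleftrightarrow> \<mu> \<le> m s"
    "\<And>s \<mu>. s \<in> {c L<..<c 0} - c ` V \<Longrightarrow> \<mu> \<in> {0..L} \<Longrightarrow> c \<mu> \<le> s \<longleftrightarrow> m s \<le> \<mu>"
    "\<And>s. s \<in> {c L<..<c 0} - c ` V \<Longrightarrow> (m has_real_derivative inverse (fst (g' (m s)))) (at s)"
    by (rule monotone_crossing_inverse[OF L_pos cont anti finite_V zero_in_V L_in_V der nz]) (assumption+, rule that, assumption+)
  from this[folded Q, unfolded c_def] show thesis by (rule that)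
qed

text \<open>Heights do not decrease along the curve, so the crossing lemma is applied to
  \<open>- snd (g \<mu>)\<close> at the level \<open>- t\<close>; here \<open>m t\<close> is the
  lower end of the arc.\<close>

lemma t_inverse:
  obtains m m' where "\<And>t. t \<in> regular_t \<Longrightarrow> m t \<in> {0..L} - V" "\<And>t. t \<in> regular_t \<Longrightarrow> snd (g (m t)) = t"
    "\<And>t \<mu>. t \<in> regular_t \<Longrightarrow> \<mu> \<in> {0..L} \<Longrightarrow> t \<le> snd (g \<mu>) \<longleftrightarrow> m t \<le> \<mu>"
    "\<And>t \<mu>. t \<in> regular_t \<Longrightarrow> \<mu> \<in> {0..L} \<Longrightarrow> snd (g \<mu>) \<le> t \<longleftrightarrow> \<mu> \<le> m t"
    "\<And>t. t \<in> regular_t \<Longrightarrow> (m has_real_derivative m' t) (at t)"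
proof -
  define Q where "Q = {- snd (g L)<..<- snd (g 0)} - (\<lambda>\<mu>. - snd (g \<mu>)) ` V"
  have Q: "t \<in> regular_t \<longleftrightarrow> - t \<in> Q" for t
    using g_ends by (auto simp: Q_def regular_t_def)
  define c where "c \<mu> = - snd (g \<mu>)" for \<mu>
  have Q_eq: "Q = {c L<..<c 0} - c ` V"
    by (auto simp: c_def Q_def)
  have cont: "continuous_on {0..L} c"
    unfolding c_def by (intro continuous_on_minus continuous_on_snd g_cont)
  have anti: "c \<nu> \<le> c \<mu>" if "0 \<le> \<mu>" "\<mu> \<le> \<nu>" "\<nu> \<le> L" for \<mu> \<nu>
    using g_mono[OF that] by (simp add: c_def)
  have der: "(c has_real_derivative - snd (g' \<mu>)) (at \<mu>)" if "\<mu> \<in> {0..L} - V" for \<mu>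
    unfolding c_def[abs_def] using g_deriv_snd[OF that] by (rule DERIV_minus)
  have nz: "- snd (g' \<mu>) \<noteq> 0" if "\<mu> \<in> {0..L} - V" "c \<mu> \<notin> c ` V" for \<mu>
    using snd_g'_nonzero[OF that(1)] that(2) by (auto simp: image_iff c_def)
  obtain m where "\<And>s. s \<in> {c L<..<c 0} - c ` V \<Longrightarrow> m s \<in> {0..L} - V"
    "\<And>s. s \<in> {c L<..<c 0} - c ` V \<Longrightarrow> c (m s) = s"
    "\<And>s \<mu>. s \<in> {c L<..<c 0} - c ` V \<Longrightarrow> \<mu> \<in> {0..L} \<Longrightarrow> s \<le> c \<mu> \<longleftrightarrow> \<mu> \<le> m s"
    "\<And>s \<mu>. s \<in> {c L<..<c 0} - c ` V \<Longrightarrow> \<mu> \<in> {0..L} \<Longrightarrow> c \<mu> \<le> s \<longleftrightarrow> m s \<le> \<mu>"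
    "\<And>s. s \<in> {c L<..<c 0} - c ` V \<Longrightarrow> (m has_real_derivative inverse (- snd (g' (m s)))) (at s)"
    by (rule monotone_crossing_inverse[OF L_pos cont anti finite_V zero_in_V L_in_V der nz]) (assumption+, rule that, assumption+)
  note m = this[folded Q_eq, unfolded c_def]
  show thesis
  proof (rule that[of "\<lambda>t. m (- t)" "\<lambda>t. - inverse (- snd (g' (m (- t))))"])
    fix t assume t: "t \<in> regular_t"
    then have Qt: "- t \<in> Q" by (simp add: Q)
    show "m (- t) \<in> {0..L} - V" using m(1) Qt .
    show "snd (g (m (- t))) = t" using m(2)[OF Qt] by simp
    show "t \<le> snd (g \<mu>) \<longleftrightarrow> m (- t) \<le> \<mu>" "snd (g \<mu>) \<le> t \<longleftrightarrow> \<mu> \<le> m (- t)" if "\<mu> \<in> {0..L}" for \<mu>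
      using m(3)[OF Qt that] m(4)[OF Qt that] by auto
    have "((\<lambda>t. m (- t)) has_real_derivative inverse (- snd (g' (m (- t)))) * (- 1)) (at t)"
      by (rule DERIV_chain2[where f = m and g = uminus, OF m(5)[OF Qt]]) (auto intro!: derivative_eq_intros)
    then show "((\<lambda>t. m (- t)) has_real_derivative - inverse (- snd (g' (m (- t))))) (at t)" by simp
  qed
qed

end

section \<open>Sources at the vertices, on the curve and in the interior\<close>

locale arc_kernel = boundary_arc + adjoint_kernel "region N mu g" r rs rt rst z0 fx fp fps fq fqt
  for r rs rt rst :: "'n::finite \<Rightarrow> real \<times> real \<Rightarrow> real \<times> real \<Rightarrow> real" and z0 fx fp fps fq fqt +
  assumes z0_regular: "fst z0 \<in> regular_s" "snd z0 \<in> regular_t"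
begin

lemma near_regular: "\<forall>\<^sub>F z in nhds z0. fst z \<in> regular_s \<and> snd z \<in> regular_t"
proof -
  have "open (regular_s \<times> regular_t)" by (intro open_Times open_regular)
  then have "\<forall>\<^sub>F z in nhds z0. z \<in> regular_s \<times> regular_t"
    using z0_regular by (intro eventually_nhds_in_open) (auto simp: mem_Times_iff)
  then show ?thesis by eventually_elim auto
qed

text \<open>A vertex is a point mass, modelled by counting measure on one element. Since its
  coordinate lines avoid the regular point, the cut-off is constant nearby and neither edge
  contributes.\<close>

lemma adjoint_solution_vertex:
  assumes k: "k \<le> Suc N"
  shows "adjoint_solution G z0 fx fp fps fq fqt
    (\<lambda>j z. if g (mu k) \<in> E G z then c * r j (g (mu k)) z else 0) (\<lambda>_. 0)"
proof -
  let ?P = "g (mu k)"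
  have PG: "?P \<in> G" using g_in_G mu_in k by blast
  have Ps: "s \<noteq> fst ?P" if "s \<in> regular_s" for s
    using that k by (auto simp: regular_s_def)
  have Pt: "t \<noteq> snd ?P" if "t \<in> regular_t" for t
    using that k by (auto simp: regular_t_def)
  have [simp]: "(\<integral>\<omega>. x \<partial>count_space {()}) = x" for x :: real
    by (simp add: lebesgue_integral_count_space_finite)
  have "adjoint_solution G z0 fx fp fps fq fqt
    (\<lambda>j z. \<integral>\<omega>. (if ?P \<in> E G z then c * r j ?P z else 0) \<partial>count_space {()}) (\<lambda>_. 0)"
  proof (rule adjoint_solution_layer[where \<alpha> = "\<lambda>_. 0" and \<beta> = "\<lambda>_ _. 0" and M = "count_space {()}"
        and \<pi> = "\<lambda>_. ?P" and w = "\<lambda>_. c"])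
    show "AE \<omega> in count_space {()}. fst ?P \<noteq> fst z0"
      using Ps[OF z0_regular(1)] by (auto intro!: AE_I2)
    show "\<forall>\<^sub>F z in nhds z0. z \<in> G \<longrightarrow> (AE \<omega> in count_space {()}. snd ?P \<noteq> snd z)"
      using near_regular
    proof eventually_elim
      case (elim z)
      then show ?case using Pt[of "snd z"] by (auto intro!: AE_I2)
    qed
    show "((\<lambda>s. \<integral>\<omega>. (if ?P \<in> E G (s, snd z0) then c * K ?P (fst ?P, snd z0) else 0) \<partial>count_space {()})
        has_real_derivative - 0) (at (fst z0) within {s. (s, snd z0) \<in> G})" for K :: "real \<times> real \<Rightarrow> real \<times> real \<Rightarrow> real"
    proof (rule has_field_derivative_transform_within[where d = "\<bar>fst ?P - fst z0\<bar>"
          and f = "\<lambda>_. if ?P \<in> E G z0 then c * K ?P (fst ?P, snd z0) else 0"])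
      \<comment> \<open>Within this distance \<open>s\<close> and \<open>fst z0\<close> lie on the
        same side of the vertex line.\<close>
      fix s assume s: "s \<in> {s. (s, snd z0) \<in> G}" "dist s (fst z0) < \<bar>fst ?P - fst z0\<bar>"
      then have "?P \<in> E G z0 \<longleftrightarrow> ?P \<in> E G (s, snd z0)"
        using G_nonneg[of "(s, snd z0)"] G_nonneg[OF z0] by (auto simp: mem_E_iff dist_real_def)
      then show "(if ?P \<in> E G z0 then c * K ?P (fst ?P, snd z0) else 0) =
        (\<integral>\<omega>. (if ?P \<in> E G (s, snd z0) then c * K ?P (fst ?P, snd z0) else 0) \<partial>count_space {()})"
        by simp
    qed (use z0 Ps[OF z0_regular(1)] in auto)
    show "\<forall>\<^sub>F z in nhds z0. z \<in> G \<longrightarrow> (\<forall>j.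
      ((\<lambda>t. \<integral>\<omega>. (if ?P \<in> E G (fst z, t) then c * r j ?P (fst z, snd ?P) else 0) \<partial>count_space {()})
        has_real_derivative - 0) (at (snd z) within {t. (fst z, t) \<in> G}))"
      using near_regular
    proof eventually_elim
      case (elim z)
      show ?case
      proof (intro impI allI)
        fix j assume z: "z \<in> G"
        show "((\<lambda>t. \<integral>\<omega>. (if ?P \<in> E G (fst z, t) then c * r j ?P (fst z, snd ?P) else 0) \<partial>count_space {()})
          has_real_derivative - 0) (at (snd z) within {t. (fst z, t) \<in> G})"
        proof (rule has_field_derivative_transform_within[where d = "\<bar>snd ?P - snd z\<bar>"
              and f = "\<lambda>_. if ?P \<in> E G z then c * r j ?P (fst z, snd ?P) else 0"])
          fix t assume t: "t \<in> {t. (fst z, t) \<in> G}" "dist t (snd z) < \<bar>snd ?P - snd z\<bar>"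
          then have "?P \<in> E G z \<longleftrightarrow> ?P \<in> E G (fst z, t)"
            using G_nonneg[of "(fst z, t)"] G_nonneg[OF z] by (auto simp: mem_E_iff dist_real_def)
          then show "(if ?P \<in> E G z then c * r j ?P (fst z, snd ?P) else 0) =
            (\<integral>\<omega>. (if ?P \<in> E G (fst z, t) then c * r j ?P (fst z, snd ?P) else 0) \<partial>count_space {()})"
            by simp
        qed (use z Pt[of "snd z"] elim in auto)
      qed
    qed
  qed (auto simp: integrable_count_space)
  then show ?thesis by simp
qed

text \<open>The curve sources dominating \<open>(s, t)\<close> are the parameters in
  \<open>{mt t..ms s}\<close>. Each edge therefore contributes the kernel at one end point, and that
  point shares a coordinate with \<open>(s, t)\<close>, so the matching adjoint edge condition
  applies. The lower end does not depend on \<open>s\<close>, hence no corner term arises.\<close>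

lemma adjoint_solution_curve:
  assumes w: "w \<in> borel_measurable borel" "\<And>\<mu>. \<bar>w \<mu>\<bar> \<le> C" "\<And>\<mu>. \<mu> \<notin> {0..L} \<Longrightarrow> w \<mu> = 0"
    and w_cont: "\<And>\<mu>. \<mu> \<in> {0..L} - V \<Longrightarrow> isCont w \<mu>"
  shows "adjoint_solution G z0 fx fp fps fq fqt
    (\<lambda>j z. \<integral>\<mu>. (if \<mu> \<in> {0..L} \<and> g \<mu> \<in> E G z then w \<mu> * r j (g \<mu>) z else 0) \<partial>lborel) (\<lambda>_. 0)"
proof -
  obtain ms ms' where ms: "\<And>s. s \<in> regular_s \<Longrightarrow> ms s \<in> {0..L} - V" "\<And>s. s \<in> regular_s \<Longrightarrow> fst (g (ms s)) = s"
    "\<And>s \<mu>. s \<in> regular_s \<Longrightarrow> \<mu> \<in> {0..L} \<Longrightarrow> s \<le> fst (g \<mu>) \<longleftrightarrow> \<mu> \<le> ms s"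
    "\<And>s \<mu>. s \<in> regular_s \<Longrightarrow> \<mu> \<in> {0..L} \<Longrightarrow> fst (g \<mu>) \<le> s \<longleftrightarrow> ms s \<le> \<mu>"
    "\<And>s. s \<in> regular_s \<Longrightarrow> (ms has_real_derivative ms' s) (at s)"
    by (rule s_inverse) (rule that, assumption+)
  obtain mt mt' where mt: "\<And>t. t \<in> regular_t \<Longrightarrow> mt t \<in> {0..L} - V" "\<And>t. t \<in> regular_t \<Longrightarrow> snd (g (mt t)) = t"
    "\<And>t \<mu>. t \<in> regular_t \<Longrightarrow> \<mu> \<in> {0..L} \<Longrightarrow> t \<le> snd (g \<mu>) \<longleftrightarrow> mt t \<le> \<mu>"
    "\<And>t \<mu>. t \<in> regular_t \<Longrightarrow> \<mu> \<in> {0..L} \<Longrightarrow> snd (g \<mu>) \<le> t \<longleftrightarrow> \<mu> \<le> mt t"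
    "\<And>t. t \<in> regular_t \<Longrightarrow> (mt has_real_derivative mt' t) (at t)"
    by (rule t_inverse) (rule that, assumption+)
  have reg_pos: "s \<in> regular_s \<Longrightarrow> 0 < s" "t \<in> regular_t \<Longrightarrow> 0 < t" for s t
    by (auto simp: regular_s_def regular_t_def)
  \<comment> \<open>Parameters beyond the curve are sent to a point outside the quadrant, which
    never belongs to \<open>E G z\<close>.\<close>
  define \<pi> where "\<pi> \<mu> = (if \<mu> \<in> {0..L} then g \<mu> else (-1, -1))" for \<mu>
  have outside: "(-1, -1) \<notin> E G z" for z using G_nonneg[of "(-1, -1)"] by (auto simp: mem_E_iff)
  have "\<pi> \<in> borel_measurable borel"
    unfolding \<pi>_def by (intro borel_measurable_continuous_on_if g_cont continuous_intros) auto
  then have \<pi>: "\<pi> \<in> borel_measurable lborel" by simp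
  have wi: "integrable lborel w"
    by (rule integrable_bounded_support[where p = 0 and q = L]) (use w in auto)
  have \<pi>_E: "\<pi> \<mu> \<in> E G z \<longleftrightarrow> \<mu> \<in> {0..L} \<and> g \<mu> \<in> E G z" for \<mu> z
    using outside by (auto simp: \<pi>_def)
  have \<pi>_in: "\<pi> \<mu> = g \<mu>" if "\<mu> \<in> {0..L}" for \<mu>
    using that by (simp add: \<pi>_def)
  \<comment> \<open>Putting one coordinate to 0 removes the corresponding cut-off and leaves an arc
    running to an end of the curve; the diagonal integrands are needed on such a fixed arc while the
    limit of integration moves inside it.\<close>
  have g_E: "g \<mu> \<in> E G (s, t) \<longleftrightarrow> mt t \<le> \<mu> \<and> \<mu> \<le> ms s"
    and g_E_s: "g \<mu> \<in> E G (s, 0) \<longleftrightarrow> \<mu> \<le> ms s"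
    and g_E_t: "g \<mu> \<in> E G (0, t) \<longleftrightarrow> mt t \<le> \<mu>"
    if "s \<in> regular_s" "t \<in> regular_t" "\<mu> \<in> {0..L}" for s t \<mu>
    using reg_pos(1)[OF that(1)] reg_pos(2)[OF that(2)] ms(3)[OF that(1,3)] mt(3)[OF that(2,3)]
      g_in_G[OF that(3)] g_nonneg[OF that(3)]
    by (auto simp: mem_E_iff)
  have le: "mt t \<le> ms s" and fst_le: "s \<le> fst (g (mt t))" and snd_le: "t \<le> snd (g (ms s))"
    if st: "s \<in> regular_s" "t \<in> regular_t" "(s, t) \<in> G" for s t
  proof -
    obtain \<mu> where "\<mu> \<in> {0..L}" "s \<le> fst (g \<mu>)" "t \<le> snd (g \<mu>)"
      using st(3) by (auto simp: mem_G_iff mem_W_iff)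
    then show "mt t \<le> ms s" using ms(3)[OF st(1)] mt(3)[OF st(2)] by force
    then show "s \<le> fst (g (mt t))" "t \<le> snd (g (ms s))"
      using ms(3)[OF st(1), of "mt t"] mt(3)[OF st(2), of "ms s"] ms(1)[OF st(1)] mt(1)[OF st(2)] by auto
  qed
  have ends: "g (ms s) \<in> E G (s, t)" "g (mt t) \<in> E G (s, t)"
    if "s \<in> regular_s" "t \<in> regular_t" "(s, t) \<in> G" for s t
    using fst_le[OF that] snd_le[OF that] ms(1,2)[OF that(1)] mt(1,2)[OF that(2)] reg_pos that g_in_G
    by (auto simp: mem_E_iff less_imp_le)
  obtain s0 t0 where z0_eq: "z0 = (s0, t0)" by fastforce
  have reg0: "s0 \<in> regular_s" "t0 \<in> regular_t" "(s0, t0) \<in> G" using z0_regular z0 z0_eq by auto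
  have K_cont: "continuous_on {\<mu>\<in>{0..L}. g \<mu> \<in> E G z} (\<lambda>\<mu>. K (g \<mu>) (c (g \<mu>)))"
    if K: "continuous_on (kernel_domain G) (\<lambda>(\<zeta>, z). K \<zeta> z)" and c: "continuous_on UNIV c"
      and cW: "\<And>\<zeta>. \<zeta> \<in> E G z \<Longrightarrow> c \<zeta> \<in> W \<zeta>"
    for K :: "real \<times> real \<Rightarrow> real \<times> real \<Rightarrow> real" and z c
    by (rule continuous_on_compose2[OF continuous_on_kernel_section[OF K c cW]])
      (auto intro: continuous_on_subset[OF g_cont])
  define \<alpha> where "\<alpha> K = - (w (ms s0) * K (g (ms s0)) (s0, t0) * ms' s0)" for K :: "real \<times> real \<Rightarrow> real \<times> real \<Rightarrow> real"
  define \<beta> where "\<beta> j z = w (mt (snd z)) * r j (g (mt (snd z))) z * mt' (snd z)" for j z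
  have "adjoint_solution G z0 fx fp fps fq fqt
    (\<lambda>j z. \<integral>\<mu>. (if \<pi> \<mu> \<in> E G z then w \<mu> * r j (\<pi> \<mu>) z else 0) \<partial>lborel) (\<lambda>_. 0)"
    unfolding z0_eq
  proof (rule adjoint_solution_layer[where \<alpha> = \<alpha> and \<beta> = \<beta>, unfolded z0_eq fst_conv snd_conv])
    have "AE \<mu> in lborel. \<mu> \<noteq> ms s0" by (rule AE_lborel_singleton)
    then show "AE \<mu> in lborel. fst (\<pi> \<mu>) \<noteq> s0"
    proof eventually_elim
      case (elim \<mu>)
      then show ?case using ms(3,4)[OF reg0(1), of \<mu>] reg_pos(1)[OF reg0(1)] by (auto simp: \<pi>_def)
    qed
    show "\<forall>\<^sub>F z in nhds (s0, t0). z \<in> G \<longrightarrow> (AE \<mu> in lborel. snd (\<pi> \<mu>) \<noteq> snd z)"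
      using near_regular unfolding z0_eq
    proof eventually_elim
      case (elim z)
      have "AE \<mu> in lborel. \<mu> \<noteq> mt (snd z)" by (rule AE_lborel_singleton)
      then have "AE \<mu> in lborel. snd (\<pi> \<mu>) \<noteq> snd z"
      proof eventually_elim
        case (elim \<mu>)
        then show ?case
          using mt(3,4)[of "snd z" \<mu>] reg_pos(2)[of "snd z"] \<open>_ \<and> _\<close> by (auto simp: \<pi>_def)
      qed
      then show ?case ..
    qed
    show "\<alpha> (rt j) = - (\<Sum>k\<in>UNIV. fp k j * \<alpha> (r k))" for j
    proof -
      have "rt j (g (ms s0)) (s0, t0) = - (\<Sum>k\<in>UNIV. fp k j * r k (g (ms s0)) (s0, t0))"
        using edge_s[of "g (ms s0)" j] ends(1)[OF reg0] ms(2)[OF reg0(1)] by (simp add: z0_eq)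
      then show ?thesis
        by (simp add: \<alpha>_def sum_negf sum_distrib_left sum_distrib_right algebra_simps)
    qed
    show "((\<lambda>s. \<beta> j (s, t0)) has_real_derivative - 0 - (\<Sum>k\<in>UNIV. fq k j * \<beta> k (s0, t0)))
        (at s0 within {s. (s, t0) \<in> G})" for j
    proof -
      let ?P = "g (mt t0)"
      have P: "?P \<in> G" "(s0, t0) \<in> W ?P" using ends(2)[OF reg0] by (auto simp: E_def)
      have "((\<lambda>s. r j ?P (s, t0)) has_real_derivative rs j ?P (s0, t0)) (at s0 within {0..fst ?P})"
        using r_s[OF P] by simp
      \<comment> \<open>\<open>?P\<close> is the rightmost point of the region at height
        \<open>t0\<close>, so the derivative known on \<open>{0..fst ?P}\<close> covers the whole
        section.\<close>
      moreover have "{s. (s, t0) \<in> G} \<subseteq> {0..fst ?P}"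
      proof safe
        fix s assume s: "(s, t0) \<in> G"
        then obtain \<mu> where \<mu>: "\<mu> \<in> {0..L}" "s \<le> fst (g \<mu>)" "t0 \<le> snd (g \<mu>)"
          by (auto simp: mem_G_iff mem_W_iff)
        then have "fst (g \<mu>) \<le> fst ?P"
          using mt(1)[OF reg0(2)] mt(3)[OF reg0(2), of \<mu>] g_mono[of "mt t0" \<mu>] by auto
        then show "s \<in> {0..fst ?P}" using G_nonneg[OF s] \<mu> by auto
      qed
      ultimately have "((\<lambda>s. r j ?P (s, t0)) has_real_derivative rs j ?P (s0, t0)) (at s0 within {s. (s, t0) \<in> G})"
        by (rule has_field_derivative_subset)
      then have "((\<lambda>s. w (mt t0) * r j ?P (s, t0) * mt' t0) has_real_derivative w (mt t0) * rs j ?P (s0, t0) * mt' t0)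
          (at s0 within {s. (s, t0) \<in> G})"
        by (intro DERIV_cmult DERIV_cmult_right)
      moreover have "rs j ?P (s0, t0) = - (\<Sum>k\<in>UNIV. fq k j * r k ?P (s0, t0))"
        using edge_t[of ?P j] ends(2)[OF reg0] mt(2)[OF reg0(2)] by (simp add: z0_eq)
      ultimately show ?thesis
        by (simp add: \<beta>_def sum_distrib_left sum_distrib_right algebra_simps)
    qed
    show "((\<lambda>s. \<integral>\<mu>. (if \<pi> \<mu> \<in> E G (s, t0) then w \<mu> * K (\<pi> \<mu>) (fst (\<pi> \<mu>), t0) else 0) \<partial>lborel)
        has_real_derivative - \<alpha> K) (at s0 within {s. (s, t0) \<in> G})"
      if K: "continuous_on (kernel_domain G) (\<lambda>(\<zeta>, z). K \<zeta> z)" for K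
    proof -
      define \<kappa> where "\<kappa> \<mu> = w \<mu> * K (g \<mu>) (fst (g \<mu>), t0)" for \<mu>
      have E_set: "{\<mu>\<in>{0..L}. g \<mu> \<in> E G (0, t0)} = {mt t0..L}"
        using mt(1)[OF reg0(2)] by (auto simp: g_E_t[OF reg0(1,2)])
      have "integrable lborel (\<lambda>\<mu>. if \<pi> \<mu> \<in> E G (0, t0) then w \<mu> * K (\<pi> \<mu>) (fst (\<pi> \<mu>), t0) else 0)"
        by (rule integrable_layer[OF compact K \<pi> wi, where c = "\<lambda>\<zeta>. (fst \<zeta>, t0)"])
          (auto simp: mem_E_iff mem_W_iff intro!: continuous_intros)
      also have "(\<lambda>\<mu>. if \<pi> \<mu> \<in> E G (0, t0) then w \<mu> * K (\<pi> \<mu>) (fst (\<pi> \<mu>), t0) else 0)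
          = (\<lambda>\<mu>. indicator {mt t0..L} \<mu> *\<^sub>R \<kappa> \<mu>)"
        using mt(1)[OF reg0(2)]
        by (intro ext) (auto simp: \<pi>_E \<pi>_in g_E_t[OF reg0(1,2)] \<kappa>_def indicator_def)
      finally have "set_integrable lborel {mt t0..L} \<kappa>" by (simp add: set_integrable_def)
      moreover have "continuous (at (ms s0) within {mt t0..L}) \<kappa>"
      proof -
        have "continuous_on {mt t0..L} (\<lambda>\<mu>. K (g \<mu>) (fst (g \<mu>), t0))"
          unfolding E_set[symmetric] by (rule K_cont[OF K, of "\<lambda>\<zeta>. (fst \<zeta>, t0)"])
            (auto simp: mem_E_iff mem_W_iff intro!: continuous_intros)
        then have "continuous (at (ms s0) within {mt t0..L}) (\<lambda>\<mu>. K (g \<mu>) (fst (g \<mu>), t0))"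
          using le[OF reg0] ms(1)[OF reg0(1)] by (simp add: continuous_on_eq_continuous_within)
        with continuous_at_imp_continuous_at_within[OF w_cont[OF ms(1)[OF reg0(1)]]] show ?thesis
          unfolding \<kappa>_def[abs_def] by (rule continuous_mult)
      qed
      \<comment> \<open>Intersecting with the open set \<open>regular_s\<close> confines
        \<open>s\<close> to where \<open>ms\<close> is known to be the crossing parameter; the
        filter at \<open>s0\<close> is unchanged by it.\<close>
      moreover have "(ms has_real_derivative ms' s0) (at s0 within {s. (s, t0) \<in> G} \<inter> regular_s)"
        using ms(5)[OF reg0(1)] by (rule has_field_derivative_at_within)
      ultimately have "((\<lambda>s. LINT \<mu>:{mt t0..ms s}|lborel. \<kappa> \<mu>) has_real_derivative \<kappa> (ms s0) * ms' s0)
          (at s0 within {s. (s, t0) \<in> G} \<inter> regular_s)"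
        by (rule has_real_derivative_upper_limit) (use le reg0 ms(1) in auto)
      then have "((\<lambda>s. \<integral>\<mu>. (if \<pi> \<mu> \<in> E G (s, t0) then w \<mu> * K (\<pi> \<mu>) (fst (\<pi> \<mu>), t0) else 0) \<partial>lborel)
          has_real_derivative \<kappa> (ms s0) * ms' s0) (at s0 within {s. (s, t0) \<in> G} \<inter> regular_s)"
      proof (rule has_field_derivative_transform_within[OF _ zero_less_one])
        fix s assume s: "s \<in> {s. (s, t0) \<in> G} \<inter> regular_s"
        show "(LINT \<mu>:{mt t0..ms s}|lborel. \<kappa> \<mu>)
            = (\<integral>\<mu>. (if \<pi> \<mu> \<in> E G (s, t0) then w \<mu> * K (\<pi> \<mu>) (fst (\<pi> \<mu>), t0) else 0) \<partial>lborel)"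
          unfolding set_lebesgue_integral_def
          by (intro Bochner_Integration.integral_cong refl)
            (use s reg0 ms(1)[of s] mt(1)[of t0] in \<open>auto simp: \<pi>_E \<pi>_in g_E \<kappa>_def indicator_def\<close>)
      qed (use reg0 in auto)
      also have "at s0 within {s. (s, t0) \<in> G} \<inter> regular_s = at s0 within {s. (s, t0) \<in> G}"
        by (rule at_within_nhd[OF reg0(1) open_regular(1)]) auto
      finally show ?thesis using ms(2)[OF reg0(1)] by (simp add: \<alpha>_def \<kappa>_def)
    qed
    show "\<forall>\<^sub>F z in nhds (s0, t0). z \<in> G \<longrightarrow> (\<forall>j.
      ((\<lambda>t. \<integral>\<mu>. (if \<pi> \<mu> \<in> E G (fst z, t) then w \<mu> * r j (\<pi> \<mu>) (fst z, snd (\<pi> \<mu>)) else 0) \<partial>lborel)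
        has_real_derivative - \<beta> j z) (at (snd z) within {t. (fst z, t) \<in> G}))"
      using near_regular unfolding z0_eq
    proof eventually_elim
      case (elim z)
      show ?case
      proof (intro impI allI)
        fix j assume "z \<in> G"
        obtain s t where z_eq: "z = (s, t)" by fastforce
        have reg: "s \<in> regular_s" "t \<in> regular_t" "(s, t) \<in> G" using elim \<open>z \<in> G\<close> z_eq by auto
        define \<kappa> where "\<kappa> \<mu> = w \<mu> * r j (g \<mu>) (s, snd (g \<mu>))" for \<mu>
        have E_set: "{\<mu>\<in>{0..L}. g \<mu> \<in> E G (s, 0)} = {0..ms s}"
          using ms(1)[OF reg(1)] by (auto simp: g_E_s[OF reg(1,2)])
        have "integrable lborel (\<lambda>\<mu>. if \<pi> \<mu> \<in> E G (s, 0) then w \<mu> * r j (\<pi> \<mu>) (s, snd (\<pi> \<mu>)) else 0)"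
          by (rule integrable_layer[OF compact cont(1) \<pi> wi, where c = "\<lambda>\<zeta>. (s, snd \<zeta>)"])
            (auto simp: mem_E_iff mem_W_iff intro!: continuous_intros)
        also have "(\<lambda>\<mu>. if \<pi> \<mu> \<in> E G (s, 0) then w \<mu> * r j (\<pi> \<mu>) (s, snd (\<pi> \<mu>)) else 0)
            = (\<lambda>\<mu>. indicator {0..ms s} \<mu> *\<^sub>R \<kappa> \<mu>)"
          using ms(1)[OF reg(1)]
          by (intro ext) (auto simp: \<pi>_E \<pi>_in g_E_s[OF reg(1,2)] \<kappa>_def indicator_def)
        finally have "set_integrable lborel {0..ms s} \<kappa>" by (simp add: set_integrable_def)
        moreover have "continuous (at (mt t) within {0..ms s}) \<kappa>"
        proof -
          have "continuous_on {0..ms s} (\<lambda>\<mu>. r j (g \<mu>) (s, snd (g \<mu>)))"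
            unfolding E_set[symmetric] by (rule K_cont[OF cont(1), of "\<lambda>\<zeta>. (s, snd \<zeta>)"])
              (auto simp: mem_E_iff mem_W_iff intro!: continuous_intros)
          then have "continuous (at (mt t) within {0..ms s}) (\<lambda>\<mu>. r j (g \<mu>) (s, snd (g \<mu>)))"
            using le[OF reg] mt(1)[OF reg(2)] by (simp add: continuous_on_eq_continuous_within)
          with continuous_at_imp_continuous_at_within[OF w_cont[OF mt(1)[OF reg(2)]]] show ?thesis
            unfolding \<kappa>_def[abs_def] by (rule continuous_mult)
        qed
        moreover have "(mt has_real_derivative mt' t) (at t within {t. (s, t) \<in> G} \<inter> regular_t)"
          using mt(5)[OF reg(2)] by (rule has_field_derivative_at_within)
        ultimately have "((\<lambda>t. LINT \<mu>:{mt t..ms s}|lborel. \<kappa> \<mu>) has_real_derivative - (\<kappa> (mt t) * mt' t))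
            (at t within {t. (s, t) \<in> G} \<inter> regular_t)"
          by (rule has_real_derivative_lower_limit) (use le reg mt(1) in auto)
        then have "((\<lambda>t. \<integral>\<mu>. (if \<pi> \<mu> \<in> E G (s, t) then w \<mu> * r j (\<pi> \<mu>) (s, snd (\<pi> \<mu>)) else 0) \<partial>lborel)
            has_real_derivative - (\<kappa> (mt t) * mt' t)) (at t within {t. (s, t) \<in> G} \<inter> regular_t)"
        proof (rule has_field_derivative_transform_within[OF _ zero_less_one])
          fix t' assume t': "t' \<in> {t. (s, t) \<in> G} \<inter> regular_t"
          show "(LINT \<mu>:{mt t'..ms s}|lborel. \<kappa> \<mu>)
              = (\<integral>\<mu>. (if \<pi> \<mu> \<in> E G (s, t') then w \<mu> * r j (\<pi> \<mu>) (s, snd (\<pi> \<mu>)) else 0) \<partial>lborel)"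
            unfolding set_lebesgue_integral_def
            by (intro Bochner_Integration.integral_cong refl)
              (use t' reg ms(1)[of s] mt(1)[of t'] in \<open>auto simp: \<pi>_E \<pi>_in g_E \<kappa>_def indicator_def\<close>)
        qed (use reg in auto)
        also have "at t within {t. (s, t) \<in> G} \<inter> regular_t = at t within {t. (s, t) \<in> G}"
          by (rule at_within_nhd[OF reg(2) open_regular(2)]) auto
        finally show "((\<lambda>t. \<integral>\<mu>. (if \<pi> \<mu> \<in> E G (fst z, t) then w \<mu> * r j (\<pi> \<mu>) (fst z, snd (\<pi> \<mu>)) else 0) \<partial>lborel)
            has_real_derivative - \<beta> j z) (at (snd z) within {t. (fst z, t) \<in> G})"
          using mt(2)[OF reg(2)] by (simp add: \<beta>_def \<kappa>_def z_eq cong: if_cong)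
      qed
    qed
  qed (fact \<pi> wi)+
  moreover have "(if \<pi> \<mu> \<in> E G z then w \<mu> * r j (\<pi> \<mu>) z else 0)
      = (if \<mu> \<in> {0..L} \<and> g \<mu> \<in> E G z then w \<mu> * r j (g \<mu>) z else 0)" for \<mu> z j
    by (auto simp: \<pi>_E \<pi>_in)
  ultimately show ?thesis by simp
qed

end

section \<open>Sources spread over the region\<close>

lemma AE_line:
  fixes s :: real
  shows "AE z :: real \<times> real in lborel. fst z \<noteq> s" "AE z :: real \<times> real in lborel. snd z \<noteq> s"
proof -
  have null: "AE z in lborel. z \<notin> S" if "negligible S" "closed S" for S :: "(real \<times> real) set"
    using that by (intro AE_not_in) (simp add: negligible_iff_null_sets null_sets_completion_iff borel_closed)
  have "negligible {z :: real \<times> real. fst z = s}" "negligible {z :: real \<times> real. snd z = s}"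
    using negligible_hyperplane[of "(1, 0) :: real \<times> real" s] negligible_hyperplane[of "(0, 1) :: real \<times> real" s]
    by (simp_all add: inner_prod_def prod_eq_iff)
  moreover have "closed {z :: real \<times> real. fst z = s}" "closed {z :: real \<times> real. snd z = s}"
    by (intro closed_Collect_eq continuous_intros)+
  ultimately show "AE z :: real \<times> real in lborel. fst z \<noteq> s" "AE z :: real \<times> real in lborel. snd z \<noteq> s"
    using null[of "{z. fst z = s}"] null[of "{z. snd z = s}"] by simp_all
qed

context arc_kernel
begin

text \<open>An explicit open part of \<open>G\<close>; a regular coordinate line meets the rest of
  \<open>G\<close> in a null set only, so continuity there is enough for the half-plane
  rule.\<close>

definition "inner_region = {z. 0 < fst z \<and> 0 < snd z \<and> (\<exists>\<mu>\<in>{0..L}. fst z < fst (g \<mu>) \<and> snd z < snd (g \<mu>))}"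

lemma open_inner_region: "open inner_region"
proof -
  have "inner_region = (\<Union>\<mu>\<in>{0..L}. {0<..<fst (g \<mu>)} \<times> {0<..<snd (g \<mu>)})"
    by (auto simp: inner_region_def)
  then show ?thesis by (auto intro!: open_Times)
qed

lemma inner_region_subset: "inner_region \<subseteq> G"
proof
  fix z assume "z \<in> inner_region"
  then obtain \<mu> where "\<mu> \<in> {0..L}" "z \<in> W (g \<mu>)" by (auto simp: inner_region_def mem_W_iff)
  then show "z \<in> G" by (auto simp: mem_G_iff)
qed

text \<open>Away from the boundary of \<open>G\<close> and from the edge
  \<open>c \<zeta> = p\<close>, the cut-off integrand coincides on an open set with \<open>h\<close>
  or with 0.\<close>

lemma isCont_truncated:
  fixes c :: "real \<times> real \<Rightarrow> real"
  assumes h: "continuous_on {\<zeta> \<in> G. p \<le> c \<zeta>} h" and c: "continuous_on UNIV c"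
    and \<zeta>: "\<zeta>0 \<in> inner_region \<union> - G" "c \<zeta>0 \<noteq> p"
  shows "isCont (\<lambda>\<zeta>. if \<zeta> \<in> G \<and> p \<le> c \<zeta> then h \<zeta> else 0 :: real) \<zeta>0"
proof -
  let ?f = "\<lambda>\<zeta>. if \<zeta> \<in> G \<and> p \<le> c \<zeta> then h \<zeta> else 0"
  have gt: "open {\<zeta>. p < c \<zeta>}" and lt: "open {\<zeta>. c \<zeta> < p}"
    using c by (intro open_Collect_less continuous_on_const; assumption)+
  consider "\<zeta>0 \<in> - G" | "\<zeta>0 \<in> {\<zeta>. c \<zeta> < p}" | "\<zeta>0 \<in> inner_region \<inter> {\<zeta>. p < c \<zeta>}"
    using \<zeta> by force
  then show ?thesis
  proof cases
    case 1
    have "open (- G)" using compact_G compact_imp_closed by blast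
    moreover have "continuous_on (- G) ?f"
      by (rule continuous_on_eq[of _ "\<lambda>_. 0"]) auto
    ultimately show ?thesis using 1 continuous_on_eq_continuous_at by blast
  next
    case 2
    have "continuous_on {\<zeta>. c \<zeta> < p} ?f"
      by (rule continuous_on_eq[of _ "\<lambda>_. 0"]) auto
    then show ?thesis using lt 2 continuous_on_eq_continuous_at by blast
  next
    case 3
    have "continuous_on (inner_region \<inter> {\<zeta>. p < c \<zeta>}) ?f"
      by (rule continuous_on_eq[OF continuous_on_subset[OF h]]) (use inner_region_subset in auto)
    moreover have "open (inner_region \<inter> {\<zeta>. p < c \<zeta>})" using open_inner_region gt by auto
    ultimately show ?thesis using 3 continuous_on_eq_continuous_at by blast
  qed
qed

text \<open>The exceptional heights are 0 and that of the crossing point \<open>g m\<close>. Below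
  \<open>g m\<close>, a curve point slightly before \<open>m\<close> is still above \<open>t\<close>
  by continuity and strictly to the right of \<open>s\<close>, because a regular abscissa is
  attained at one parameter only.\<close>

lemma regular_line_s:
  assumes s: "s \<in> regular_s" shows "AE t in lborel. (s, t) \<in> inner_region \<union> - G"
proof -
  obtain ms ms' where ms: "\<And>s. s \<in> regular_s \<Longrightarrow> ms s \<in> {0..L} - V" "\<And>s. s \<in> regular_s \<Longrightarrow> fst (g (ms s)) = s"
    "\<And>s \<mu>. s \<in> regular_s \<Longrightarrow> \<mu> \<in> {0..L} \<Longrightarrow> s \<le> fst (g \<mu>) \<longleftrightarrow> \<mu> \<le> ms s"
    "\<And>s \<mu>. s \<in> regular_s \<Longrightarrow> \<mu> \<in> {0..L} \<Longrightarrow> fst (g \<mu>) \<le> s \<longleftrightarrow> ms s \<le> \<mu>"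
    "\<And>s. s \<in> regular_s \<Longrightarrow> (ms has_real_derivative ms' s) (at s)"
    by (rule s_inverse) (rule that, assumption+)
  define m where "m = ms s"
  have m: "m \<in> {0..L} - V" and m_ne: "m \<noteq> 0" using ms(1)[OF s] zero_in_V by (auto simp: m_def)
  have "AE t in lborel. t \<noteq> 0" "AE t in lborel. t \<noteq> snd (g m)" by (rule AE_lborel_singleton)+
  then show ?thesis
  proof eventually_elim
    case (elim t)
    have "(s, t) \<in> inner_region" if G: "(s, t) \<in> G"
    proof -
      obtain \<mu> where \<mu>: "\<mu> \<in> {0..L}" "s \<le> fst (g \<mu>)" "t \<le> snd (g \<mu>)"
        using G by (auto simp: mem_G_iff mem_W_iff)
      then have "\<mu> \<le> m" using ms(3)[OF s] by (simp add: m_def)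
      then have "t < snd (g m)" using \<mu> m g_mono[of \<mu> m] elim by auto
      have "isCont (\<lambda>\<mu>. snd (g \<mu>)) m" using g_deriv_snd[OF m] by (rule DERIV_isCont)
      then have "\<forall>\<^sub>F \<nu> in at_left m. t < snd (g \<nu>)"
        using \<open>t < snd (g m)\<close>
        by (intro order_tendstoD) (auto simp: isCont_def intro: tendsto_mono[OF at_le])
      moreover have "\<forall>\<^sub>F \<nu> in at_left m. \<nu> \<in> {0<..<m}"
        using m m_ne by (intro eventually_at_leftI[of 0]) auto
      ultimately have "\<forall>\<^sub>F \<nu> in at_left m. t < snd (g \<nu>) \<and> \<nu> \<in> {0<..<m}"
        by (rule eventually_conj)
      then obtain \<nu> where \<nu>: "t < snd (g \<nu>)" "0 < \<nu>" "\<nu> < m"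
        using eventually_happens[of _ "at_left m"] trivial_limit_at_left_real by fastforce
      then have "s < fst (g \<nu>)" using ms(4)[OF s, of \<nu>] m by (force simp: m_def)
      then show ?thesis
        using \<nu> m G_nonneg[OF G] elim s by (auto simp: inner_region_def regular_s_def intro!: bexI[of _ \<nu>])
    qed
    then show ?case by blast
  qed
qed

lemma regular_line_t:
  assumes t: "t \<in> regular_t" shows "AE s in lborel. (s, t) \<in> inner_region \<union> - G"
proof -
  obtain mt mt' where mt: "\<And>t. t \<in> regular_t \<Longrightarrow> mt t \<in> {0..L} - V" "\<And>t. t \<in> regular_t \<Longrightarrow> snd (g (mt t)) = t"
    "\<And>t \<mu>. t \<in> regular_t \<Longrightarrow> \<mu> \<in> {0..L} \<Longrightarrow> t \<le> snd (g \<mu>) \<longleftrightarrow> mt t \<le> \<mu>"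
    "\<And>t \<mu>. t \<in> regular_t \<Longrightarrow> \<mu> \<in> {0..L} \<Longrightarrow> snd (g \<mu>) \<le> t \<longleftrightarrow> \<mu> \<le> mt t"
    "\<And>t. t \<in> regular_t \<Longrightarrow> (mt has_real_derivative mt' t) (at t)"
    by (rule t_inverse) (rule that, assumption+)
  define m where "m = mt t"
  have m: "m \<in> {0..L} - V" and m_ne: "m \<noteq> L" using mt(1)[OF t] L_in_V by (auto simp: m_def)
  have "AE s in lborel. s \<noteq> 0" "AE s in lborel. s \<noteq> fst (g m)" by (rule AE_lborel_singleton)+
  then show ?thesis
  proof eventually_elim
    case (elim s)
    have "(s, t) \<in> inner_region" if G: "(s, t) \<in> G"
    proof -
      obtain \<mu> where \<mu>: "\<mu> \<in> {0..L}" "s \<le> fst (g \<mu>)" "t \<le> snd (g \<mu>)"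
        using G by (auto simp: mem_G_iff mem_W_iff)
      then have "m \<le> \<mu>" using mt(3)[OF t] by (simp add: m_def)
      then have "s < fst (g m)" using \<mu> m g_mono[of m \<mu>] elim by auto
      have "isCont (\<lambda>\<mu>. fst (g \<mu>)) m" using g_deriv_fst[OF m] by (rule DERIV_isCont)
      then have "\<forall>\<^sub>F \<nu> in at_right m. s < fst (g \<nu>)"
        using \<open>s < fst (g m)\<close>
        by (intro order_tendstoD) (auto simp: isCont_def intro: tendsto_mono[OF at_le])
      moreover have "\<forall>\<^sub>F \<nu> in at_right m. \<nu> \<in> {m<..<L}"
        using m m_ne by (intro eventually_at_rightI[of m L]) auto
      ultimately have "\<forall>\<^sub>F \<nu> in at_right m. s < fst (g \<nu>) \<and> \<nu> \<in> {m<..<L}"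
        by (rule eventually_conj)
      then obtain \<nu> where \<nu>: "s < fst (g \<nu>)" "m < \<nu>" "\<nu> < L"
        using eventually_happens[of _ "at_right m"] trivial_limit_at_right_real by fastforce
      then have "t < snd (g \<nu>)" using mt(4)[OF t, of \<nu>] m by (force simp: m_def)
      then show ?thesis
        using \<nu> m G_nonneg[OF G] elim t by (auto simp: inner_region_def regular_t_def intro!: bexI[of _ \<nu>])
    qed
    then show ?case by blast
  qed
qed

lemma section_t:
  assumes t: "t \<in> regular_t" shows "\<exists>\<theta>. {s. (s, t) \<in> G} = {0..\<theta>}"
proof -
  obtain mt mt' where mt: "\<And>t. t \<in> regular_t \<Longrightarrow> mt t \<in> {0..L} - V" "\<And>t. t \<in> regular_t \<Longrightarrow> snd (g (mt t)) = t"
    "\<And>t \<mu>. t \<in> regular_t \<Longrightarrow> \<mu> \<in> {0..L} \<Longrightarrow> t \<le> snd (g \<mu>) \<longleftrightarrow> mt t \<le> \<mu>"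
    "\<And>t \<mu>. t \<in> regular_t \<Longrightarrow> \<mu> \<in> {0..L} \<Longrightarrow> snd (g \<mu>) \<le> t \<longleftrightarrow> \<mu> \<le> mt t"
    "\<And>t. t \<in> regular_t \<Longrightarrow> (mt has_real_derivative mt' t) (at t)"
    by (rule t_inverse) (rule that, assumption+)
  have "(s, t) \<in> G \<longleftrightarrow> s \<in> {0..fst (g (mt t))}" for s
  proof
    assume G: "(s, t) \<in> G"
    then obtain \<mu> where \<mu>: "\<mu> \<in> {0..L}" "s \<le> fst (g \<mu>)" "t \<le> snd (g \<mu>)"
      by (auto simp: mem_G_iff mem_W_iff)
    then have "fst (g \<mu>) \<le> fst (g (mt t))"
      using mt(1)[OF t] mt(3)[OF t, of \<mu>] g_mono[of "mt t" \<mu>] by auto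
    then show "s \<in> {0..fst (g (mt t))}" using G_nonneg[OF G] \<mu> by auto
  next
    assume "s \<in> {0..fst (g (mt t))}"
    then have "(s, t) \<in> W (g (mt t))" using mt(2)[OF t] t by (auto simp: mem_W_iff regular_t_def)
    then show "(s, t) \<in> G" using mt(1)[OF t] by (auto simp: mem_G_iff)
  qed
  then show ?thesis by blast
qed

text \<open>Here \<open>\<alpha>\<close> and \<open>\<beta>\<close> integrate over the vertical and
  the horizontal edge of \<open>E G z\<close>. In \<open>\<beta>\<close> both the kernel and the
  left end of the edge move with \<open>s\<close>: the kernel returns \<open>\<beta>\<close> through
  the adjoint edge condition, the moving end yields the corner term.\<close>

lemma adjoint_solution_area:
  assumes w: "continuous_on G w"
  shows "adjoint_solution G z0 fx fp fps fq fqt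
    (\<lambda>j z. \<integral>\<zeta>. (if \<zeta> \<in> E G z then w \<zeta> * r j \<zeta> z else 0) \<partial>lborel) (\<lambda>j. w z0 * r j z0 z0)"
proof -
  obtain s0 t0 where z0_eq: "z0 = (s0, t0)" by fastforce
  have reg0: "s0 \<in> regular_s" "t0 \<in> regular_t" "(s0, t0) \<in> G" using z0_regular z0 z0_eq by auto
  have reg_pos: "s \<in> regular_s \<Longrightarrow> 0 < s" "t \<in> regular_t \<Longrightarrow> 0 < t" for s t
    by (auto simp: regular_s_def regular_t_def)
  \<comment> \<open>Extension by 0 turns the weight into an integrable function on the plane and on
    every coordinate line without changing the integrals over \<open>E G z\<close>.\<close>
  define v where "v \<zeta> = (if \<zeta> \<in> G then w \<zeta> else 0)" for \<zeta>
  have v[measurable]: "v \<in> borel_measurable borel"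
    unfolding v_def by (intro borel_measurable_continuous_on_if w continuous_on_const borel_closed compact_imp_closed compact_G)
  have "bounded (w ` G)" using compact_continuous_image[OF w compact_G] by (rule compact_imp_bounded)
  then obtain C where C': "\<And>\<zeta>. \<zeta> \<in> G \<Longrightarrow> \<bar>w \<zeta>\<bar> \<le> C" unfolding bounded_iff by auto
  have C: "\<bar>v \<zeta>\<bar> \<le> \<bar>C\<bar>" for \<zeta> using C'[of \<zeta>] by (auto simp: v_def)
  have G_box: "\<zeta> \<in> G \<Longrightarrow> \<zeta> \<in> cbox (0, 0) (a, b)" for \<zeta>
    using G_nonneg[of \<zeta>] G_le[of \<zeta>] by (cases \<zeta>) (auto simp: cbox_Pair_eq)
  have v_int: "integrable lborel v"
    by (rule integrable_bounded_support[OF v C, of "(0, 0)" "(a, b)"]) (use G_box in \<open>auto simp: v_def\<close>)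
  have pair_meas: "Pair s \<in> borel_measurable borel" "(\<lambda>s. (s, t)) \<in> borel_measurable borel" for s t :: real
    by (intro borel_measurable_continuous_onI continuous_intros)+
  have v_s_int: "integrable lborel (\<lambda>t. v (s, t))" for s
    by (rule integrable_bounded_support[where C = "\<bar>C\<bar>" and p = 0 and q = b])
      (use C measurable_compose[OF pair_meas(1) v] G_nonneg G_le in \<open>force simp: v_def\<close>)+
  have v_t_int: "integrable lborel (\<lambda>s. v (s, t))" for t
    by (rule integrable_bounded_support[where C = "\<bar>C\<bar>" and p = 0 and q = a])
      (use C measurable_compose[OF pair_meas(2) v] G_nonneg G_le in \<open>force simp: v_def\<close>)+
  define \<alpha> where "\<alpha> K = (\<integral>t. (if (s0, t) \<in> E G (s0, t0) then v (s0, t) * K (s0, t) (s0, t0) else 0) \<partial>lborel)"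
    for K :: "real \<times> real \<Rightarrow> real \<times> real \<Rightarrow> real"
  define \<beta> where "\<beta> j z = (\<integral>s. (if (s, snd z) \<in> E G z then v (s, snd z) * r j (s, snd z) z else 0) \<partial>lborel)" for j z
  have "adjoint_solution G (s0, t0) fx fp fps fq fqt
    (\<lambda>j z. \<integral>\<zeta>. (if \<zeta> \<in> E G z then v \<zeta> * r j \<zeta> z else 0) \<partial>lborel) (\<lambda>j. v (s0, t0) * r j (s0, t0) (s0, t0))"
  proof (rule adjoint_solution_layer[where \<alpha> = \<alpha> and \<beta> = \<beta> and \<pi> = "\<lambda>\<zeta>. \<zeta>", unfolded z0_eq fst_conv snd_conv])
    show "AE \<zeta> :: real \<times> real in lborel. fst \<zeta> \<noteq> s0" by (rule AE_line)
    show "\<forall>\<^sub>F z in nhds (s0, t0). z \<in> G \<longrightarrow> (AE \<zeta> :: real \<times> real in lborel. snd \<zeta> \<noteq> snd z)"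
      by (simp add: AE_line)
    show "\<alpha> (rt j) = - (\<Sum>k\<in>UNIV. fp k j * \<alpha> (r k))" for j
    proof -
      let ?i = "\<lambda>K t. if (s0, t) \<in> E G (s0, t0) then v (s0, t) * K (s0, t) (s0, t0) else 0"
      have int: "integrable lborel (?i (r k))" for k
        by (rule integrable_layer[OF compact cont(1) _ v_s_int, where c = "\<lambda>_. (s0, t0)"])
          (use pair_meas in \<open>auto simp: E_def\<close>)
      have "?i (rt j) t = - (\<Sum>k\<in>UNIV. fp k j * ?i (r k) t)" for t
        using edge_s[of "(s0, t)" j] by (simp add: z0_eq sum_distrib_left algebra_simps)
      then show ?thesis
        unfolding \<alpha>_def using int by (simp add: Bochner_Integration.integral_sum)
    qed
    show "((\<lambda>s. \<integral>\<zeta>. (if \<zeta> \<in> E G (s, t0) then v \<zeta> * K \<zeta> (fst \<zeta>, t0) else 0) \<partial>lborel)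
        has_real_derivative - \<alpha> K) (at s0 within {s. (s, t0) \<in> G})"
      if K: "continuous_on (kernel_domain G) (\<lambda>(\<zeta>, z). K \<zeta> z)" for K
    proof -
      \<comment> \<open>The diagonal value at the edge \<open>\<sigma> = s\<close> is the kernel at
        \<open>(fst \<zeta>, t0)\<close>, so \<open>s\<close> survives only in the half-plane
        condition \<open>s \<le> fst \<zeta>\<close>, and \<open>f\<close> itself does not depend on
        it.\<close>
      define f where "f \<zeta> = (if \<zeta> \<in> G \<and> t0 \<le> snd \<zeta> then w \<zeta> * K \<zeta> (fst \<zeta>, t0) else 0)" for \<zeta>
      have E_set: "E G (0, t0) = {\<zeta> \<in> G. t0 \<le> snd \<zeta>}"
        using G_nonneg reg_pos(2)[OF reg0(2)] by (auto simp: mem_E_iff)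
      have h: "continuous_on {\<zeta> \<in> G. t0 \<le> snd \<zeta>} (\<lambda>\<zeta>. w \<zeta> * K \<zeta> (fst \<zeta>, t0))"
        unfolding E_set[symmetric]
        by (intro continuous_on_mult continuous_on_subset[OF w]
            continuous_on_kernel_section[OF K, where c = "\<lambda>\<zeta>. (fst \<zeta>, t0)"] continuous_intros)
          (auto simp: mem_E_iff mem_W_iff)
      obtain CK where CK: "0 \<le> CK" "\<And>\<zeta> z. \<zeta> \<in> G \<Longrightarrow> z \<in> W \<zeta> \<Longrightarrow> \<bar>K \<zeta> z\<bar> \<le> CK"
        using kernel_bounded[OF compact K] by blast
      have "((\<lambda>s. \<integral>\<zeta>. (if s \<le> fst \<zeta> then f \<zeta> else 0) \<partial>lborel) has_real_derivative - (\<integral>t. f (s0, t) \<partial>lborel)) (at s0)"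
      proof (rule half_plane_derivative_fst[where C = "\<bar>C\<bar> * CK" and p = "(0, 0)" and q = "(a, b)"])
        show "f \<in> borel_measurable borel"
          using borel_measurable_continuous_on_if[OF _ h continuous_on_const, of 0]
            closed_E[OF compact_G, of "(0, t0)"] unfolding f_def[abs_def] E_set by auto
        show "\<bar>f \<zeta>\<bar> \<le> \<bar>C\<bar> * CK" for \<zeta>
          using C[of \<zeta>] CK(2)[of \<zeta> "(fst \<zeta>, t0)"] CK(1) G_nonneg[of \<zeta>] reg_pos(2)[OF reg0(2)]
          by (auto simp: f_def v_def abs_mult mem_W_iff intro!: mult_mono)
        show "f \<zeta> = 0" if "\<zeta> \<notin> cbox (0, 0) (a, b)" for \<zeta>
          using that G_box[of \<zeta>] by (auto simp: f_def)
        \<comment> \<open>The edge \<open>\<tau> = t0\<close> meets the line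
          \<open>\<sigma> = s0\<close> in one point, the boundary of the region meets it in a null
          set.\<close>
        have "AE t in lborel. t \<noteq> t0" by (rule AE_lborel_singleton)
        with regular_line_s[OF reg0(1)] show "AE t in lborel. isCont f (s0, t)"
        proof eventually_elim
          case (elim t)
          then show ?case unfolding f_def[abs_def] by (intro isCont_truncated h continuous_intros) auto
        qed
      qed
      then have der: "((\<lambda>s. \<integral>\<zeta>. (if s \<le> fst \<zeta> then f \<zeta> else 0) \<partial>lborel) has_real_derivative - (\<integral>t. f (s0, t) \<partial>lborel))
          (at s0 within {s. (s, t0) \<in> G})"
        by (rule has_field_derivative_at_within)
      have \<alpha>_eq: "(\<integral>t. f (s0, t) \<partial>lborel) = \<alpha> K"
        unfolding \<alpha>_def f_def using reg_pos(1)[OF reg0(1)] reg_pos(2)[OF reg0(2)]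
        by (intro Bochner_Integration.integral_cong refl) (auto simp: mem_E_iff v_def)
      have f_eq: "(if \<zeta> \<in> E G (s, t0) then v \<zeta> * K \<zeta> (fst \<zeta>, t0) else 0) = (if s \<le> fst \<zeta> then f \<zeta> else 0)"
        if "(s, t0) \<in> G" for s \<zeta>
        using G_nonneg[OF that] by (auto simp: mem_E_iff f_def v_def)
      show ?thesis
        by (rule has_field_derivative_transform_within[OF der[unfolded \<alpha>_eq] zero_less_one])
          (use reg0 in \<open>simp_all add: f_eq\<close>)
    qed
    show "\<forall>\<^sub>F z in nhds (s0, t0). z \<in> G \<longrightarrow> (\<forall>j.
      ((\<lambda>t. \<integral>\<zeta>. (if \<zeta> \<in> E G (fst z, t) then v \<zeta> * r j \<zeta> (fst z, snd \<zeta>) else 0) \<partial>lborel)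
        has_real_derivative - \<beta> j z) (at (snd z) within {t. (fst z, t) \<in> G}))"
      using near_regular unfolding z0_eq
    proof eventually_elim
      case (elim z)
      show ?case
      proof (intro impI allI)
        fix j assume "z \<in> G"
        obtain s t where z_eq: "z = (s, t)" by fastforce
        have reg: "s \<in> regular_s" "t \<in> regular_t" "(s, t) \<in> G" using elim \<open>z \<in> G\<close> z_eq by auto
        define f where "f \<zeta> = (if \<zeta> \<in> G \<and> s \<le> fst \<zeta> then w \<zeta> * r j \<zeta> (s, snd \<zeta>) else 0)" for \<zeta>
        have E_set: "E G (s, 0) = {\<zeta> \<in> G. s \<le> fst \<zeta>}"
          using G_nonneg reg_pos(1)[OF reg(1)] by (auto simp: mem_E_iff)
        have h: "continuous_on {\<zeta> \<in> G. s \<le> fst \<zeta>} (\<lambda>\<zeta>. w \<zeta> * r j \<zeta> (s, snd \<zeta>))"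
          unfolding E_set[symmetric]
          by (intro continuous_on_mult continuous_on_subset[OF w]
              continuous_on_kernel_section[OF cont(1), where c = "\<lambda>\<zeta>. (s, snd \<zeta>)"] continuous_intros)
            (auto simp: mem_E_iff mem_W_iff)
        obtain CK where CK: "0 \<le> CK" "\<And>\<zeta> z. \<zeta> \<in> G \<Longrightarrow> z \<in> W \<zeta> \<Longrightarrow> \<bar>r j \<zeta> z\<bar> \<le> CK"
          using kernel_bounded[OF compact cont(1)] by blast
        have "((\<lambda>t. \<integral>\<zeta>. (if t \<le> snd \<zeta> then f \<zeta> else 0) \<partial>lborel) has_real_derivative - (\<integral>s. f (s, t) \<partial>lborel)) (at t)"
        proof (rule half_plane_derivative_snd[where C = "\<bar>C\<bar> * CK" and p = "(0, 0)" and q = "(a, b)"])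
          show "f \<in> borel_measurable borel"
            using borel_measurable_continuous_on_if[OF _ h continuous_on_const, of 0]
              closed_E[OF compact_G, of "(s, 0)"] unfolding f_def[abs_def] E_set by auto
          show "\<bar>f \<zeta>\<bar> \<le> \<bar>C\<bar> * CK" for \<zeta>
            using C[of \<zeta>] CK(2)[of \<zeta> "(s, snd \<zeta>)"] CK(1) G_nonneg[of \<zeta>] reg_pos(1)[OF reg(1)]
            by (auto simp: f_def v_def abs_mult mem_W_iff intro!: mult_mono)
          show "f \<zeta> = 0" if "\<zeta> \<notin> cbox (0, 0) (a, b)" for \<zeta>
            using that G_box[of \<zeta>] by (auto simp: f_def)
          have "AE s' in lborel. s' \<noteq> s" by (rule AE_lborel_singleton)
          with regular_line_t[OF reg(2)] show "AE s' in lborel. isCont f (s', t)"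
          proof eventually_elim
            case (elim s')
            then show ?case unfolding f_def[abs_def] by (intro isCont_truncated h continuous_intros) auto
          qed
        qed
        then have der: "((\<lambda>t. \<integral>\<zeta>. (if t \<le> snd \<zeta> then f \<zeta> else 0) \<partial>lborel) has_real_derivative - (\<integral>s. f (s, t) \<partial>lborel))
            (at t within {t. (s, t) \<in> G})"
          by (rule has_field_derivative_at_within)
        have \<beta>_eq: "(\<integral>s. f (s, t) \<partial>lborel) = \<beta> j z"
          unfolding \<beta>_def f_def z_eq using reg_pos(1)[OF reg(1)] reg_pos(2)[OF reg(2)]
          by (intro Bochner_Integration.integral_cong refl) (auto simp: mem_E_iff v_def)
        have f_eq: "(if \<zeta> \<in> E G (s, t') then v \<zeta> * r j \<zeta> (s, snd \<zeta>) else 0) = (if t' \<le> snd \<zeta> then f \<zeta> else 0)"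
          if "(s, t') \<in> G" for t' \<zeta>
          using G_nonneg[OF that] by (auto simp: mem_E_iff f_def v_def)
        show "((\<lambda>t. \<integral>\<zeta>. (if \<zeta> \<in> E G (fst z, t) then v \<zeta> * r j \<zeta> (fst z, snd \<zeta>) else 0) \<partial>lborel)
            has_real_derivative - \<beta> j z) (at (snd z) within {t. (fst z, t) \<in> G})"
          unfolding z_eq fst_conv snd_conv
          by (rule has_field_derivative_transform_within[OF der[unfolded \<beta>_eq z_eq] zero_less_one])
            (use reg in \<open>simp_all add: f_eq\<close>)
      qed
    qed
    \<comment> \<open>\<open>\<beta>\<close> is itself a superposition of sources, placed at
      \<open>(x, t0)\<close> with weight \<open>v (x, t0)\<close>, so the rule for the
      \<open>s\<close>-derivative applies a second time, now on a line. Its diagonal part is the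
      integral of \<open>\<kappa>\<close> from \<open>s\<close> on and contributes
      \<open>- \<kappa> s0\<close>, the corner value.\<close>
    show "((\<lambda>s. \<beta> j (s, t0)) has_real_derivative - (v (s0, t0) * r j (s0, t0) (s0, t0)) - (\<Sum>k\<in>UNIV. fq k j * \<beta> k (s0, t0)))
        (at s0 within {s. (s, t0) \<in> G})" for j
    proof -
      obtain \<theta> where \<theta>: "{s. (s, t0) \<in> G} = {0..\<theta>}" using section_t[OF reg0(2)] by blast
      define \<kappa> where "\<kappa> s = v (s, t0) * r j (s, t0) (s, t0)" for s
      have in_G: "s \<in> {0..\<theta>} \<longleftrightarrow> (s, t0) \<in> G" for s using \<theta> by blast
      have "continuous_on {0..\<theta>} (\<lambda>s. w (s, t0) * (\<lambda>(\<zeta>, z). r j \<zeta> z) ((s, t0), (s, t0)))"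
        by (intro continuous_on_mult continuous_on_compose2[OF w] continuous_on_compose2[OF cont(1)] continuous_intros)
          (use in_G G_nonneg in \<open>force simp: kernel_domain_def mem_W_iff\<close>)+
      then have \<kappa>_cont: "continuous_on {0..\<theta>} \<kappa>"
        by (rule continuous_on_eq) (use in_G in \<open>auto simp: \<kappa>_def v_def\<close>)
      have "((\<lambda>s. LINT x:{s..\<theta>}|lborel. \<kappa> x) has_real_derivative - (\<kappa> s0 * 1)) (at s0 within {0..\<theta>})"
      proof (rule has_real_derivative_lower_limit)
        show "set_integrable lborel {0..\<theta>} \<kappa>" using \<kappa>_cont by (rule borel_integrable_atLeastAtMost')
        show "continuous (at s0 within {0..\<theta>}) \<kappa>"
          using \<kappa>_cont reg0(3) in_G by (simp add: continuous_on_eq_continuous_within)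
      qed (use reg0(3) in_G in auto)
      then have "((\<lambda>s. \<integral>x. (if (x, t0) \<in> E G (s, t0) then v (x, t0) * r j (x, t0) (fst (x, t0), t0) else 0) \<partial>lborel)
          has_real_derivative - (\<kappa> s0 * 1)) (at s0 within {0..\<theta>})"
      proof (rule has_field_derivative_transform_within[OF _ zero_less_one])
        fix s assume s: "s \<in> {0..\<theta>}"
        show "(LINT x:{s..\<theta>}|lborel. \<kappa> x)
            = (\<integral>x. (if (x, t0) \<in> E G (s, t0) then v (x, t0) * r j (x, t0) (fst (x, t0), t0) else 0) \<partial>lborel)"
          unfolding set_lebesgue_integral_def
        proof (intro Bochner_Integration.integral_cong refl)
          fix x
          have "(x, t0) \<in> E G (s, t0) \<longleftrightarrow> x \<in> {s..\<theta>}"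
            using in_G[of x] s reg_pos(2)[OF reg0(2)] by (auto simp: mem_E_iff)
          then show "indicat_real {s..\<theta>} x *\<^sub>R \<kappa> x
            = (if (x, t0) \<in> E G (s, t0) then v (x, t0) * r j (x, t0) (fst (x, t0), t0) else 0)"
            by (simp add: \<kappa>_def)
        qed
      qed (use reg0(3) in_G in auto)
      then have slice: "((\<lambda>s. \<integral>x. (if (x, t0) \<in> E G (s, t0) then v (x, t0) * r j (x, t0) (fst (x, t0), t0) else 0) \<partial>lborel)
          has_real_derivative - \<kappa> s0) (at s0 within {s. (s, t0) \<in> G})"
        unfolding \<theta> by simp
      have \<pi>: "(\<lambda>s. (s, t0)) \<in> borel_measurable lborel" using pair_meas(2) by simp
      have "AE x in lborel. fst (x, t0) \<noteq> s0" using AE_lborel_singleton[of s0] by simp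
      from layer_s_derivative[OF compact nonneg cont(1,2) r_s \<pi> v_t_int reg0(3) this slice]
      have der: "((\<lambda>s. \<beta> j (s, t0)) has_real_derivative
          (\<integral>x. (if (x, t0) \<in> E G (s0, t0) then v (x, t0) * rs j (x, t0) (s0, t0) else 0) \<partial>lborel) + - \<kappa> s0)
          (at s0 within {s. (s, t0) \<in> G})"
        by (simp add: \<beta>_def cong: if_cong)
      let ?i = "\<lambda>K s. if (s, t0) \<in> E G (s0, t0) then v (s, t0) * K (s, t0) (s0, t0) else 0"
      have int: "integrable lborel (?i (r k))" for k
        by (rule integrable_layer[OF compact cont(1) \<pi> v_t_int, where c = "\<lambda>_. (s0, t0)"]) (auto simp: E_def)
      have "?i (rs j) s = - (\<Sum>k\<in>UNIV. fq k j * ?i (r k) s)" for s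
        using edge_t[of "(s, t0)" j] by (simp add: z0_eq sum_distrib_left algebra_simps)
      then have "(\<integral>x. ?i (rs j) x \<partial>lborel) = - (\<Sum>k\<in>UNIV. fq k j * \<beta> k (s0, t0))"
        unfolding \<beta>_def snd_conv using int by (simp add: Bochner_Integration.integral_sum)
      moreover have "A + - B = - B - C" if "A = - C" for A B C :: real using that by simp
      ultimately show ?thesis using der unfolding \<kappa>_def by metis
    qed
  qed (use v_int in auto)
  moreover have "(if \<zeta> \<in> E G z then v \<zeta> * r j \<zeta> z else 0) = (if \<zeta> \<in> E G z then w \<zeta> * r j \<zeta> z else 0)" for \<zeta> z j
    by (auto simp: v_def E_def)
  ultimately show ?thesis using reg0(3) by (simp add: v_def z0_eq)
qed

end

section \<open>Smoothness along the state\<close>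

lemma frechet_derivative_cong_open:
  assumes "open S" "z \<in> S" "\<And>y. y \<in> S \<Longrightarrow> \<phi> y = \<psi> y" "\<phi> differentiable (at z)"
  shows "(\<psi> has_derivative frechet_derivative \<phi> (at z)) (at z)"
    "frechet_derivative \<psi> (at z) = frechet_derivative \<phi> (at z)"
proof -
  have "(\<phi> has_derivative frechet_derivative \<phi> (at z)) (at z)"
    using assms(4) by (simp only: frechet_derivative_works)
  then show *: "(\<psi> has_derivative frechet_derivative \<phi> (at z)) (at z)"
    by (rule has_derivative_transform_within_open[OF _ assms(1-3)])
  then show "frechet_derivative \<psi> (at z) = frechet_derivative \<phi> (at z)"
    by (rule frechet_derivative_at[symmetric])
qed

lemma Ck_open_cong:
  assumes "Ck_open k \<phi> S" "open S" "\<And>z. z \<in> S \<Longrightarrow> \<phi> z = \<psi> z"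
  shows "Ck_open k \<psi> S"
  using assms(1,3)
proof (induction k arbitrary: \<phi> \<psi>)
  case 0
  then show ?case by (simp cong: continuous_on_cong)
next
  case (Suc k)
  have diff: "\<phi> differentiable (at z)" if "z \<in> S" for z
    using Ck_open_Suc_has_derivative[OF Suc.prems(1) assms(2) that] by (rule differentiableI)
  have "\<psi> differentiable_on S"
    unfolding differentiable_on_def
  proof
    fix z assume z: "z \<in> S"
    show "\<psi> differentiable (at z within S)"
      using frechet_derivative_cong_open(1)[OF assms(2) z Suc.prems(2) diff[OF z]]
      by (auto intro: differentiable_at_withinI differentiableI)
  qed
  moreover have "Ck_open k (\<lambda>z. frechet_derivative \<psi> (at z) v) S" for v
  proof (rule Suc.IH)
    show "Ck_open k (\<lambda>z. frechet_derivative \<phi> (at z) v) S" using Suc.prems(1) by simp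
    show "frechet_derivative \<phi> (at z) v = frechet_derivative \<psi> (at z) v" if "z \<in> S" for z
      using frechet_derivative_cong_open(2)[OF assms(2) that Suc.prems(2) diff[OF that]] by simp
  qed
  ultimately show ?case by simp
qed

text \<open>By induction, as differentiation commutes with a bounded linear map; used to pass from
  vector- and matrix-valued functions to their entries.\<close>

lemma Ck_open_linear:
  assumes "Ck_open k \<phi> S" "open S" "bounded_linear h"
  shows "Ck_open k (\<lambda>z. h (\<phi> z)) S"
  using assms(1)
proof (induction k arbitrary: \<phi>)
  case 0
  then show ?case using bounded_linear.continuous_on[OF assms(3)] by simp
next
  case (Suc k)
  have der: "((\<lambda>z. h (\<phi> z)) has_derivative (\<lambda>v. h (frechet_derivative \<phi> (at z) v))) (at z)" if "z \<in> S" for z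
    using Ck_open_Suc_has_derivative[OF Suc.prems assms(2) that]
    by (rule bounded_linear.has_derivative[OF assms(3)])
  have "(\<lambda>z. h (\<phi> z)) differentiable_on S"
    using der by (auto simp: differentiable_on_def intro: differentiable_at_withinI differentiableI)
  moreover have "Ck_open k (\<lambda>z. frechet_derivative (\<lambda>z. h (\<phi> z)) (at z) v) S" for v
  proof (rule Ck_open_cong[OF Suc.IH assms(2)])
    show "Ck_open k (\<lambda>z. frechet_derivative \<phi> (at z) v) S" using Suc.prems by simp
    show "h (frechet_derivative \<phi> (at z) v) = frechet_derivative (\<lambda>z. h (\<phi> z)) (at z) v" if "z \<in> S" for z
      using fun_cong[OF frechet_derivative_at[OF der[OF that]], of v] .
  qed
  ultimately show ?case by simp
qed

lemma Ck_on_linear: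
  assumes "Ck_on k \<phi> S" "bounded_linear h" shows "Ck_on k (\<lambda>z. h (\<phi> z)) S"
proof -
  obtain \<Omega> \<phi>' where "open \<Omega>" "S \<subseteq> \<Omega>" "Ck_open k \<phi>' \<Omega>" "\<forall>z\<in>S. \<phi>' z = \<phi> z"
    using assms(1) unfolding Ck_on_def by blast
  then show ?thesis
    unfolding Ck_on_def using Ck_open_linear[OF _ _ assms(2)]
    by (intro exI[of _ \<Omega>] exI[of _ "\<lambda>z. h (\<phi>' z)"]) auto
qed

text \<open>The jets over \<open>G\<close> and \<open>U\<close> need not form an open set, yet the
  slots of \<open>x\<close>, \<open>p\<close> and \<open>q\<close> range over the full space. In
  these directions the partial derivatives are therefore those of any smooth extension.\<close>

lemma jet_partials:
  fixes \<Phi> \<Phi>' :: "('n::finite, 'm::finite) jet \<Rightarrow> real"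
  assumes der: "(\<Phi>' has_derivative D) (at (s, t, y, p, q, v))"
    and eq: "\<And>y p q. \<Phi> (s, t, y, p, q, v) = \<Phi>' (s, t, y, p, q, v)"
  shows "((\<lambda>h. \<Phi> (s, t, y + h *\<^sub>R axis i 1, p, q, v)) has_real_derivative D (0, 0, axis i 1, 0, 0, 0)) (at 0)"
    "((\<lambda>h. \<Phi> (s, t, y, p + h *\<^sub>R axis i 1, q, v)) has_real_derivative D (0, 0, 0, axis i 1, 0, 0)) (at 0)"
    "((\<lambda>h. \<Phi> (s, t, y, p, q + h *\<^sub>R axis i 1, v)) has_real_derivative D (0, 0, 0, 0, axis i 1, 0)) (at 0)"
    "D_x i \<Phi> (s, t, y, p, q, v) = D (0, 0, axis i 1, 0, 0, 0)"
    "D_p i \<Phi> (s, t, y, p, q, v) = D (0, 0, 0, axis i 1, 0, 0)"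
    "D_q i \<Phi> (s, t, y, p, q, v) = D (0, 0, 0, 0, axis i 1, 0)"
proof -
  have l: "bounded_linear (\<lambda>y :: real^'n. (0 :: real, 0 :: real, y, 0 :: real^'n, 0 :: real^'n, 0 :: real^'m))"
    "bounded_linear (\<lambda>y :: real^'n. (0 :: real, 0 :: real, 0 :: real^'n, y, 0 :: real^'n, 0 :: real^'m))"
    "bounded_linear (\<lambda>y :: real^'n. (0 :: real, 0 :: real, 0 :: real^'n, 0 :: real^'n, y, 0 :: real^'m))"
    by (intro bounded_linear_Pair bounded_linear_zero bounded_linear_ident)+
  note x = coord_deriv_eq[where e = "\<lambda>y. (s, t, y, p, q, v)" and \<phi> = "\<lambda>y. \<Phi> (s, t, y, p, q, v)" and i = i, OF der l(1)]
  show "((\<lambda>h. \<Phi> (s, t, y + h *\<^sub>R axis i 1, p, q, v)) has_real_derivative D (0, 0, axis i 1, 0, 0, 0)) (at 0)"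
    "D_x i \<Phi> (s, t, y, p, q, v) = D (0, 0, axis i 1, 0, 0, 0)"
    using x by (simp_all add: eq D_x_def)
  note p = coord_deriv_eq[where e = "\<lambda>p. (s, t, y, p, q, v)" and \<phi> = "\<lambda>p. \<Phi> (s, t, y, p, q, v)" and i = i, OF der l(2)]
  show "((\<lambda>h. \<Phi> (s, t, y, p + h *\<^sub>R axis i 1, q, v)) has_real_derivative D (0, 0, 0, axis i 1, 0, 0)) (at 0)"
    "D_p i \<Phi> (s, t, y, p, q, v) = D (0, 0, 0, axis i 1, 0, 0)"
    using p by (simp_all add: eq D_p_def)
  note q = coord_deriv_eq[where e = "\<lambda>q. (s, t, y, p, q, v)" and \<phi> = "\<lambda>q. \<Phi> (s, t, y, p, q, v)" and i = i, OF der l(3)]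
  show "((\<lambda>h. \<Phi> (s, t, y, p, q + h *\<^sub>R axis i 1, v)) has_real_derivative D (0, 0, 0, 0, axis i 1, 0)) (at 0)"
    "D_q i \<Phi> (s, t, y, p, q, v) = D (0, 0, 0, 0, axis i 1, 0)"
    using q by (simp_all add: eq D_q_def)
qed

lemma bjet_partials:
  fixes \<Phi> \<Phi>' :: "'n::finite bjet \<Rightarrow> real"
  assumes der: "(\<Phi>' has_derivative D) (at (s, t, y, \<eta>))"
    and eq: "\<And>y \<eta>. \<Phi> (s, t, y, \<eta>) = \<Phi>' (s, t, y, \<eta>)"
  shows "B_x i \<Phi> (s, t, y, \<eta>) = D (0, 0, axis i 1, 0)"
    "B_eta i \<Phi> (s, t, y, \<eta>) = D (0, 0, 0, axis i 1)"
proof -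
  have l: "bounded_linear (\<lambda>y :: real^'n. (0 :: real, 0 :: real, y, 0 :: real^'n))"
    "bounded_linear (\<lambda>y :: real^'n. (0 :: real, 0 :: real, 0 :: real^'n, y))"
    by (intro bounded_linear_Pair bounded_linear_zero bounded_linear_ident)+
  show "B_x i \<Phi> (s, t, y, \<eta>) = D (0, 0, axis i 1, 0)"
    using coord_deriv_eq(2)[where e = "\<lambda>y. (s, t, y, \<eta>)" and \<phi> = "\<lambda>y. \<Phi> (s, t, y, \<eta>)" and i = i, OF der l(1)]
    by (simp add: eq B_x_def)
  show "B_eta i \<Phi> (s, t, y, \<eta>) = D (0, 0, 0, axis i 1)"
    using coord_deriv_eq(2)[where e = "\<lambda>\<eta>. (s, t, y, \<eta>)" and \<phi> = "\<lambda>\<eta>. \<Phi> (s, t, y, \<eta>)" and i = i, OF der l(2)]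
    by (simp add: eq B_eta_def)
qed

definition jets :: "(real \<times> real) set \<Rightarrow> (real^'m::finite) set \<Rightarrow> ('n::finite, 'm) jet set" where
  "jets G U = {(s, t, y, p, q, v). (s, t) \<in> G \<and> v \<in> U}"

lemma smooth_jet_derivatives:
  fixes \<Phi> :: "('n::finite, 'm::finite) jet \<Rightarrow> real"
  assumes "Ck_on 2 \<Phi> (jets G U)" "(s, t) \<in> G" "v \<in> U"
  shows "((\<lambda>h. \<Phi> (s, t, y + h *\<^sub>R axis i 1, p, q, v)) has_real_derivative D_x i \<Phi> (s, t, y, p, q, v)) (at 0)"
    "((\<lambda>h. \<Phi> (s, t, y, p + h *\<^sub>R axis i 1, q, v)) has_real_derivative D_p i \<Phi> (s, t, y, p, q, v)) (at 0)"
    "((\<lambda>h. \<Phi> (s, t, y, p, q + h *\<^sub>R axis i 1, v)) has_real_derivative D_q i \<Phi> (s, t, y, p, q, v)) (at 0)"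
proof -
  obtain \<Omega> \<Phi>' where \<Phi>': "open \<Omega>" "jets G U \<subseteq> \<Omega>" "Ck_open 2 \<Phi>' \<Omega>" "\<forall>w\<in>jets G U. \<Phi>' w = \<Phi> w"
    using assms(1) unfolding Ck_on_def by blast
  have jets: "(s, t, y, p, q, v) \<in> jets G U" for y p q :: "real^'n" using assms by (simp add: jets_def)
  have "(\<Phi>' has_derivative frechet_derivative \<Phi>' (at (s, t, y, p, q, v))) (at (s, t, y, p, q, v))"
    by (rule C1_on_has_derivative[OF Ck_open_2_imp_C1_on(1)[OF \<Phi>'(3,1)]]) (use jets \<Phi>'(2) in blast)
  note der = jet_partials[OF this, of \<Phi> i]
  have "\<Phi> (s, t, y, p, q, v) = \<Phi>' (s, t, y, p, q, v)" for y p q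
    using \<Phi>'(4) jets by simp
  note der' = der[OF this]
  show "((\<lambda>h. \<Phi> (s, t, y + h *\<^sub>R axis i 1, p, q, v)) has_real_derivative D_x i \<Phi> (s, t, y, p, q, v)) (at 0)"
    "((\<lambda>h. \<Phi> (s, t, y, p + h *\<^sub>R axis i 1, q, v)) has_real_derivative D_p i \<Phi> (s, t, y, p, q, v)) (at 0)"
    "((\<lambda>h. \<Phi> (s, t, y, p, q + h *\<^sub>R axis i 1, v)) has_real_derivative D_q i \<Phi> (s, t, y, p, q, v)) (at 0)"
    unfolding der'(4-6) by (fact der'(1-3))+
qed

text \<open>The co-state is a constant parameter of \<open>H\<close>, so the partial derivatives act
  on \<open>\<Phi>\<close> and \<open>f\<close> alone.\<close>

lemma hamiltonian_partials:
  fixes \<Phi> :: "('n::finite, 'm::finite) jet \<Rightarrow> real"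
  assumes \<Phi>: "Ck_on 2 \<Phi> (jets G U)" and f: "Ck_on 2 f (jets G U)" and w: "w \<in> jets G U"
  shows "D_x i (H \<Phi> f \<psi>) w = D_x i \<Phi> w + (\<Sum>j\<in>UNIV. \<psi> $ j * D_x i (\<lambda>w. f w $ j) w)"
    "D_p i (H \<Phi> f \<psi>) w = D_p i \<Phi> w + (\<Sum>j\<in>UNIV. \<psi> $ j * D_p i (\<lambda>w. f w $ j) w)"
    "D_q i (H \<Phi> f \<psi>) w = D_q i \<Phi> w + (\<Sum>j\<in>UNIV. \<psi> $ j * D_q i (\<lambda>w. f w $ j) w)"
proof -
  obtain s t y p q v where w_eq: "w = (s, t, y, p, q, v)" by (cases w) auto
  have st: "(s, t) \<in> G" "v \<in> U" using w by (auto simp: jets_def w_eq)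
  have fj: "Ck_on 2 (\<lambda>w. f w $ j) (jets G U)" for j
    using f by (rule Ck_on_linear) (rule bounded_linear_vec_nth)
  note d\<Phi> = smooth_jet_derivatives[OF \<Phi> st] and df = smooth_jet_derivatives[OF fj st]
  have "((\<lambda>h. H \<Phi> f \<psi> (s, t, y + h *\<^sub>R axis i 1, p, q, v)) has_real_derivative
      D_x i \<Phi> w + (\<Sum>j\<in>UNIV. \<psi> $ j * D_x i (\<lambda>w. f w $ j) w)) (at 0)"
    unfolding H_def w_eq by (intro DERIV_add DERIV_sum DERIV_cmult d\<Phi> df)
  then show "D_x i (H \<Phi> f \<psi>) w = D_x i \<Phi> w + (\<Sum>j\<in>UNIV. \<psi> $ j * D_x i (\<lambda>w. f w $ j) w)"
    by (subst D_x_def) (simp add: coord_deriv_def w_eq DERIV_imp_deriv)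
  have "((\<lambda>h. H \<Phi> f \<psi> (s, t, y, p + h *\<^sub>R axis i 1, q, v)) has_real_derivative
      D_p i \<Phi> w + (\<Sum>j\<in>UNIV. \<psi> $ j * D_p i (\<lambda>w. f w $ j) w)) (at 0)"
    unfolding H_def w_eq by (intro DERIV_add DERIV_sum DERIV_cmult d\<Phi> df)
  then show "D_p i (H \<Phi> f \<psi>) w = D_p i \<Phi> w + (\<Sum>j\<in>UNIV. \<psi> $ j * D_p i (\<lambda>w. f w $ j) w)"
    by (subst D_p_def) (simp add: coord_deriv_def w_eq DERIV_imp_deriv)
  have "((\<lambda>h. H \<Phi> f \<psi> (s, t, y, p, q + h *\<^sub>R axis i 1, v)) has_real_derivative
      D_q i \<Phi> w + (\<Sum>j\<in>UNIV. \<psi> $ j * D_q i (\<lambda>w. f w $ j) w)) (at 0)"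
    unfolding H_def w_eq by (intro DERIV_add DERIV_sum DERIV_cmult d\<Phi> df)
  then show "D_q i (H \<Phi> f \<psi>) w = D_q i \<Phi> w + (\<Sum>j\<in>UNIV. \<psi> $ j * D_q i (\<lambda>w. f w $ j) w)"
    by (subst D_q_def) (simp add: coord_deriv_def w_eq DERIV_imp_deriv)
qed

section \<open>One-sided partial derivatives on the region\<close>

context boundary_arc
begin

abbreviation "corners \<equiv> {(a, 0), (0, b)}"

text \<open>One-sided derivatives are unique only if the section accumulates at the point. On the
  \<open>t\<close>-axis below \<open>(0, b)\<close> room to the right comes from the curve: close to
  its end it is higher than the point and still has a positive abscissa.\<close>

lemma section_s_nontrivial:
  assumes z: "z \<in> G - corners" shows "at (fst z) within {s. (s, snd z) \<in> G} \<noteq> bot"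
proof -
  obtain c where c: "0 < c" "(c, snd z) \<in> G" "fst z \<le> c"
  proof (cases "fst z = 0")
    case True
    obtain \<mu> where \<mu>: "\<mu> \<in> {0..L}" "snd z \<le> snd (g \<mu>)"
      using z by (auto simp: mem_G_iff mem_W_iff)
    have "snd z < b" using True z G_le[of z] by (cases z) auto
    moreover have "((\<lambda>\<mu>. snd (g \<mu>)) \<longlongrightarrow> snd (g L)) (at L within {0..L})"
      using g_cont L_pos by (intro tendsto_snd) (auto simp: continuous_on_def)
    ultimately have "\<forall>\<^sub>F \<mu> in at L within {0..L}. snd z < snd (g \<mu>)"
      by (intro order_tendstoD) (simp_all add: g_ends)
    then have "\<forall>\<^sub>F \<mu> in at_left L. snd z < snd (g \<mu>)"
      using L_pos by (simp add: at_within_Icc_at_left)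
    moreover have "\<forall>\<^sub>F \<mu> in at_left L. \<mu> \<in> {0<..<L}"
      using L_pos by (intro eventually_at_leftI[of 0]) auto
    ultimately have "\<forall>\<^sub>F \<mu> in at_left L. snd z < snd (g \<mu>) \<and> \<mu> \<in> {0<..<L}" by (rule eventually_conj)
    then obtain \<nu> where \<nu>: "snd z < snd (g \<nu>)" "0 < \<nu>" "\<nu> < L"
      using eventually_happens[of _ "at_left L"] trivial_limit_at_left_real by fastforce
    show thesis
    proof (rule that[of "fst (g \<nu>)"])
      show "(fst (g \<nu>), snd z) \<in> G"
        using \<nu> g_pos[OF \<nu>(2,3)] G_nonneg[of z] z by (intro G_down[OF g_in_G[of \<nu>]]) (auto simp: mem_W_iff)
    qed (use \<nu> g_pos[OF \<nu>(2,3)] True in auto)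
  next
    case False
    then show thesis using G_nonneg[of z] z by (intro that[of "fst z"]) auto
  qed
  have "{0..c} \<subseteq> {s. (s, snd z) \<in> G}"
    using c G_nonneg[OF c(2)] by (auto intro!: G_down[OF c(2)] simp: mem_W_iff)
  moreover have "fst z islimpt {0..c}" using c G_nonneg[of z] z by (subst islimpt_Icc) auto
  ultimately show ?thesis by (auto simp: trivial_limit_within intro: islimpt_subset)
qed

lemma section_t_nontrivial:
  assumes z: "z \<in> G - corners" shows "at (snd z) within {t. (fst z, t) \<in> G} \<noteq> bot"
proof -
  obtain c where c: "0 < c" "(fst z, c) \<in> G" "snd z \<le> c"
  proof (cases "snd z = 0")
    case True
    have "fst z < a" using True z G_le[of z] by (cases z) auto
    moreover have "((\<lambda>\<mu>. fst (g \<mu>)) \<longlongrightarrow> fst (g 0)) (at 0 within {0..L})"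
      using g_cont L_pos by (intro tendsto_fst) (auto simp: continuous_on_def)
    ultimately have "\<forall>\<^sub>F \<mu> in at 0 within {0..L}. fst z < fst (g \<mu>)"
      by (intro order_tendstoD) (simp_all add: g_ends)
    then have "\<forall>\<^sub>F \<mu> in at_right 0. fst z < fst (g \<mu>)"
      using L_pos by (simp add: at_within_Icc_at_right)
    moreover have "\<forall>\<^sub>F \<mu> in at_right 0. \<mu> \<in> {0<..<L}"
      using L_pos by (intro eventually_at_rightI[of 0 L]) auto
    ultimately have "\<forall>\<^sub>F \<mu> in at_right 0. fst z < fst (g \<mu>) \<and> \<mu> \<in> {0<..<L}" by (rule eventually_conj)
    then obtain \<nu> where \<nu>: "fst z < fst (g \<nu>)" "0 < \<nu>" "\<nu> < L"
      using eventually_happens[of _ "at_right (0::real)"] trivial_limit_at_right_real by fastforce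
    show thesis
    proof (rule that[of "snd (g \<nu>)"])
      show "(fst z, snd (g \<nu>)) \<in> G"
        using \<nu> g_pos[OF \<nu>(2,3)] G_nonneg[of z] z by (intro G_down[OF g_in_G[of \<nu>]]) (auto simp: mem_W_iff)
    qed (use \<nu> g_pos[OF \<nu>(2,3)] True in auto)
  next
    case False
    then show thesis using G_nonneg[of z] z by (intro that[of "snd z"]) auto
  qed
  have "{0..c} \<subseteq> {t. (fst z, t) \<in> G}"
    using c G_nonneg[OF c(2)] by (auto intro!: G_down[OF c(2)] simp: mem_W_iff)
  moreover have "snd z islimpt {0..c}" using c G_nonneg[of z] z by (subst islimpt_Icc) auto
  ultimately show ?thesis by (auto simp: trivial_limit_within intro: islimpt_subset)
qed

text \<open>Transfers the derivative of a smooth expression to \<open>\<phi>\<close> although the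
  two need agree only off the corners, where partial derivatives of the state may be
  meaningless.\<close>

lemma pds_eqI:
  assumes der: "(\<phi>' has_derivative D) (at z)" and z: "z \<in> G - corners"
    and eq: "\<And>y. y \<in> G - corners \<Longrightarrow> \<phi> y = \<phi>' y"
  shows "((\<lambda>s. \<phi> (s, snd z)) has_vector_derivative D (1, 0)) (at (fst z) within {s. (s, snd z) \<in> G})"
    "pds G \<phi> z = D (1, 0)"
proof -
  \<comment> \<open>Points of the line within \<open>d\<close> of \<open>z\<close> have abscissa
    neither 0 nor \<open>a\<close>, except possibly \<open>z\<close> itself; so none of them is a
    corner.\<close>
  define d where "d = min (if fst z = a then 1 else \<bar>a - fst z\<bar>) (if fst z = 0 then 1 else \<bar>fst z\<bar>)"
  have "((\<lambda>s. \<phi>' (s, snd z)) has_vector_derivative D (1, 0)) (at (fst z))"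
    using der by (intro has_derivative_fst_line) simp
  then have "((\<lambda>s. \<phi>' (s, snd z)) has_vector_derivative D (1, 0)) (at (fst z) within {s. (s, snd z) \<in> G})"
    by (rule has_vector_derivative_at_within)
  then show *: "((\<lambda>s. \<phi> (s, snd z)) has_vector_derivative D (1, 0)) (at (fst z) within {s. (s, snd z) \<in> G})"
  proof (rule has_vector_derivative_transform_within[where d = d])
    fix s assume s: "s \<in> {s. (s, snd z) \<in> G}" "dist s (fst z) < d"
    have "(s, snd z) \<notin> corners"
    proof
      assume "(s, snd z) \<in> corners"
      then show False using z s(2) by (cases z) (auto simp: d_def dist_real_def split: if_splits)
    qed
    then show "\<phi>' (s, snd z) = \<phi> (s, snd z)" using eq s by simp
  qed (use z in \<open>auto simp: d_def\<close>)
  show "pds G \<phi> z = D (1, 0)"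
    unfolding pds_def by (rule vector_derivative_within[OF section_s_nontrivial[OF z] *])
qed

lemma pdt_eqI:
  assumes der: "(\<phi>' has_derivative D) (at z)" and z: "z \<in> G - corners"
    and eq: "\<And>y. y \<in> G - corners \<Longrightarrow> \<phi> y = \<phi>' y"
  shows "((\<lambda>t. \<phi> (fst z, t)) has_vector_derivative D (0, 1)) (at (snd z) within {t. (fst z, t) \<in> G})"
    "pdt G \<phi> z = D (0, 1)"
proof -
  define d where "d = min (if snd z = b then 1 else \<bar>b - snd z\<bar>) (if snd z = 0 then 1 else \<bar>snd z\<bar>)"
  have "((\<lambda>t. \<phi>' (fst z, t)) has_vector_derivative D (0, 1)) (at (snd z))"
    using der by (intro has_derivative_snd_line) simp
  then have "((\<lambda>t. \<phi>' (fst z, t)) has_vector_derivative D (0, 1)) (at (snd z) within {t. (fst z, t) \<in> G})"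
    by (rule has_vector_derivative_at_within)
  then show *: "((\<lambda>t. \<phi> (fst z, t)) has_vector_derivative D (0, 1)) (at (snd z) within {t. (fst z, t) \<in> G})"
  proof (rule has_vector_derivative_transform_within[where d = d])
    fix t assume t: "t \<in> {t. (fst z, t) \<in> G}" "dist t (snd z) < d"
    have "(fst z, t) \<notin> corners"
    proof
      assume "(fst z, t) \<in> corners"
      then show False using z t(2) by (cases z) (auto simp: d_def dist_real_def split: if_splits)
    qed
    then show "\<phi>' (fst z, t) = \<phi> (fst z, t)" using eq t by simp
  qed (use z in \<open>auto simp: d_def\<close>)
  show "pdt G \<phi> z = D (0, 1)"
    unfolding pdt_def by (rule vector_derivative_within[OF section_t_nontrivial[OF z] *])
qed

end

section \<open>The jet along the state and the source densities\<close>

lemma has_derivative_imp_has_real_derivative: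
  fixes e :: "real \<Rightarrow> real"
  assumes "(e has_derivative D) (at \<mu>)" shows "(e has_real_derivative D 1) (at \<mu>)"
proof (rule has_derivative_imp_has_field_derivative[OF assms])
  show "x * D 1 = D x" for x
    using linear_scale[OF has_derivative_linear[OF assms], of x 1] by simp
qed

text \<open>\<open>X\<close> and \<open>Y\<close> extend state and control to an open neighbourhood
  of the region, so that total derivatives of composites can be computed as ordinary derivatives;
  \<open>U\<close> is the set of admissible control values.\<close>

locale smooth_arc = boundary_arc +
  fixes x X :: "real \<times> real \<Rightarrow> real^'n::finite" and u Y :: "real \<times> real \<Rightarrow> real^'m::finite"
    and U :: "(real^'m) set" and \<Omega> :: "(real \<times> real) set"
  assumes \<Omega>: "open \<Omega>" "region N mu g \<subseteq> \<Omega>"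
    and X: "Ck_open 2 X \<Omega>" "\<And>z. z \<in> region N mu g \<Longrightarrow> X z = x z"
    and Y: "C1_on Y \<Omega>" "\<And>z. z \<in> region N mu g \<Longrightarrow> Y z = u z"
    and U: "\<And>z. z \<in> region N mu g \<Longrightarrow> u z \<in> U"
begin

text \<open>The jet formed with the extensions. It uses two-sided derivatives, makes sense at the
  corners as well, and is of class C1 on an open set, which \<open>jet G x u\<close> is not known to
  be.\<close>

definition "J z = (fst z, snd z, X z, frechet_derivative X (at z) (1, 0), frechet_derivative X (at z) (0, 1), Y z)"

lemma C1_J: "C1_on J \<Omega>"
  unfolding J_def
  by (intro C1_on_Pair C1_on_bounded_linear[OF bounded_linear_fst] C1_on_bounded_linear[OF bounded_linear_snd]
      Ck_open_2_imp_C1_on[OF X(1) \<Omega>(1)] Y(1))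

lemma J_in_jets: "z \<in> G \<Longrightarrow> J z \<in> jets G U"
  using Y(2) U by (simp add: J_def jets_def)

lemma partial_x:
  assumes "z \<in> G - corners"
  shows "pds G x z = frechet_derivative X (at z) (1, 0)" "pdt G x z = frechet_derivative X (at z) (0, 1)"
proof -
  have "(X has_derivative frechet_derivative X (at z)) (at z)"
    using assms \<Omega>(2) by (intro C1_on_has_derivative[OF Ck_open_2_imp_C1_on(1)[OF X(1) \<Omega>(1)]]) auto
  then show "pds G x z = frechet_derivative X (at z) (1, 0)" "pdt G x z = frechet_derivative X (at z) (0, 1)"
    using assms X(2) by (auto intro!: pds_eqI pdt_eqI)
qed

lemma jet_eq_J: "z \<in> G - corners \<Longrightarrow> jet G x u z = J z"
  using X(2) Y(2) by (simp add: jet_def J_def partial_x)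

lemma C1_along_jet:
  assumes P: "C1_on P \<Omega>p" "open \<Omega>p" "jets G U \<subseteq> \<Omega>p"
  shows "\<exists>T. open T \<and> G \<subseteq> T \<and> C1_on (\<lambda>z. P (J z)) T"
proof (intro exI conjI)
  \<comment> \<open>Open by continuity of \<open>J\<close>, and it contains \<open>G\<close> because
    \<open>J\<close> maps points of \<open>G\<close> to jets over \<open>G\<close> and
    \<open>U\<close>.\<close>
  let ?T = "{z \<in> \<Omega>. J z \<in> \<Omega>p}"
  show "open ?T"
    using continuous_open_preimage[OF C1_on_imp_continuous_on[OF C1_J] \<Omega>(1) P(2)]
    by (simp add: vimage_def Int_def conj_commute)
  show "G \<subseteq> ?T" using J_in_jets P(3) \<Omega>(2) by blast
  show "C1_on (\<lambda>z. P (J z)) ?T"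
    by (rule C1_on_compose[OF C1_on_subset[OF C1_J] P(1)]) auto
qed

lemma partials_along_jet:
  assumes P: "C1_on P \<Omega>p" "open \<Omega>p" "jets G U \<subseteq> \<Omega>p"
    and \<phi>: "\<And>z. z \<in> G - corners \<Longrightarrow> \<phi> z = P (J z)" and z: "z \<in> G - corners"
  shows "((\<lambda>s. \<phi> (s, snd z)) has_vector_derivative frechet_derivative (\<lambda>z. P (J z)) (at z) (1, 0))
      (at (fst z) within {s. (s, snd z) \<in> G})"
    "pds G \<phi> z = frechet_derivative (\<lambda>z. P (J z)) (at z) (1, 0)"
    "((\<lambda>t. \<phi> (fst z, t)) has_vector_derivative frechet_derivative (\<lambda>z. P (J z)) (at z) (0, 1))
      (at (snd z) within {t. (fst z, t) \<in> G})"
    "pdt G \<phi> z = frechet_derivative (\<lambda>z. P (J z)) (at z) (0, 1)"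
proof -
  obtain T where T: "G \<subseteq> T" "C1_on (\<lambda>z. P (J z)) T" using C1_along_jet[OF P] by blast
  have D: "((\<lambda>z. P (J z)) has_derivative frechet_derivative (\<lambda>z. P (J z)) (at z)) (at z)"
    by (rule C1_on_has_derivative[OF T(2)]) (use z T(1) in auto)
  show "((\<lambda>s. \<phi> (s, snd z)) has_vector_derivative frechet_derivative (\<lambda>z. P (J z)) (at z) (1, 0))
      (at (fst z) within {s. (s, snd z) \<in> G})"
    "pds G \<phi> z = frechet_derivative (\<lambda>z. P (J z)) (at z) (1, 0)"
    using pds_eqI[OF D z \<phi>] by auto
  show "((\<lambda>t. \<phi> (fst z, t)) has_vector_derivative frechet_derivative (\<lambda>z. P (J z)) (at z) (0, 1))
      (at (snd z) within {t. (fst z, t) \<in> G})"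
    "pdt G \<phi> z = frechet_derivative (\<lambda>z. P (J z)) (at z) (0, 1)"
    using pdt_eqI[OF D z \<phi>] by auto
qed

lemma continuous_along_jet:
  assumes "C1_on P \<Omega>p" "open \<Omega>p" "jets G U \<subseteq> \<Omega>p"
  shows "continuous_on G (\<lambda>z. frechet_derivative (\<lambda>z. P (J z)) (at z) v)" "continuous_on G (\<lambda>z. P (J z))"
proof -
  obtain T where T: "G \<subseteq> T" "C1_on (\<lambda>z. P (J z)) T" using C1_along_jet[OF assms] by blast
  show "continuous_on G (\<lambda>z. frechet_derivative (\<lambda>z. P (J z)) (at z) v)"
    using C1_on_continuous_derivative[OF T(2)] T(1) continuous_on_subset by blast
  show "continuous_on G (\<lambda>z. P (J z))"
    using C1_on_imp_continuous_on[OF T(2)] T(1) continuous_on_subset by blast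
qed

text \<open>Partial derivatives along the state become directional derivatives of an extension at
  \<open>J z\<close>; as these are again of class C1, their total derivatives exist.\<close>

lemma smooth_extension:
  fixes \<Phi> :: "('n, 'm) jet \<Rightarrow> real"
  assumes "Ck_on 2 \<Phi> (jets G U)"
  obtains \<Phi>' \<Omega>p where "open \<Omega>p" "jets G U \<subseteq> \<Omega>p" "C1_on \<Phi>' \<Omega>p"
    "\<And>v. C1_on (\<lambda>w. frechet_derivative \<Phi>' (at w) v) \<Omega>p"
    "\<And>z i. z \<in> G - corners \<Longrightarrow> D_x i \<Phi> (jet G x u z) = frechet_derivative \<Phi>' (at (J z)) (0, 0, axis i 1, 0, 0, 0)"
    "\<And>z i. z \<in> G - corners \<Longrightarrow> D_p i \<Phi> (jet G x u z) = frechet_derivative \<Phi>' (at (J z)) (0, 0, 0, axis i 1, 0, 0)"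
    "\<And>z i. z \<in> G - corners \<Longrightarrow> D_q i \<Phi> (jet G x u z) = frechet_derivative \<Phi>' (at (J z)) (0, 0, 0, 0, axis i 1, 0)"
proof -
  obtain \<Omega>p \<Phi>' where \<Phi>': "open \<Omega>p" "jets G U \<subseteq> \<Omega>p" "Ck_open 2 \<Phi>' \<Omega>p" "\<forall>w\<in>jets G U. \<Phi>' w = \<Phi> w"
    using assms unfolding Ck_on_def by blast
  have D: "D_x i \<Phi> (jet G x u z) = frechet_derivative \<Phi>' (at (J z)) (0, 0, axis i 1, 0, 0, 0)"
    "D_p i \<Phi> (jet G x u z) = frechet_derivative \<Phi>' (at (J z)) (0, 0, 0, axis i 1, 0, 0)"
    "D_q i \<Phi> (jet G x u z) = frechet_derivative \<Phi>' (at (J z)) (0, 0, 0, 0, axis i 1, 0)"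
    if z: "z \<in> G - corners" for z i
  proof -
    obtain s t y p q v where J: "J z = (s, t, y, p, q, v)" by (cases "J z") auto
    have jets: "(s, t, y, p, q, v) \<in> jets G U" for y p q :: "real^'n"
      using J_in_jets[of z] z J by (auto simp: jets_def)
    have "(\<Phi>' has_derivative frechet_derivative \<Phi>' (at (J z))) (at (s, t, y, p, q, v))"
      unfolding J[symmetric]
      by (rule C1_on_has_derivative[OF Ck_open_2_imp_C1_on(1)[OF \<Phi>'(3,1)]]) (use J_in_jets \<Phi>'(2) z in blast)
    from jet_partials(4-6)[OF this] \<Phi>'(4) jets
    show "D_x i \<Phi> (jet G x u z) = frechet_derivative \<Phi>' (at (J z)) (0, 0, axis i 1, 0, 0, 0)"
      "D_p i \<Phi> (jet G x u z) = frechet_derivative \<Phi>' (at (J z)) (0, 0, 0, axis i 1, 0, 0)"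
      "D_q i \<Phi> (jet G x u z) = frechet_derivative \<Phi>' (at (J z)) (0, 0, 0, 0, axis i 1, 0)"
      by (simp_all add: jet_eq_J[OF z] J)
  qed
  show thesis
    by (rule that[OF \<Phi>'(1,2) Ck_open_2_imp_C1_on[OF \<Phi>'(3,1)] D])
qed

lemma D_p_along_jet:
  fixes \<Phi> :: "('n, 'm) jet \<Rightarrow> real"
  assumes "Ck_on 2 \<Phi> (jets G U)" "z \<in> G - corners"
  shows "((\<lambda>s. D_p i \<Phi> (jet G x u (s, snd z))) has_real_derivative pds G (\<lambda>z. D_p i \<Phi> (jet G x u z)) z)
    (at (fst z) within {s. (s, snd z) \<in> G})"
proof -
  obtain \<Phi>' \<Omega>p where \<Phi>': "open \<Omega>p" "jets G U \<subseteq> \<Omega>p" "\<And>v. C1_on (\<lambda>w. frechet_derivative \<Phi>' (at w) v) \<Omega>p"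
    "\<And>z i. z \<in> G - corners \<Longrightarrow> D_p i \<Phi> (jet G x u z) = frechet_derivative \<Phi>' (at (J z)) (0, 0, 0, axis i 1, 0, 0)"
    by (rule smooth_extension[OF assms(1)]) (rule that, assumption+)
  show ?thesis
    using partials_along_jet(1,2)[OF \<Phi>'(3,1,2) \<Phi>'(4) assms(2)]
    by (simp add: has_real_derivative_iff_has_vector_derivative)
qed

lemma D_q_along_jet:
  fixes \<Phi> :: "('n, 'm) jet \<Rightarrow> real"
  assumes "Ck_on 2 \<Phi> (jets G U)" "z \<in> G - corners"
  shows "((\<lambda>t. D_q i \<Phi> (jet G x u (fst z, t))) has_real_derivative pdt G (\<lambda>z. D_q i \<Phi> (jet G x u z)) z)
    (at (snd z) within {t. (fst z, t) \<in> G})"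
proof -
  obtain \<Phi>' \<Omega>p where \<Phi>': "open \<Omega>p" "jets G U \<subseteq> \<Omega>p" "\<And>v. C1_on (\<lambda>w. frechet_derivative \<Phi>' (at w) v) \<Omega>p"
    "\<And>z i. z \<in> G - corners \<Longrightarrow> D_q i \<Phi> (jet G x u z) = frechet_derivative \<Phi>' (at (J z)) (0, 0, 0, 0, axis i 1, 0)"
    by (rule smooth_extension[OF assms(1)]) (rule that, assumption+)
  show ?thesis
    using partials_along_jet(3,4)[OF \<Phi>'(3,1,2) \<Phi>'(4) assms(2)]
    by (simp add: has_real_derivative_iff_has_vector_derivative)
qed

text \<open>\<open>F\<close> may have no meaningful value at the two corners, where a section can
  degenerate; a continuous function equal to it elsewhere serves equally well in the area
  integral.\<close>

lemma F_continuous: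
  assumes "Ck_on 2 \<Phi> (jets G U)"
  shows "\<exists>\<phi>. continuous_on G \<phi> \<and> (\<forall>z\<in>G - corners. F G \<Phi> x u i z = \<phi> z)"
proof -
  obtain \<Phi>' \<Omega>p where \<Phi>': "open \<Omega>p" "jets G U \<subseteq> \<Omega>p" "\<And>v. C1_on (\<lambda>w. frechet_derivative \<Phi>' (at w) v) \<Omega>p"
    "\<And>z i. z \<in> G - corners \<Longrightarrow> D_x i \<Phi> (jet G x u z) = frechet_derivative \<Phi>' (at (J z)) (0, 0, axis i 1, 0, 0, 0)"
    "\<And>z i. z \<in> G - corners \<Longrightarrow> D_p i \<Phi> (jet G x u z) = frechet_derivative \<Phi>' (at (J z)) (0, 0, 0, axis i 1, 0, 0)"
    "\<And>z i. z \<in> G - corners \<Longrightarrow> D_q i \<Phi> (jet G x u z) = frechet_derivative \<Phi>' (at (J z)) (0, 0, 0, 0, axis i 1, 0)"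
    by (rule smooth_extension[OF assms(1)]) (rule that, assumption+)
  let ?\<phi> = "\<lambda>z. frechet_derivative \<Phi>' (at (J z)) (0, 0, axis i 1, 0, 0, 0)
    - frechet_derivative (\<lambda>z. frechet_derivative \<Phi>' (at (J z)) (0, 0, 0, axis i 1, 0, 0)) (at z) (1, 0)
    - frechet_derivative (\<lambda>z. frechet_derivative \<Phi>' (at (J z)) (0, 0, 0, 0, axis i 1, 0)) (at z) (0, 1)"
  have "continuous_on G ?\<phi>"
    by (intro continuous_on_diff continuous_along_jet[OF \<Phi>'(3,1,2)])
  moreover have "F G \<Phi> x u i z = ?\<phi> z" if z: "z \<in> G - corners" for z
  proof -
    have "pds G (\<lambda>\<zeta>. D_p i \<Phi> (jet G x u \<zeta>)) z
        = frechet_derivative (\<lambda>z. frechet_derivative \<Phi>' (at (J z)) (0, 0, 0, axis i 1, 0, 0)) (at z) (1, 0)"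
      by (rule partials_along_jet(2)[OF \<Phi>'(3,1,2) \<Phi>'(5) z])
    moreover have "pdt G (\<lambda>\<zeta>. D_q i \<Phi> (jet G x u \<zeta>)) z
        = frechet_derivative (\<lambda>z. frechet_derivative \<Phi>' (at (J z)) (0, 0, 0, 0, axis i 1, 0)) (at z) (0, 1)"
      by (rule partials_along_jet(4)[OF \<Phi>'(3,1,2) \<Phi>'(6) z])
    ultimately show ?thesis by (simp only: F_def \<Phi>'(4)[OF z])
  qed
  ultimately show ?thesis by blast
qed

text \<open>With \<open>h\<close> in place of \<open>g\<close> every ingredient of \<open>F1\<close>
  makes sense up to the vertices, so \<open>F1\<close> stays bounded on each open segment although
  the tangent may jump at its ends.\<close>

lemma F1_continuous_segment:
  fixes \<Phi> :: "('n, 'm) jet \<Rightarrow> real"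
  assumes \<Phi>: "Ck_on 2 \<Phi> (jets G U)"
    and \<Phi>1: "Ck_on 2 \<Phi>1 {(s, t, y, \<eta>). (s, t) \<in> g ` {0..L}}" and r: "r \<le> N"
  shows "\<exists>\<kappa>. continuous_on {mu r..mu (Suc r)} \<kappa> \<and>
    (\<forall>\<mu>\<in>{mu r<..<mu (Suc r)}. F1 G g \<Phi> \<Phi>1 x u i \<mu> = \<kappa> \<mu>)"
proof -
  obtain \<Phi>' \<Omega>p where \<Phi>': "open \<Omega>p" "jets G U \<subseteq> \<Omega>p" "\<And>v. C1_on (\<lambda>w. frechet_derivative \<Phi>' (at w) v) \<Omega>p"
    "\<And>z i. z \<in> G - corners \<Longrightarrow> D_p i \<Phi> (jet G x u z) = frechet_derivative \<Phi>' (at (J z)) (0, 0, 0, axis i 1, 0, 0)"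
    "\<And>z i. z \<in> G - corners \<Longrightarrow> D_q i \<Phi> (jet G x u z) = frechet_derivative \<Phi>' (at (J z)) (0, 0, 0, 0, axis i 1, 0)"
    by (rule smooth_extension[OF \<Phi>]) (rule that, assumption+)
  obtain \<Omega>1 \<Phi>1' where \<Phi>1': "open \<Omega>1" "{(s, t, y, \<eta>). (s, t) \<in> g ` {0..L}} \<subseteq> \<Omega>1" "Ck_open 2 \<Phi>1' \<Omega>1"
    "\<forall>w\<in>{(s, t, y, \<eta>). (s, t) \<in> g ` {0..L}}. \<Phi>1' w = \<Phi>1 w"
    using \<Phi>1 unfolding Ck_on_def by blast
  obtain \<Omega>h h where h: "open \<Omega>h" "{mu r..mu (Suc r)} \<subseteq> \<Omega>h" "Ck_open 2 h \<Omega>h"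
    "\<And>\<mu>. \<mu> \<in> {mu r..mu (Suc r)} \<Longrightarrow> h \<mu> = g \<mu>"
    "\<And>\<mu>. \<mu> \<in> {mu r<..<mu (Suc r)} \<Longrightarrow> (g has_vector_derivative frechet_derivative h (at \<mu>) 1) (at \<mu>)"
    by (rule segment_extension[OF r]) (rule that, assumption+)
  define h' where "h' \<mu> = frechet_derivative h (at \<mu>) 1" for \<mu>
  \<comment> \<open>Since \<open>n1\<close> is the second component of the tangent and
    \<open>n2\<close> minus the first, the tangential derivative in \<open>bjet\<close> is the
    derivative of \<open>x\<close> in direction of the tangent; here it is written with the
    extensions \<open>h\<close> and \<open>X\<close>.\<close>
  define BJ where "BJ \<mu> = (fst (h \<mu>), snd (h \<mu>), X (h \<mu>),
    fst (h' \<mu>) *\<^sub>R frechet_derivative X (at (h \<mu>)) (1, 0) + snd (h' \<mu>) *\<^sub>R frechet_derivative X (at (h \<mu>)) (0, 1))" for \<mu>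
  have seg: "{mu r..mu (Suc r)} \<subseteq> {0..L}" using mu_in[of r] mu_in[of "Suc r"] r by auto
  have C1h: "C1_on h \<Omega>h" "C1_on h' \<Omega>h"
    using Ck_open_2_imp_C1_on[OF h(3,1)] unfolding h'_def by auto
  define T where "T = {\<mu> \<in> \<Omega>h. h \<mu> \<in> \<Omega>}"
  have T: "open T" "{mu r..mu (Suc r)} \<subseteq> T" "T \<subseteq> \<Omega>h" "\<And>\<mu>. \<mu> \<in> T \<Longrightarrow> h \<mu> \<in> \<Omega>"
  proof -
    show "open T"
      using continuous_open_preimage[OF C1_on_imp_continuous_on[OF C1h(1)] h(1) \<Omega>(1)]
      by (simp add: T_def vimage_def Int_def conj_commute)
    show "{mu r..mu (Suc r)} \<subseteq> T"
      using h(2,4) g_in_G \<Omega>(2) seg by (force simp: T_def)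
  qed (auto simp: T_def)
  have C1T: "C1_on h T" "C1_on h' T" using C1h T(3) by (auto intro: C1_on_subset)
  have C1_BJ: "C1_on BJ T"
    unfolding BJ_def
    by (intro C1_on_Pair C1_on_add C1_on_scaleR C1_on_linear_compose[OF bounded_linear_fst]
        C1_on_linear_compose[OF bounded_linear_snd] C1T
        C1_on_compose[OF C1T(1) Ck_open_2_imp_C1_on(1)[OF X(1) \<Omega>(1)] T(4)]
        C1_on_compose[OF C1T(1) Ck_open_2_imp_C1_on(2)[OF X(1) \<Omega>(1)] T(4)])
  define T1 where "T1 = {\<mu> \<in> T. BJ \<mu> \<in> \<Omega>1}"
  have BJ_in: "BJ \<mu> \<in> {(s, t, y, \<eta>). (s, t) \<in> g ` {0..L}}" if "\<mu> \<in> {mu r..mu (Suc r)}" for \<mu>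
    using h(4)[OF that] that seg by (auto simp: BJ_def)
  have T1: "open T1" "{mu r..mu (Suc r)} \<subseteq> T1" "T1 \<subseteq> T" "\<And>\<mu>. \<mu> \<in> T1 \<Longrightarrow> BJ \<mu> \<in> \<Omega>1"
  proof -
    show "open T1"
      using continuous_open_preimage[OF C1_on_imp_continuous_on[OF C1_BJ] T(1) \<Phi>1'(1)]
      by (simp add: T1_def vimage_def Int_def conj_commute)
    show "{mu r..mu (Suc r)} \<subseteq> T1"
    proof
      fix \<mu> assume \<mu>: "\<mu> \<in> {mu r..mu (Suc r)}"
      have "BJ \<mu> \<in> \<Omega>1" by (rule subsetD[OF \<Phi>1'(2) BJ_in[OF \<mu>]])
      then show "\<mu> \<in> T1" using subsetD[OF T(2) \<mu>] by (simp add: T1_def)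
    qed
  qed (auto simp: T1_def)
  define e where "e v \<mu> = frechet_derivative \<Phi>1' (at (BJ \<mu>)) v" for v \<mu>
  have C1_e: "C1_on (e v) T1" for v
    unfolding e_def[abs_def]
    by (rule C1_on_compose[OF C1_on_subset[OF C1_BJ T1(3)] Ck_open_2_imp_C1_on(2)[OF \<Phi>1'(3,1)] T1(4)])
  have on_arc: "g \<mu> \<in> G - corners" "bjet G g x \<mu> = BJ \<mu>" "g' \<mu> = h' \<mu>"
    if \<mu>: "\<mu> \<in> {mu r<..<mu (Suc r)}" for \<mu>
  proof -
    have \<mu>L: "\<mu> \<in> {0..L}" "0 < \<mu>" "\<mu> < L" using \<mu> seg mu_in[of r] mu_in[of "Suc r"] r by auto
    show gG: "g \<mu> \<in> G - corners" using g_in_G[OF \<mu>L(1)] g_pos[OF \<mu>L(2,3)] by auto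
    show g'_eq: "g' \<mu> = h' \<mu>" using vector_derivative_at[OF h(5)[OF \<mu>]] by (simp add: h'_def)
    have "h \<mu> = g \<mu>" using h(4) \<mu> by simp
    then show "bjet G g x \<mu> = BJ \<mu>"
      using gG X(2)[of "g \<mu>"] by (simp add: bjet_def BJ_def n1_def n2_def g'_eq partial_x[OF gG])
  qed
  have B: "B_x i \<Phi>1 (bjet G g x \<mu>) = e (0, 0, axis i 1, 0) \<mu>" "B_eta i \<Phi>1 (bjet G g x \<mu>) = e (0, 0, 0, axis i 1) \<mu>"
    if \<mu>: "\<mu> \<in> {mu r<..<mu (Suc r)}" for \<mu>
  proof -
    obtain s t y \<eta> where BJ: "BJ \<mu> = (s, t, y, \<eta>)" by (cases "BJ \<mu>") auto
    have "\<mu> \<in> T1" using T1(2) \<mu> by auto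
    then have "(\<Phi>1' has_derivative frechet_derivative \<Phi>1' (at (BJ \<mu>))) (at (s, t, y, \<eta>))"
      unfolding BJ[symmetric]
      by (intro C1_on_has_derivative[OF Ck_open_2_imp_C1_on(1)[OF \<Phi>1'(3,1)]] T1(4))
    moreover have "\<Phi>1 (s, t, y, \<eta>) = \<Phi>1' (s, t, y, \<eta>)" for y \<eta>
      using BJ_in[of \<mu>] \<mu> \<Phi>1'(4) BJ by auto
    ultimately show "B_x i \<Phi>1 (bjet G g x \<mu>) = e (0, 0, axis i 1, 0) \<mu>" "B_eta i \<Phi>1 (bjet G g x \<mu>) = e (0, 0, 0, axis i 1) \<mu>"
      using bjet_partials[of \<Phi>1' "frechet_derivative \<Phi>1' (at (BJ \<mu>))" s t y \<eta> \<Phi>1 i]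
      by (simp_all add: on_arc(2)[OF \<mu>] BJ e_def)
  qed
  have dB: "deriv (\<lambda>\<nu>. B_eta i \<Phi>1 (bjet G g x \<nu>)) \<mu> = frechet_derivative (e (0, 0, 0, axis i 1)) (at \<mu>) 1"
    if \<mu>: "\<mu> \<in> {mu r<..<mu (Suc r)}" for \<mu>
  proof (rule DERIV_imp_deriv)
    have "(e (0, 0, 0, axis i 1) has_derivative frechet_derivative (e (0, 0, 0, axis i 1)) (at \<mu>)) (at \<mu>)"
      by (rule C1_on_has_derivative[OF C1_e]) (use T1(2) \<mu> in auto)
    then have "(e (0, 0, 0, axis i 1) has_real_derivative frechet_derivative (e (0, 0, 0, axis i 1)) (at \<mu>) 1) (at \<mu>)"
      by (rule has_derivative_imp_has_real_derivative)
    then show "((\<lambda>\<nu>. B_eta i \<Phi>1 (bjet G g x \<nu>)) has_real_derivative frechet_derivative (e (0, 0, 0, axis i 1)) (at \<mu>) 1) (at \<mu>)"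
      by (rule has_field_derivative_transform_within_open[where S = "{mu r<..<mu (Suc r)}"])
        (use \<mu> B(2) in auto)
  qed
  define \<kappa> where "\<kappa> \<mu> = snd (h' \<mu>) * frechet_derivative \<Phi>' (at (J (h \<mu>))) (0, 0, 0, axis i 1, 0, 0)
    - fst (h' \<mu>) * frechet_derivative \<Phi>' (at (J (h \<mu>))) (0, 0, 0, 0, axis i 1, 0)
    + e (0, 0, axis i 1, 0) \<mu> - frechet_derivative (e (0, 0, 0, axis i 1)) (at \<mu>) 1" for \<mu>
  have cont_h: "continuous_on {mu r..mu (Suc r)} h" "continuous_on {mu r..mu (Suc r)} h'"
    using C1h h(2) by (auto intro: continuous_on_subset[OF C1_on_imp_continuous_on])
  have cont_J: "continuous_on {mu r..mu (Suc r)} (\<lambda>\<mu>. frechet_derivative \<Phi>' (at (J (h \<mu>))) v)" for v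
    by (rule continuous_on_compose2[OF continuous_along_jet(2)[OF \<Phi>'(3,1,2)] cont_h(1)])
      (use h(4) g_in_G seg in force)
  have "continuous_on {mu r..mu (Suc r)} \<kappa>"
    unfolding \<kappa>_def
    by (intro continuous_on_add continuous_on_diff continuous_on_mult cont_J
        continuous_on_fst continuous_on_snd cont_h
        continuous_on_subset[OF C1_on_imp_continuous_on[OF C1_e] T1(2)]
        continuous_on_subset[OF C1_on_continuous_derivative[OF C1_e] T1(2)])
  moreover have "F1 G g \<Phi> \<Phi>1 x u i \<mu> = \<kappa> \<mu>" if \<mu>: "\<mu> \<in> {mu r<..<mu (Suc r)}" for \<mu>
    using on_arc[OF \<mu>] h(4)[of \<mu>] \<mu>
    by (simp add: F1_def \<kappa>_def n1_def n2_def \<Phi>'(4,5) B[OF \<mu>, unfolded on_arc(2)[OF \<mu>]] dB[OF \<mu>])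
  ultimately show ?thesis by blast
qed

text \<open>At the vertices \<open>F1\<close> is a junk value (the tangent jumps there), hence the cut-off.\<close>

lemma F1_weight:
  fixes \<Phi> :: "('n, 'm) jet \<Rightarrow> real" and i :: 'n
  assumes \<Phi>: "Ck_on 2 \<Phi> (jets G U)" "Ck_on 2 \<Phi>1 {(s, t, y, \<eta>). (s, t) \<in> g ` {0..L}}"
  defines "w \<equiv> \<lambda>\<mu>. if \<mu> \<in> {0..L} - V then F1 G g \<Phi> \<Phi>1 x u i \<mu> else 0"
  shows "w \<in> borel_measurable borel" "\<exists>C. \<forall>\<mu>. \<bar>w \<mu>\<bar> \<le> C" "\<And>\<mu>. \<mu> \<in> {0..L} - V \<Longrightarrow> isCont w \<mu>"
proof -
  define \<kappa> where "\<kappa> r = (SOME \<kappa>. continuous_on {mu r..mu (Suc r)} \<kappa> \<and>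
    (\<forall>\<mu>\<in>{mu r<..<mu (Suc r)}. F1 G g \<Phi> \<Phi>1 x u i \<mu> = \<kappa> \<mu>))" for r
  have \<kappa>_props: "continuous_on {mu r..mu (Suc r)} (\<kappa> r) \<and>
    (\<forall>\<mu>\<in>{mu r<..<mu (Suc r)}. F1 G g \<Phi> \<Phi>1 x u i \<mu> = \<kappa> r \<mu>)" if "r \<le> N" for r
    unfolding \<kappa>_def by (rule someI_ex[OF F1_continuous_segment[OF \<Phi> that]])
  have \<kappa>: "continuous_on {mu r..mu (Suc r)} (\<kappa> r)"
    "\<And>\<mu>. \<mu> \<in> {mu r<..<mu (Suc r)} \<Longrightarrow> F1 G g \<Phi> \<Phi>1 x u i \<mu> = \<kappa> r \<mu>" if "r \<le> N" for r
    using \<kappa>_props[OF that] by auto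
  have w_seg: "w \<mu> = \<kappa> r \<mu>" if "r \<le> N" "\<mu> \<in> {mu r<..<mu (Suc r)}" for r \<mu>
    using segment_not_vertex[of r \<mu>] \<kappa>(2)[OF that] that by (simp add: w_def)
  show isCont: "isCont w \<mu>" if \<mu>: "\<mu> \<in> {0..L} - V" for \<mu>
  proof -
    obtain r where r: "r \<le> N" "mu r < \<mu>" "\<mu> < mu (Suc r)" using in_segment[OF \<mu>] .
    have "continuous_on {mu r<..<mu (Suc r)} w"
      by (rule continuous_on_eq[OF continuous_on_subset[OF \<kappa>(1)[OF r(1)]]]) (use w_seg r in auto)
    then show ?thesis using r by (simp add: continuous_on_eq_continuous_at)
  qed
  have "closed V" by (intro finite_imp_closed finite_V)
  have "open ({0<..<L} - V)" using \<open>closed V\<close> by (intro open_Diff open_greaterThanLessThan)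
  \<comment> \<open>Both ends of the parameter interval are vertices, so removing \<open>V\<close>
    leaves an open set.\<close>
  moreover have L_V: "{0..L} - V = {0<..<L} - V" using zero_in_V L_in_V by (auto simp: less_le)
  ultimately have "{0..L} - V \<in> sets borel" by simp
  moreover have "continuous_on ({0..L} - V) (F1 G g \<Phi> \<Phi>1 x u i)"
  proof (rule continuous_on_eq)
    show "continuous_on ({0..L} - V) w" using isCont by (auto intro: continuous_at_imp_continuous_on)
  qed (simp add: w_def)
  ultimately show "w \<in> borel_measurable borel"
    unfolding w_def by (intro borel_measurable_continuous_on_if continuous_on_const)
  have "\<exists>C. \<forall>\<mu>\<in>{mu r..mu (Suc r)}. \<bar>\<kappa> r \<mu>\<bar> \<le> C" if "r \<le> N" for r
    using compact_imp_bounded[OF compact_continuous_image[OF \<kappa>(1)[OF that] compact_Icc]]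
    by (auto simp: bounded_iff)
  then have "\<exists>C. \<forall>r. r \<le> N \<longrightarrow> (\<forall>\<mu>\<in>{mu r..mu (Suc r)}. \<bar>\<kappa> r \<mu>\<bar> \<le> C r)"
    by (intro choice) blast
  then obtain C where C: "\<And>r \<mu>. r \<le> N \<Longrightarrow> \<mu> \<in> {mu r..mu (Suc r)} \<Longrightarrow> \<bar>\<kappa> r \<mu>\<bar> \<le> C r" by blast
  have "\<bar>w \<mu>\<bar> \<le> (\<Sum>r\<le>N. \<bar>C r\<bar>)" for \<mu>
  proof (cases "\<mu> \<in> {0..L} - V")
    case True
    obtain r where r: "r \<le> N" "mu r < \<mu>" "\<mu> < mu (Suc r)" using in_segment[OF True] .
    have "\<bar>w \<mu>\<bar> \<le> \<bar>C r\<bar>" using C[of r \<mu>] w_seg[of r \<mu>] r by auto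
    also have "\<dots> \<le> (\<Sum>r\<le>N. \<bar>C r\<bar>)" using r by (intro member_le_sum) auto
    finally show ?thesis .
  next
    case False
    then show ?thesis by (auto simp: w_def intro: sum_nonneg)
  qed
  then show "\<exists>C. \<forall>\<mu>. \<bar>w \<mu>\<bar> \<le> C" by blast
qed

end

section \<open>The co-state equation\<close>

text \<open>Derivatives of the Riemann function are known within \<open>{0..\<sigma>}\<close>, while
  partial derivatives refer to sections of \<open>G\<close>; strictly below \<open>\<sigma>\<close>
  the upper bound is inactive and the derivative carries over.\<close>

lemma has_real_derivative_within_section:
  fixes \<phi> :: "real \<Rightarrow> real"
  assumes "(\<phi> has_real_derivative d) (at s within {0..\<sigma>})" "s < \<sigma>" "S \<subseteq> {0..}"
  shows "(\<phi> has_real_derivative d) (at s within S)"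
proof -
  have "(\<phi> has_real_derivative d) (at s within S \<inter> {..<\<sigma>})"
    by (rule has_field_derivative_subset[OF assms(1)]) (use assms(3) in auto)
  also have "at s within S \<inter> {..<\<sigma>} = at s within S"
    by (rule at_within_nhd[where S = "{..<\<sigma>}"]) (use assms(2) in auto)
  finally show ?thesis .
qed

text \<open>Serves to identify the derivative prescribed on a characteristic with the one computed
  from a smooth extension of the kernel.\<close>

lemma has_real_derivative_unique_Icc:
  fixes \<phi> :: "real \<Rightarrow> real"
  assumes "(\<phi> has_real_derivative d) (at s within {0..\<sigma>})" "(\<phi> has_real_derivative d') (at s within {0..\<sigma>})"
    and "0 < s" "s \<le> \<sigma>"
  shows "d = d'"
proof (rule vector_derivative_unique_within)
  show "at s within {0..\<sigma>} \<noteq> bot" using assms(3,4) by (simp add: trivial_limit_within islimpt_Icc)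
qed (use assms(1,2) in \<open>auto simp: has_real_derivative_iff_has_vector_derivative\<close>)

lemma kernel_line_derivatives:
  fixes P :: "(real \<times> real) \<times> (real \<times> real) \<Rightarrow> real"
  assumes P: "C1_on P S" "kernel_domain G \<subseteq> S"
    and K: "\<And>\<zeta> z. \<zeta> \<in> G \<Longrightarrow> z \<in> W \<zeta> \<Longrightarrow> K \<zeta> z = P (\<zeta>, z)" and z: "\<zeta> \<in> G" "z \<in> W \<zeta>"
  shows "((\<lambda>s. K \<zeta> (s, snd z)) has_real_derivative frechet_derivative P (at (\<zeta>, z)) (0, (1, 0)))
      (at (fst z) within {0..fst \<zeta>})"
    "((\<lambda>t. K \<zeta> (fst z, t)) has_real_derivative frechet_derivative P (at (\<zeta>, z)) (0, (0, 1)))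
      (at (snd z) within {0..snd \<zeta>})"
proof -
  have D: "(P has_derivative frechet_derivative P (at (\<zeta>, z))) (at (\<zeta>, (fst z, snd z)))"
    using z P(2) by (simp, intro C1_on_has_derivative[OF P(1)]) (auto simp: kernel_domain_def)
  have "((\<lambda>y. P (\<zeta>, y)) has_derivative (\<lambda>h. frechet_derivative P (at (\<zeta>, z)) (0, h))) (at (fst z, snd z))"
    by (rule has_derivative_compose[where f = "\<lambda>y. (\<zeta>, y)" and g = P, OF _ D])
      (intro has_derivative_Pair has_derivative_ident has_derivative_const)
  note lines = has_derivative_fst_line[OF this] has_derivative_snd_line[OF this]
  have s: "((\<lambda>s. P (\<zeta>, (s, snd z))) has_real_derivative frechet_derivative P (at (\<zeta>, z)) (0, (1, 0)))
      (at (fst z) within {0..fst \<zeta>})"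
    using lines(1) by (simp add: has_real_derivative_iff_has_vector_derivative has_vector_derivative_at_within)
  show "((\<lambda>s. K \<zeta> (s, snd z)) has_real_derivative frechet_derivative P (at (\<zeta>, z)) (0, (1, 0)))
      (at (fst z) within {0..fst \<zeta>})"
    by (rule has_field_derivative_transform_within[OF s zero_less_one])
      (use z K in \<open>auto simp: mem_W_iff\<close>)
  have t: "((\<lambda>t. P (\<zeta>, (fst z, t))) has_real_derivative frechet_derivative P (at (\<zeta>, z)) (0, (0, 1)))
      (at (snd z) within {0..snd \<zeta>})"
    using lines(2) by (simp add: has_real_derivative_iff_has_vector_derivative has_vector_derivative_at_within)
  show "((\<lambda>t. K \<zeta> (fst z, t)) has_real_derivative frechet_derivative P (at (\<zeta>, z)) (0, (0, 1)))
      (at (snd z) within {0..snd \<zeta>})"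
    by (rule has_field_derivative_transform_within[OF t zero_less_one])
      (use z K in \<open>auto simp: mem_W_iff\<close>)
qed

context smooth_arc
begin

lemma pds_eq_derivative:
  assumes "z \<in> G - corners" "((\<lambda>s. \<phi> (s, snd z)) has_real_derivative d) (at (fst z) within {s. (s, snd z) \<in> G})"
  shows "pds G \<phi> z = d"
  unfolding pds_def using assms(2)
  by (intro vector_derivative_within[OF section_s_nontrivial[OF assms(1)]])
    (simp add: has_real_derivative_iff_has_vector_derivative)

lemma pdt_eq_derivative:
  assumes "z \<in> G - corners" "((\<lambda>t. \<phi> (fst z, t)) has_real_derivative d) (at (snd z) within {t. (fst z, t) \<in> G})"
  shows "pdt G \<phi> z = d"
  unfolding pdt_def using assms(2)
  by (intro vector_derivative_within[OF section_t_nontrivial[OF assms(1)]])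
    (simp add: has_real_derivative_iff_has_vector_derivative)

text \<open>The adjoint problem of \<open>R\<close> is stated through derivatives of whole products;
  smoothness lets the product rule be carried out, which gives the pointwise form required of a
  kernel. The row \<open>i\<close> is fixed.\<close>

lemma riemann_arc_kernel:
  fixes f :: "('n, 'm) jet \<Rightarrow> real^'n" and R :: "real \<times> real \<Rightarrow> real \<times> real \<Rightarrow> real^'n^'n"
  assumes f: "Ck_on 2 f (jets G U)" and riemann: "riemann_function a b G f x u R"
    and R: "Ck_on 2 (\<lambda>(z, \<zeta>). R z \<zeta>) (kernel_domain G)"
    and z0: "z0 \<in> G" "fst z0 \<in> regular_s" "snd z0 \<in> regular_t"
  shows "\<exists>rs rt rst. arc_kernel a b N mu g (\<lambda>j \<zeta> z. R \<zeta> z $ i $ j) rs rt rst z0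
    (\<lambda>k j. D_x j (\<lambda>w. f w $ k) (jet G x u z0))
    (\<lambda>k j. D_p j (\<lambda>w. f w $ k) (jet G x u z0))
    (\<lambda>k j. pds G (\<lambda>z. D_p j (\<lambda>w. f w $ k) (jet G x u z)) z0)
    (\<lambda>k j. D_q j (\<lambda>w. f w $ k) (jet G x u z0))
    (\<lambda>k j. pdt G (\<lambda>z. D_q j (\<lambda>w. f w $ k) (jet G x u z)) z0)"
proof -
  obtain \<Omega>r R' where R': "open \<Omega>r" "kernel_domain G \<subseteq> \<Omega>r" "Ck_open 2 R' \<Omega>r"
    "\<forall>p\<in>kernel_domain G. R' p = (\<lambda>(z, \<zeta>). R z \<zeta>) p"
    using R unfolding Ck_on_def by blast
  define r where "r j \<zeta> z = R \<zeta> z $ i $ j" for j \<zeta> z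
  define P where "P j p = R' p $ i $ j" for j p
  have lin: "bounded_linear (\<lambda>M :: real^'n^'n. M $ i $ j)" for j
    by (rule bounded_linear_compose[OF bounded_linear_vec_nth bounded_linear_vec_nth])
  have P_Ck: "Ck_open 2 (P j) \<Omega>r" for j
    unfolding P_def[abs_def] by (rule Ck_open_linear[OF R'(3,1) lin])
  define Pt where "Pt j p = frechet_derivative (P j) (at p) (0, (0, 1))" for j p
  have P_C1: "C1_on (P j) \<Omega>r" "C1_on (Pt j) \<Omega>r" for j
    unfolding Pt_def by (rule Ck_open_2_imp_C1_on[OF P_Ck R'(1)])+
  have r_P: "r j \<zeta> z = P j (\<zeta>, z)" if "\<zeta> \<in> G" "z \<in> W \<zeta>" for j \<zeta> z
    using bspec[OF R'(4), of "(\<zeta>, z)"] that by (simp add: r_def P_def kernel_domain_def)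
  define rs where "rs j \<zeta> z = frechet_derivative (P j) (at (\<zeta>, z)) (0, (1, 0))" for j \<zeta> z
  define rt where "rt j \<zeta> z = Pt j (\<zeta>, z)" for j \<zeta> z
  define rst where "rst j \<zeta> z = frechet_derivative (Pt j) (at (\<zeta>, z)) (0, (1, 0))" for j \<zeta> z
  have r_s: "((\<lambda>s. r j \<zeta> (s, snd z)) has_real_derivative rs j \<zeta> z) (at (fst z) within {0..fst \<zeta>})"
    and r_t: "((\<lambda>t. r j \<zeta> (fst z, t)) has_real_derivative rt j \<zeta> z) (at (snd z) within {0..snd \<zeta>})"
    and rt_s: "((\<lambda>s. rt j \<zeta> (s, snd z)) has_real_derivative rst j \<zeta> z) (at (fst z) within {0..fst \<zeta>})"
    if "\<zeta> \<in> G" "z \<in> W \<zeta>" for j \<zeta> z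
    using kernel_line_derivatives[OF P_C1(1) R'(2) r_P that] kernel_line_derivatives(1)[OF P_C1(2) R'(2) _ that, of "rt j" j]
    unfolding rs_def rt_def rst_def Pt_def by auto
  obtain s0 t0 where z0_eq: "z0 = (s0, t0)" by fastforce
  have pos: "0 < s0" "s0 < a" "0 < t0" "t0 < b" using z0 by (auto simp: z0_eq regular_s_def regular_t_def)
  have z0c: "z0 \<in> G - corners" using z0 pos by (auto simp: z0_eq)
  have sub: "{s. (s, t) \<in> G} \<subseteq> {0..}" "{t. (s, t) \<in> G} \<subseteq> {0..}" for s t
    using G_nonneg by fastforce+
  let ?fx = "\<lambda>k j z. D_x j (\<lambda>w. f w $ k) (jet G x u z)"
  let ?fp = "\<lambda>k j z. D_p j (\<lambda>w. f w $ k) (jet G x u z)"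
  let ?fq = "\<lambda>k j z. D_q j (\<lambda>w. f w $ k) (jet G x u z)"
  have fk: "Ck_on 2 (\<lambda>w. f w $ k) (jets G U)" for k
    using f by (rule Ck_on_linear) (rule bounded_linear_vec_nth)
  \<comment> \<open>Skips the vanishing, diagonal and Goursat clauses; the three adjoint clauses
    remain.\<close>
  note riemann' = riemann[unfolded riemann_function_def is_riemann_def, THEN conjunct2, THEN conjunct2, THEN conjunct2, THEN conjunct2, THEN conjunct2]
  note adjoint_pde = conjunct1[OF riemann']
    and adjoint_t = conjunct1[OF conjunct2[OF riemann']]
    and adjoint_s = conjunct2[OF conjunct2[OF riemann']]
  have "arc_kernel a b N mu g r rs rt rst z0 (\<lambda>k j. ?fx k j z0)
    (\<lambda>k j. ?fp k j z0) (\<lambda>k j. pds G (?fp k j) z0) (\<lambda>k j. ?fq k j z0) (\<lambda>k j. pdt G (?fq k j) z0)"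
  proof (unfold_locales)
    show "compact G" by (rule compact_G)
    show "0 \<le> fst z \<and> 0 \<le> snd z" if "z \<in> G" for z using G_nonneg[OF that] .
    show "continuous_on (kernel_domain G) (\<lambda>(\<zeta>, z). r j \<zeta> z)" for j
      by (rule continuous_on_eq[OF continuous_on_subset[OF C1_on_imp_continuous_on[OF P_C1(1)] R'(2)]])
        (auto simp: kernel_domain_def r_P)
    show "continuous_on (kernel_domain G) (\<lambda>(\<zeta>, z). rs j \<zeta> z)" for j
      by (rule continuous_on_eq[OF continuous_on_subset[OF C1_on_continuous_derivative[OF P_C1(1)] R'(2)]])
        (auto simp: rs_def)
    show "continuous_on (kernel_domain G) (\<lambda>(\<zeta>, z). rt j \<zeta> z)" for j
      by (rule continuous_on_eq[OF continuous_on_subset[OF C1_on_imp_continuous_on[OF P_C1(2)] R'(2)]])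
        (auto simp: rt_def)
    show "continuous_on (kernel_domain G) (\<lambda>(\<zeta>, z). rst j \<zeta> z)" for j
      by (rule continuous_on_eq[OF continuous_on_subset[OF C1_on_continuous_derivative[OF P_C1(2)] R'(2)]])
        (auto simp: rst_def)
    show "rst j \<zeta> z0 = (\<Sum>k\<in>UNIV. ?fx k j z0 * r k \<zeta> z0)
        - (\<Sum>k\<in>UNIV. pds G (?fp k j) z0 * r k \<zeta> z0 + ?fp k j z0 * rs k \<zeta> z0)
        - (\<Sum>k\<in>UNIV. pdt G (?fq k j) z0 * r k \<zeta> z0 + ?fq k j z0 * rt k \<zeta> z0)"
      if \<zeta>: "\<zeta> \<in> E G z0" "fst z0 < fst \<zeta>" "snd z0 < snd \<zeta>" for j \<zeta>
    proof -
      obtain \<sigma> \<tau> where \<zeta>_eq: "\<zeta> = (\<sigma>, \<tau>)" by fastforce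
      have \<zeta>': "\<zeta> \<in> G" "s0 < \<sigma>" "t0 < \<tau>" using \<zeta> by (auto simp: \<zeta>_eq z0_eq E_def)
      have W: "(s, t) \<in> W \<zeta>" if "0 \<le> s" "s \<le> \<sigma>" "0 \<le> t" "t \<le> \<tau>" for s t
        using that by (simp add: mem_W_iff \<zeta>_eq)
      have z0W: "z0 \<in> W \<zeta>" using \<zeta>' pos W by (simp add: z0_eq)
      have "pds G (pdt G (\<lambda>z. r j \<zeta> z)) z0 =
          (\<Sum>k\<in>UNIV. ?fx k j z0 * r k \<zeta> z0)
          - pds G (\<lambda>z. \<Sum>k\<in>UNIV. ?fp k j z * r k \<zeta> z) z0 - pdt G (\<lambda>z. \<Sum>k\<in>UNIV. ?fq k j z * r k \<zeta> z) z0"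
        using adjoint_pde[THEN spec[of _ s0], THEN spec[of _ t0], THEN spec[of _ \<sigma>], THEN spec[of _ \<tau>],
            THEN spec[of _ i], THEN spec[of _ j], THEN mp] \<zeta>' pos
        by (simp add: r_def z0_eq \<zeta>_eq)
      moreover have "pds G (\<lambda>z. \<Sum>k\<in>UNIV. ?fp k j z * r k \<zeta> z) z0
          = (\<Sum>k\<in>UNIV. pds G (?fp k j) z0 * r k \<zeta> z0 + ?fp k j z0 * rs k \<zeta> z0)"
      proof (rule pds_eq_derivative[OF z0c])
        have "((\<lambda>s. r k \<zeta> (s, snd z0)) has_real_derivative rs k \<zeta> z0) (at (fst z0) within {s. (s, snd z0) \<in> G})" for k
          by (rule has_real_derivative_within_section[OF r_s[OF \<zeta>'(1) z0W] _ sub(1)]) (use \<zeta> in simp)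
        from DERIV_sum[OF DERIV_mult'[OF D_p_along_jet[OF fk z0c] this]]
        show "((\<lambda>s. \<Sum>k\<in>UNIV. ?fp k j (s, snd z0) * r k \<zeta> (s, snd z0)) has_real_derivative
            (\<Sum>k\<in>UNIV. pds G (?fp k j) z0 * r k \<zeta> z0 + ?fp k j z0 * rs k \<zeta> z0))
            (at (fst z0) within {s. (s, snd z0) \<in> G})"
          by (simp add: add.commute)
      qed
      moreover have "pdt G (\<lambda>z. \<Sum>k\<in>UNIV. ?fq k j z * r k \<zeta> z) z0
          = (\<Sum>k\<in>UNIV. pdt G (?fq k j) z0 * r k \<zeta> z0 + ?fq k j z0 * rt k \<zeta> z0)"
      proof (rule pdt_eq_derivative[OF z0c])
        have "((\<lambda>t. r k \<zeta> (fst z0, t)) has_real_derivative rt k \<zeta> z0) (at (snd z0) within {t. (fst z0, t) \<in> G})" for k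
          by (rule has_real_derivative_within_section[OF r_t[OF \<zeta>'(1) z0W] _ sub(2)]) (use \<zeta> in simp)
        from DERIV_sum[OF DERIV_mult'[OF D_q_along_jet[OF fk z0c] this]]
        show "((\<lambda>t. \<Sum>k\<in>UNIV. ?fq k j (fst z0, t) * r k \<zeta> (fst z0, t)) has_real_derivative
            (\<Sum>k\<in>UNIV. pdt G (?fq k j) z0 * r k \<zeta> z0 + ?fq k j z0 * rt k \<zeta> z0))
            (at (snd z0) within {t. (fst z0, t) \<in> G})"
          by (simp add: add.commute)
      qed
      moreover have "pds G (pdt G (\<lambda>z. r j \<zeta> z)) z0 = rst j \<zeta> z0"
      proof (rule pds_eq_derivative[OF z0c])
        have "((\<lambda>s. rt j \<zeta> (s, snd z0)) has_real_derivative rst j \<zeta> z0) (at (fst z0) within {s. (s, snd z0) \<in> G})"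
          by (rule has_real_derivative_within_section[OF rt_s[OF \<zeta>'(1) z0W] _ sub(1)]) (use \<zeta> in simp)
        \<comment> \<open>For \<open>s < \<sigma>\<close> the \<open>t\<close>-derivative of the
          kernel within the section of \<open>G\<close> is \<open>rt\<close>, because
          \<open>t0 < \<tau>\<close> keeps the point away from the edge; this identification near
          \<open>s0\<close> is enough for the mixed derivative.\<close>
        then show "((\<lambda>s. pdt G (\<lambda>z. r j \<zeta> z) (s, snd z0)) has_real_derivative rst j \<zeta> z0)
            (at (fst z0) within {s. (s, snd z0) \<in> G})"
        proof (rule has_field_derivative_transform_within[where d = "\<sigma> - s0"])
          fix s assume s: "s \<in> {s. (s, snd z0) \<in> G}" "dist s (fst z0) < \<sigma> - s0"
          then have s': "(s, t0) \<in> G" "0 \<le> s" "s < \<sigma>"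
            using G_nonneg[of "(s, t0)"] by (auto simp: z0_eq dist_real_def)
          have "(s, t0) \<in> W \<zeta>" using s' \<zeta>' pos by (intro W) auto
          from has_real_derivative_within_section[OF r_t[OF \<zeta>'(1) this] _ sub(2)]
          have "((\<lambda>t. r j \<zeta> (fst (s, t0), t)) has_real_derivative rt j \<zeta> (s, t0))
              (at (snd (s, t0)) within {t. (fst (s, t0), t) \<in> G})"
            using \<zeta>'(3) by (simp add: \<zeta>_eq)
          then have "pdt G (\<lambda>z. r j \<zeta> z) (s, t0) = rt j \<zeta> (s, t0)"
            using s'(1) pos by (intro pdt_eq_derivative) auto
          then show "rt j \<zeta> (s, snd z0) = pdt G (\<lambda>z. r j \<zeta> z) (s, snd z0)" by (simp add: z0_eq)
        qed (use \<zeta>' z0 in \<open>auto simp: z0_eq\<close>)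
      qed
      ultimately show ?thesis by simp
    qed
    show "rt j \<zeta> z0 = - (\<Sum>k\<in>UNIV. ?fp k j z0 * r k \<zeta> z0)" if \<zeta>: "\<zeta> \<in> E G z0" "fst \<zeta> = fst z0" for j \<zeta>
    proof -
      obtain \<tau> where \<zeta>_eq: "\<zeta> = (s0, \<tau>)" using \<zeta>(2) by (cases \<zeta>) (simp add: z0_eq)
      have \<zeta>': "(s0, \<tau>) \<in> G" "t0 \<le> \<tau>" "z0 \<in> W \<zeta>" using \<zeta> by (auto simp: \<zeta>_eq z0_eq E_def mem_W_iff)
      have "((\<lambda>t. r j (s0, \<tau>) (s0, t)) has_real_derivative - (\<Sum>k\<in>UNIV. ?fp k j (s0, t0) * r k (s0, \<tau>) (s0, t0)))
          (at t0 within {0..\<tau>})"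
        using adjoint_t[THEN spec[of _ t0], THEN spec[of _ s0], THEN spec[of _ \<tau>], THEN spec[of _ i],
            THEN spec[of _ j], THEN mp] \<zeta>' pos by (simp add: r_def)
      moreover have "((\<lambda>t. r j (s0, \<tau>) (s0, t)) has_real_derivative rt j (s0, \<tau>) (s0, t0)) (at t0 within {0..\<tau>})"
        using r_t[of \<zeta> z0 j] \<zeta>' by (simp add: \<zeta>_eq z0_eq)
      ultimately show ?thesis
        using has_real_derivative_unique_Icc pos(3) \<zeta>'(2) unfolding \<zeta>_eq z0_eq by blast
    qed
    show "rs j \<zeta> z0 = - (\<Sum>k\<in>UNIV. ?fq k j z0 * r k \<zeta> z0)" if \<zeta>: "\<zeta> \<in> E G z0" "snd \<zeta> = snd z0" for j \<zeta>
    proof -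
      obtain \<sigma> where \<zeta>_eq: "\<zeta> = (\<sigma>, t0)" using \<zeta>(2) by (cases \<zeta>) (simp add: z0_eq)
      have \<zeta>': "(\<sigma>, t0) \<in> G" "s0 \<le> \<sigma>" "z0 \<in> W \<zeta>" using \<zeta> by (auto simp: \<zeta>_eq z0_eq E_def mem_W_iff)
      have "((\<lambda>s. r j (\<sigma>, t0) (s, t0)) has_real_derivative - (\<Sum>k\<in>UNIV. ?fq k j (s0, t0) * r k (\<sigma>, t0) (s0, t0)))
          (at s0 within {0..\<sigma>})"
        using adjoint_s[THEN spec[of _ s0], THEN spec[of _ \<sigma>], THEN spec[of _ t0], THEN spec[of _ i],
            THEN spec[of _ j], THEN mp] \<zeta>' pos by (simp add: r_def)
      moreover have "((\<lambda>s. r j (\<sigma>, t0) (s, t0)) has_real_derivative rs j (\<sigma>, t0) (s0, t0)) (at s0 within {0..\<sigma>})"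
        using r_s[of \<zeta> z0 j] \<zeta>' by (simp add: \<zeta>_eq z0_eq)
      ultimately show ?thesis
        using has_real_derivative_unique_Icc pos(1) \<zeta>'(2) unfolding \<zeta>_eq z0_eq by blast
    qed
  qed (use r_s r_t rt_s z0 in auto)
  then show ?thesis unfolding r_def[abs_def] by blast
qed

end

section \<open>Assembly of the co-state\<close>

lemma Ck_open_subset: "Ck_open k \<phi> S \<Longrightarrow> T \<subseteq> S \<Longrightarrow> Ck_open k \<phi> T"
  by (induction k arbitrary: \<phi>) (auto intro: continuous_on_subset differentiable_on_subset)

text \<open>All derivatives involved are within sections of \<open>G\<close>, so only values on
  \<open>G\<close> enter. This allows the passage from the co-state formula to
  \<open>\<psi>\<close>, which is given by it on \<open>G\<close> only.\<close>

lemma adjoint_solution_cong: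
  assumes sol: "adjoint_solution G z0 fx fp fps fq fqt T \<phi>" and z0: "z0 \<in> G"
    and eq: "\<And>j z. z \<in> G \<Longrightarrow> T' j z = T j z"
  shows "adjoint_solution G z0 fx fp fps fq fqt T' \<phi>"
proof -
  obtain Tt Ts Tst where
    T: "\<forall>\<^sub>F z in nhds z0. z \<in> G \<longrightarrow> (\<forall>j.
        ((\<lambda>t. T j (fst z, t)) has_real_derivative Tt j z) (at (snd z) within {t. (fst z, t) \<in> G}))"
     "\<And>j. ((\<lambda>s. T j (s, snd z0)) has_real_derivative Ts j) (at (fst z0) within {s. (s, snd z0) \<in> G})"
     "\<And>j. ((\<lambda>s. Tt j (s, snd z0)) has_real_derivative Tst j) (at (fst z0) within {s. (s, snd z0) \<in> G})"
     "\<And>j. Tst j = \<phi> j + (\<Sum>k\<in>UNIV. fx k j * T k z0)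
        - (\<Sum>k\<in>UNIV. fps k j * T k z0 + fp k j * Ts k)
        - (\<Sum>k\<in>UNIV. fqt k j * T k z0 + fq k j * Tt k z0)"
    using sol unfolding adjoint_solution_def by blast
  show ?thesis unfolding adjoint_solution_def
  proof (intro exI conjI allI)
    show "\<forall>\<^sub>F z in nhds z0. z \<in> G \<longrightarrow> (\<forall>j. ((\<lambda>t. T' j (fst z, t))
        has_real_derivative Tt j z) (at (snd z) within {t. (fst z, t) \<in> G}))"
      using T(1)
    proof eventually_elim
      case (elim z)
      show ?case
      proof (intro impI allI)
        fix j assume z: "z \<in> G"
        with elim have "((\<lambda>t. T j (fst z, t)) has_real_derivative Tt j z) (at (snd z) within {t. (fst z, t) \<in> G})"
          by simp
        then show "((\<lambda>t. T' j (fst z, t)) has_real_derivative Tt j z) (at (snd z) within {t. (fst z, t) \<in> G})"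
          by (rule has_field_derivative_transform_within[OF _ zero_less_one]) (use eq z in auto)
      qed
    qed
    show "((\<lambda>s. T' j (s, snd z0)) has_real_derivative Ts j) (at (fst z0) within {s. (s, snd z0) \<in> G})" for j
      by (rule has_field_derivative_transform_within[OF T(2) zero_less_one]) (use eq z0 in auto)
    show "((\<lambda>s. Tt j (s, snd z0)) has_real_derivative Tst j) (at (fst z0) within {s. (s, snd z0) \<in> G})" for j
      by (rule T(3))
    show "Tst j = \<phi> j + (\<Sum>k\<in>UNIV. fx k j * T' k z0)
        - (\<Sum>k\<in>UNIV. fps k j * T' k z0 + fp k j * Ts k)
        - (\<Sum>k\<in>UNIV. fqt k j * T' k z0 + fq k j * Tt k z0)" for j
      using T(4)[of j] by (simp add: eq z0)
  qed
qed

context smooth_arc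
begin

text \<open>Separates the co-state into rows, each with its three kinds of sources. On the way
  \<open>F\<close> is replaced by a continuous function and \<open>F1\<close> by a bounded weight;
  they may differ at the corners and at the vertex parameters only, which are null sets.\<close>

lemma costate_layers:
  fixes R :: "real \<times> real \<Rightarrow> real \<times> real \<Rightarrow> real^'n^'n"
  assumes K: "\<And>i j. continuous_on (kernel_domain G) (\<lambda>(\<zeta>, z). R \<zeta> z $ i $ j)"
    and \<phi>: "\<And>i. continuous_on G (\<phi> i)" "\<And>i z. z \<in> G - corners \<Longrightarrow> F G \<Phi> x u i z = \<phi> i z"
    and w: "\<And>i. w i \<in> borel_measurable borel" "\<And>i \<mu>. \<bar>w i \<mu>\<bar> \<le> C i"
      "\<And>i \<mu>. \<mu> \<in> {0..L} - V \<Longrightarrow> F1 G g \<Phi> \<Phi>1 x u i \<mu> = w i \<mu>"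
  shows "costate N mu g \<Phi> \<Phi>1 \<Phi>0 x u R z $ j = (\<Sum>i\<in>UNIV.
      (\<integral>\<zeta>. (if \<zeta> \<in> E G z then \<phi> i \<zeta> * R \<zeta> z $ i $ j else 0) \<partial>lborel)
    + ((\<integral>\<mu>. (if \<mu> \<in> {0..L} \<and> g \<mu> \<in> E G z then w i \<mu> * R (g \<mu>) z $ i $ j else 0) \<partial>lborel)
    + (\<Sum>r = 1..N. if g (mu r) \<in> E G z then F0 G g mu \<Phi>1 \<Phi>0 x i r * R (g (mu r)) z $ i $ j else 0)))"
proof -
  have R_cont: "continuous_on (E G z) (\<lambda>\<zeta>. R \<zeta> z $ i $ j)" for i
    by (rule continuous_on_kernel_section[OF K, where c = "\<lambda>_. z"]) (auto simp: E_def)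
  have E_sub: "E G z \<subseteq> G" by (auto simp: E_def)
  have compact_E: "compact (E G z)"
    using compact_Int_closed[OF compact_G closed_E[OF compact_G, of z]] E_sub by (simp add: Int_absorb1)
  have area: "integrable lborel (\<lambda>\<zeta>. if \<zeta> \<in> E G z then \<phi> i \<zeta> * R \<zeta> z $ i $ j else 0)" for i
  proof -
    have "continuous_on (E G z) (\<lambda>\<zeta>. \<phi> i \<zeta> * R \<zeta> z $ i $ j)"
      by (intro continuous_on_mult continuous_on_subset[OF \<phi>(1) E_sub] R_cont)
    from borel_integrable_compact[OF compact_E this]
    have "integrable lborel (\<lambda>\<zeta>. indicat_real (E G z) \<zeta> *\<^sub>R (\<phi> i \<zeta> * R \<zeta> z $ i $ j))" .
    moreover have "indicat_real (E G z) \<zeta> *\<^sub>R y = (if \<zeta> \<in> E G z then y else 0)" for \<zeta> and y :: real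
      by (simp add: indicator_def)
    ultimately show ?thesis by (simp only:)
  qed
  let ?A = "{\<mu> \<in> {0..L}. g \<mu> \<in> E G z}"
  have closed_A: "closed ?A"
    using continuous_closed_preimage[OF g_cont closed_real_atLeastAtMost closed_E[OF compact_G, of z]]
    by (simp add: vimage_def Int_def conj_commute)
  have curve: "integrable lborel (\<lambda>\<mu>. if \<mu> \<in> {0..L} \<and> g \<mu> \<in> E G z then w i \<mu> * R (g \<mu>) z $ i $ j else 0)" for i
  proof -
    obtain CK where CK: "0 \<le> CK" "\<And>\<zeta> z. \<zeta> \<in> G \<Longrightarrow> z \<in> W \<zeta> \<Longrightarrow> \<bar>R \<zeta> z $ i $ j\<bar> \<le> CK"
      using kernel_bounded[OF compact_G K] by blast
    have "continuous_on ?A (\<lambda>\<mu>. R (g \<mu>) z $ i $ j)"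
      by (rule continuous_on_compose2[OF R_cont continuous_on_subset[OF g_cont]]) auto
    then have "(\<lambda>\<mu>. if \<mu> \<in> ?A then R (g \<mu>) z $ i $ j else 0) \<in> borel_measurable borel"
      by (intro borel_measurable_continuous_on_if borel_closed closed_A continuous_on_const)
    then have "(\<lambda>\<mu>. w i \<mu> * (if \<mu> \<in> ?A then R (g \<mu>) z $ i $ j else 0)) \<in> borel_measurable borel"
      by (intro borel_measurable_times w(1))
    moreover have "\<bar>w i \<mu> * (if \<mu> \<in> ?A then R (g \<mu>) z $ i $ j else 0)\<bar> \<le> \<bar>C i\<bar> * CK" for \<mu>
      using w(2)[of i \<mu>] CK(1) CK(2)[of "g \<mu>" z] by (auto simp: abs_mult E_def intro!: mult_mono)
    ultimately have "integrable lborel (\<lambda>\<mu>. w i \<mu> * (if \<mu> \<in> ?A then R (g \<mu>) z $ i $ j else 0))"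
      by (rule integrable_bounded_support[where p = 0 and q = L]) auto
    moreover have "w i \<mu> * (if \<mu> \<in> ?A then R (g \<mu>) z $ i $ j else 0)
        = (if \<mu> \<in> {0..L} \<and> g \<mu> \<in> E G z then w i \<mu> * R (g \<mu>) z $ i $ j else 0)" for \<mu>
      by simp
    ultimately show ?thesis by simp
  qed
  have "(LINT \<zeta>:E G z|lborel. (\<Sum>i\<in>UNIV. F G \<Phi> x u i \<zeta> * R \<zeta> z $ i $ j))
      = (\<integral>\<zeta>. (\<Sum>i\<in>UNIV. if \<zeta> \<in> E G z then \<phi> i \<zeta> * R \<zeta> z $ i $ j else 0) \<partial>lborel)"
    unfolding set_lebesgue_integral_def
  proof (rule integral_discrete_difference[where X = corners])
    fix \<zeta> assume "\<zeta> \<notin> corners"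
    then show "indicat_real (E G z) \<zeta> *\<^sub>R (\<Sum>i\<in>UNIV. F G \<Phi> x u i \<zeta> * R \<zeta> z $ i $ j)
        = (\<Sum>i\<in>UNIV. if \<zeta> \<in> E G z then \<phi> i \<zeta> * R \<zeta> z $ i $ j else 0)"
      using \<phi>(2)[of \<zeta>] E_sub by (cases "\<zeta> \<in> E G z") auto
  qed auto
  also have "\<dots> = (\<Sum>i\<in>UNIV. \<integral>\<zeta>. (if \<zeta> \<in> E G z then \<phi> i \<zeta> * R \<zeta> z $ i $ j else 0) \<partial>lborel)"
    by (rule Bochner_Integration.integral_sum[OF area])
  finally have area_eq: "(LINT \<zeta>:E G z|lborel. (\<Sum>i\<in>UNIV. F G \<Phi> x u i \<zeta> * R \<zeta> z $ i $ j)) = \<dots>" .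
  have "(LINT \<mu>:?A|lborel. (\<Sum>i\<in>UNIV. F1 G g \<Phi> \<Phi>1 x u i \<mu> * R (g \<mu>) z $ i $ j))
      = (\<integral>\<mu>. (\<Sum>i\<in>UNIV. if \<mu> \<in> {0..L} \<and> g \<mu> \<in> E G z then w i \<mu> * R (g \<mu>) z $ i $ j else 0) \<partial>lborel)"
    unfolding set_lebesgue_integral_def
  proof (rule integral_discrete_difference[where X = V])
    show "countable V" using finite_V by (rule countable_finite)
    fix \<mu> assume "\<mu> \<notin> V"
    then show "indicat_real ?A \<mu> *\<^sub>R (\<Sum>i\<in>UNIV. F1 G g \<Phi> \<Phi>1 x u i \<mu> * R (g \<mu>) z $ i $ j)
        = (\<Sum>i\<in>UNIV. if \<mu> \<in> {0..L} \<and> g \<mu> \<in> E G z then w i \<mu> * R (g \<mu>) z $ i $ j else 0)"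
      using w(3)[of \<mu>] by (cases "\<mu> \<in> ?A") auto
  qed auto
  also have "\<dots> = (\<Sum>i\<in>UNIV. \<integral>\<mu>. (if \<mu> \<in> {0..L} \<and> g \<mu> \<in> E G z then w i \<mu> * R (g \<mu>) z $ i $ j else 0) \<partial>lborel)"
    by (rule Bochner_Integration.integral_sum[OF curve])
  finally have curve_eq: "(LINT \<mu>:?A|lborel. (\<Sum>i\<in>UNIV. F1 G g \<Phi> \<Phi>1 x u i \<mu> * R (g \<mu>) z $ i $ j)) = \<dots>" .
  have "g (mu r) \<in> E G z \<longleftrightarrow> z \<in> W (g (mu r))" if "r \<in> {1..N}" for r
    using g_in_G[OF mu_in[of r]] that by (auto simp: E_def)
  then have "(\<Sum>r = 1..N. (\<Sum>i\<in>UNIV. F0 G g mu \<Phi>1 \<Phi>0 x i r * R (g (mu r)) z $ i $ j) * of_bool (z \<in> W (g (mu r))))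
      = (\<Sum>r = 1..N. \<Sum>i\<in>UNIV. if g (mu r) \<in> E G z then F0 G g mu \<Phi>1 \<Phi>0 x i r * R (g (mu r)) z $ i $ j else 0)"
    by (intro sum.cong refl) auto
  also have "\<dots> = (\<Sum>i\<in>UNIV. \<Sum>r = 1..N. if g (mu r) \<in> E G z then F0 G g mu \<Phi>1 \<Phi>0 x i r * R (g (mu r)) z $ i $ j else 0)"
    by (rule sum.swap)
  finally show ?thesis
    unfolding costate_def Let_def vec_lambda_beta area_eq curve_eq sum.distrib by simp
qed

text \<open>Every row \<open>i\<close> of \<open>R\<close> is a kernel of its own and leaves the
  corner term \<open>\<phi> i z0 * R z0 z0 $ i $ j\<close>; as \<open>R z0 z0\<close> is the
  identity matrix, summing over \<open>i\<close> leaves \<open>F\<close> with index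
  \<open>j\<close>.\<close>

lemma costate_adjoint_solution:
  fixes f :: "('n, 'm) jet \<Rightarrow> real^'n" and \<Phi> :: "('n, 'm) jet \<Rightarrow> real"
    and R :: "real \<times> real \<Rightarrow> real \<times> real \<Rightarrow> real^'n^'n"
  assumes f: "Ck_on 2 f (jets G U)" and \<Phi>: "Ck_on 2 \<Phi> (jets G U)"
    and \<Phi>1: "Ck_on 2 \<Phi>1 {(s, t, y, \<eta>). (s, t) \<in> g ` {0..L}}"
    and riemann: "riemann_function a b G f x u R"
    and R: "Ck_on 2 (\<lambda>(z, \<zeta>). R z \<zeta>) (kernel_domain G)"
    and z0: "z0 \<in> G" "fst z0 \<in> regular_s" "snd z0 \<in> regular_t"
  shows "adjoint_solution G z0
    (\<lambda>k j. D_x j (\<lambda>w. f w $ k) (jet G x u z0))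
    (\<lambda>k j. D_p j (\<lambda>w. f w $ k) (jet G x u z0))
    (\<lambda>k j. pds G (\<lambda>z. D_p j (\<lambda>w. f w $ k) (jet G x u z)) z0)
    (\<lambda>k j. D_q j (\<lambda>w. f w $ k) (jet G x u z0))
    (\<lambda>k j. pdt G (\<lambda>z. D_q j (\<lambda>w. f w $ k) (jet G x u z)) z0)
    (\<lambda>j z. costate N mu g \<Phi> \<Phi>1 \<Phi>0 x u R z $ j) (\<lambda>j. F G \<Phi> x u j z0)"
proof -
  have z0c: "z0 \<in> G - corners" using z0 by (auto simp: regular_s_def)
  have "\<exists>\<phi>. continuous_on G \<phi> \<and> (\<forall>z\<in>G - corners. F G \<Phi> x u i z = \<phi> z)" for i
    by (rule F_continuous[OF \<Phi>])
  then have "\<exists>\<phi>. \<forall>i. continuous_on G (\<phi> i) \<and> (\<forall>z\<in>G - corners. F G \<Phi> x u i z = \<phi> i z)"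
    by (intro choice allI)
  then obtain \<phi> where \<phi>: "\<And>i. continuous_on G (\<phi> i)" "\<And>i z. z \<in> G - corners \<Longrightarrow> F G \<Phi> x u i z = \<phi> i z"
    by blast
  define w where "w i \<mu> = (if \<mu> \<in> {0..L} - V then F1 G g \<Phi> \<Phi>1 x u i \<mu> else 0)" for i \<mu>
  have w: "w i \<in> borel_measurable borel" "\<exists>C. \<forall>\<mu>. \<bar>w i \<mu>\<bar> \<le> C" "\<And>\<mu>. \<mu> \<in> {0..L} - V \<Longrightarrow> isCont (w i) \<mu>" for i
    using F1_weight[OF \<Phi> \<Phi>1, where i = i] unfolding w_def[abs_def] by auto
  from w(2) have "\<exists>C. \<forall>i \<mu>. \<bar>w i \<mu>\<bar> \<le> C i" by (intro choice allI)
  then obtain C where C: "\<And>i \<mu>. \<bar>w i \<mu>\<bar> \<le> C i" by blast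
  let ?sol = "adjoint_solution G z0
    (\<lambda>k j. D_x j (\<lambda>w. f w $ k) (jet G x u z0))
    (\<lambda>k j. D_p j (\<lambda>w. f w $ k) (jet G x u z0))
    (\<lambda>k j. pds G (\<lambda>z. D_p j (\<lambda>w. f w $ k) (jet G x u z)) z0)
    (\<lambda>k j. D_q j (\<lambda>w. f w $ k) (jet G x u z0))
    (\<lambda>k j. pdt G (\<lambda>z. D_q j (\<lambda>w. f w $ k) (jet G x u z)) z0)"
  have kernel: "\<exists>rs rt rst. arc_kernel a b N mu g (\<lambda>j \<zeta> z. R \<zeta> z $ i $ j) rs rt rst z0
    (\<lambda>k j. D_x j (\<lambda>w. f w $ k) (jet G x u z0))
    (\<lambda>k j. D_p j (\<lambda>w. f w $ k) (jet G x u z0))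
    (\<lambda>k j. pds G (\<lambda>z. D_p j (\<lambda>w. f w $ k) (jet G x u z)) z0)
    (\<lambda>k j. D_q j (\<lambda>w. f w $ k) (jet G x u z0))
    (\<lambda>k j. pdt G (\<lambda>z. D_q j (\<lambda>w. f w $ k) (jet G x u z)) z0)" for i
    by (rule riemann_arc_kernel[OF f riemann R z0])
  have row: "?sol (\<lambda>j z.
      (\<integral>\<zeta>. (if \<zeta> \<in> E G z then \<phi> i \<zeta> * R \<zeta> z $ i $ j else 0) \<partial>lborel)
    + ((\<integral>\<mu>. (if \<mu> \<in> {0..L} \<and> g \<mu> \<in> E G z then w i \<mu> * R (g \<mu>) z $ i $ j else 0) \<partial>lborel)
    + (\<Sum>r = 1..N. if g (mu r) \<in> E G z then F0 G g mu \<Phi>1 \<Phi>0 x i r * R (g (mu r)) z $ i $ j else 0)))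
    (\<lambda>j. \<phi> i z0 * R z0 z0 $ i $ j + (0 + (\<Sum>r = 1..N. 0)))"
    and K: "continuous_on (kernel_domain G) (\<lambda>(\<zeta>, z). R \<zeta> z $ i $ j)" for i j
  proof -
    obtain rs rt rst where "arc_kernel a b N mu g (\<lambda>j \<zeta> z. R \<zeta> z $ i $ j) rs rt rst z0
    (\<lambda>k j. D_x j (\<lambda>w. f w $ k) (jet G x u z0))
    (\<lambda>k j. D_p j (\<lambda>w. f w $ k) (jet G x u z0))
    (\<lambda>k j. pds G (\<lambda>z. D_p j (\<lambda>w. f w $ k) (jet G x u z)) z0)
    (\<lambda>k j. D_q j (\<lambda>w. f w $ k) (jet G x u z0))
    (\<lambda>k j. pdt G (\<lambda>z. D_q j (\<lambda>w. f w $ k) (jet G x u z)) z0)"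
      using kernel[of i] by blast
    then interpret ker: arc_kernel a b N mu g "\<lambda>j \<zeta> z. R \<zeta> z $ i $ j" rs rt rst z0
      "\<lambda>k j. D_x j (\<lambda>w. f w $ k) (jet G x u z0)"
      "\<lambda>k j. D_p j (\<lambda>w. f w $ k) (jet G x u z0)"
      "\<lambda>k j. pds G (\<lambda>z. D_p j (\<lambda>w. f w $ k) (jet G x u z)) z0"
      "\<lambda>k j. D_q j (\<lambda>w. f w $ k) (jet G x u z0)"
      "\<lambda>k j. pdt G (\<lambda>z. D_q j (\<lambda>w. f w $ k) (jet G x u z)) z0" .
    show "continuous_on (kernel_domain G) (\<lambda>(\<zeta>, z). R \<zeta> z $ i $ j)" by (rule ker.cont(1))
    show "?sol (\<lambda>j z.
      (\<integral>\<zeta>. (if \<zeta> \<in> E G z then \<phi> i \<zeta> * R \<zeta> z $ i $ j else 0) \<partial>lborel)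
    + ((\<integral>\<mu>. (if \<mu> \<in> {0..L} \<and> g \<mu> \<in> E G z then w i \<mu> * R (g \<mu>) z $ i $ j else 0) \<partial>lborel)
    + (\<Sum>r = 1..N. if g (mu r) \<in> E G z then F0 G g mu \<Phi>1 \<Phi>0 x i r * R (g (mu r)) z $ i $ j else 0)))
    (\<lambda>j. \<phi> i z0 * R z0 z0 $ i $ j + (0 + (\<Sum>r = 1..N. 0)))"
    proof (intro adjoint_solution_add)
      show "?sol (\<lambda>j z. \<integral>\<zeta>. (if \<zeta> \<in> E G z then \<phi> i \<zeta> * R \<zeta> z $ i $ j else 0) \<partial>lborel)
          (\<lambda>j. \<phi> i z0 * R z0 z0 $ i $ j)"
        by (rule ker.adjoint_solution_area[OF \<phi>(1)])
      show "?sol (\<lambda>j z. \<integral>\<mu>. (if \<mu> \<in> {0..L} \<and> g \<mu> \<in> E G z then w i \<mu> * R (g \<mu>) z $ i $ j else 0) \<partial>lborel) (\<lambda>j. 0)"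
        by (rule ker.adjoint_solution_curve[OF w(1) C _ w(3)]) (auto simp: w_def)
      show "?sol (\<lambda>j z. \<Sum>r = 1..N. if g (mu r) \<in> E G z then F0 G g mu \<Phi>1 \<Phi>0 x i r * R (g (mu r)) z $ i $ j else 0)
          (\<lambda>j. \<Sum>r = 1..N. 0)"
        by (rule adjoint_solution_sum) (auto intro: ker.adjoint_solution_vertex)
    qed
  qed
  have "R z0 z0 = mat 1"
    using riemann[unfolded riemann_function_def is_riemann_def, THEN conjunct2, THEN conjunct1] z0(1) by (rule bspec)
  then have diag: "F G \<Phi> x u j z0 = (\<Sum>i\<in>UNIV. \<phi> i z0 * R z0 z0 $ i $ j + (0 + (\<Sum>r = 1..N. 0)))" for j
    by (simp add: \<phi>(2)[OF z0c] mat_def if_distrib[of "\<lambda>c. _ * c"] cong: if_cong)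
  have "?sol (\<lambda>j z. \<Sum>i\<in>UNIV.
      (\<integral>\<zeta>. (if \<zeta> \<in> E G z then \<phi> i \<zeta> * R \<zeta> z $ i $ j else 0) \<partial>lborel)
    + ((\<integral>\<mu>. (if \<mu> \<in> {0..L} \<and> g \<mu> \<in> E G z then w i \<mu> * R (g \<mu>) z $ i $ j else 0) \<partial>lborel)
    + (\<Sum>r = 1..N. if g (mu r) \<in> E G z then F0 G g mu \<Phi>1 \<Phi>0 x i r * R (g (mu r)) z $ i $ j else 0)))
    (\<lambda>j. F G \<Phi> x u j z0)"
    unfolding diag by (rule adjoint_solution_sum[OF finite_class.finite_UNIV row])
  then show ?thesis
    by (rule adjoint_solution_cong[OF _ z0(1) costate_layers[OF K \<phi> w(1) C]]) (auto simp: w_def)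
qed

end

theorem theorem3p1:
  fixes a b :: real and N :: nat and mu :: "nat \<Rightarrow> real" and g :: "real \<Rightarrow> real \<times> real"
    and G :: "(real \<times> real) set" and U :: "(real^'m::finite) set" and ulo uhi :: "real^'m"
    and f :: "('n::finite,'m) jet \<Rightarrow> real^'n" and \<Phi> :: "('n,'m) jet \<Rightarrow> real"
    and \<Phi>1 :: "'n bjet \<Rightarrow> real" and \<Phi>0 :: "real \<times> real \<Rightarrow> real^'n \<Rightarrow> real"
    and x1 x2 :: "real \<Rightarrow> real^'n"
    and u :: "real \<times> real \<Rightarrow> real^'m" and x \<psi> :: "real \<times> real \<Rightarrow> real^'n"
    and R :: "real \<times> real \<Rightarrow> real \<times> real \<Rightarrow> real^'n^'n"
  assumes curve: "boundary_curve a b N mu g"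
    and G: "G = region N mu g"
    and U: "U = cbox ulo uhi"
    and f_lipschitz: "\<exists>K. \<forall>(s, t)\<in>G. \<forall>v\<in>U. K-lipschitz_on UNIV (\<lambda>(y, p, q). f (s, t, y, p, q, v))"
    and f_cont: "\<forall>(s, t)\<in>G. \<forall>y p q. continuous_on U (\<lambda>v. f (s, t, y, p, q, v))"
    and data: "continuous_on {0..a} x1" "continuous_on {0..b} x2" "x1 0 = x2 0"
    and admissible: "\<forall>z\<in>G. u z \<in> U"
    and state: "is_state a b G f x1 x2 u x"
    and riemann: "riemann_function a b G f x u R"
    and costate: "\<forall>z\<in>G. \<psi> z = costate N mu g \<Phi> \<Phi>1 \<Phi>0 x u R z"
    and smooth_f: "Ck_on 2 f {(s, t, y, p, q, v). (s, t) \<in> G \<and> v \<in> U}"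
    and smooth_\<Phi>: "Ck_on 2 \<Phi> {(s, t, y, p, q, v). (s, t) \<in> G \<and> v \<in> U}"
    and smooth_\<Phi>1: "Ck_on 2 \<Phi>1 {(s, t, y, \<eta>). (s, t) \<in> g ` {0..mu (Suc N)}}"
    and smooth_\<Phi>0: "\<forall>r\<le>Suc N. Ck_on 1 (\<Phi>0 (g (mu r))) UNIV"
    and smooth_x: "Ck_on 2 x G"
    and smooth_u: "Ck_on 1 u G"
    and smooth_R: "Ck_on 2 (\<lambda>(z, \<zeta>). R z \<zeta>) {(z, \<zeta>). z \<in> G \<and> \<zeta> \<in> W z}"
  shows "\<forall>z\<in>regular_part N mu g. \<forall>i.
      s_differentiable G (\<lambda>\<zeta>. \<psi> \<zeta> $ i) z \<and>
      t_differentiable G (\<lambda>\<zeta>. \<psi> \<zeta> $ i) z \<and>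
      s_differentiable G (pdt G (\<lambda>\<zeta>. \<psi> \<zeta> $ i)) z \<and>
      s_differentiable G (\<lambda>\<zeta>. D_p i (H \<Phi> f (\<psi> \<zeta>)) (jet G x u \<zeta>)) z \<and>
      t_differentiable G (\<lambda>\<zeta>. D_q i (H \<Phi> f (\<psi> \<zeta>)) (jet G x u \<zeta>)) z \<and>
      pds G (pdt G (\<lambda>\<zeta>. \<psi> \<zeta> $ i)) z =
        D_x i (H \<Phi> f (\<psi> z)) (jet G x u z)
        - pds G (\<lambda>\<zeta>. D_p i (H \<Phi> f (\<psi> \<zeta>)) (jet G x u \<zeta>)) z
        - pdt G (\<lambda>\<zeta>. D_q i (H \<Phi> f (\<psi> \<zeta>)) (jet G x u \<zeta>)) z"
proof (intro ballI allI)
  fix z0 i assume z0_reg: "z0 \<in> regular_part N mu g"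
  obtain \<Omega>x X where X: "open \<Omega>x" "G \<subseteq> \<Omega>x" "Ck_open 2 X \<Omega>x" "\<forall>z\<in>G. X z = x z"
    using smooth_x unfolding Ck_on_def by blast
  obtain \<Omega>u Y where Y: "open \<Omega>u" "G \<subseteq> \<Omega>u" "Ck_open 1 Y \<Omega>u" "\<forall>z\<in>G. Y z = u z"
    using smooth_u unfolding Ck_on_def by blast
  interpret smooth_arc a b N mu g x X u Y U "\<Omega>x \<inter> \<Omega>u"
  proof unfold_locales
    show "Ck_open 2 X (\<Omega>x \<inter> \<Omega>u)" by (rule Ck_open_subset[OF X(3)]) simp
    show "C1_on Y (\<Omega>x \<inter> \<Omega>u)"
      using Y(1,3) by (intro C1_on_subset[OF Ck_open_Suc_imp_C1_on[of 0 Y \<Omega>u]]) simp_all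
  qed (use curve X Y admissible in \<open>auto simp: G\<close>)
  have jets_eq: "jets G U = {(s, t, y, p, q, v). (s, t) \<in> G \<and> v \<in> U}" by (simp add: jets_def)
  have f: "Ck_on 2 f (jets G U)" and \<Phi>: "Ck_on 2 \<Phi> (jets G U)"
    using smooth_f smooth_\<Phi> by (simp_all add: jets_eq)
  have R: "Ck_on 2 (\<lambda>(z, \<zeta>). R z \<zeta>) (kernel_domain G)"
    using smooth_R by (simp add: kernel_domain_def)
  have fk: "Ck_on 2 (\<lambda>w. f w $ k) (jets G U)" for k
    using f by (rule Ck_on_linear) (rule bounded_linear_vec_nth)
  have z0: "z0 \<in> G" using z0_reg by (simp add: regular_part_def G)
  have nv: "fst z0 \<noteq> fst (g (mu r)) \<and> snd z0 \<noteq> snd (g (mu r))" if "r \<le> Suc N" for r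
    using z0_reg that by (simp add: regular_part_def)
  \<comment> \<open>The end points of the curve count as vertices, so a regular point lies off both
    axes and strictly inside the rectangle with sides \<open>a\<close> and \<open>b\<close>.\<close>
  have "fst z0 \<noteq> a" "snd z0 \<noteq> 0" using nv[of 0] by (simp_all add: mu0 g_ends)
  moreover have "fst z0 \<noteq> 0" "snd z0 \<noteq> b" using nv[of "Suc N"] by (simp_all add: g_ends)
  ultimately have pos: "0 < fst z0" "fst z0 < a" "0 < snd z0" "snd z0 < b"
    using G_nonneg[of z0] G_le[of z0] z0 by (auto simp: G)
  have reg: "fst z0 \<in> regular_s" "snd z0 \<in> regular_t"
    using pos nv by (auto simp: regular_s_def regular_t_def)
  have z0c: "z0 \<in> G - corners" using z0 pos by auto
  let ?fx = "\<lambda>k j z. D_x j (\<lambda>w. f w $ k) (jet G x u z)"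
  let ?fp = "\<lambda>k j z. D_p j (\<lambda>w. f w $ k) (jet G x u z)"
  let ?fq = "\<lambda>k j z. D_q j (\<lambda>w. f w $ k) (jet G x u z)"
  have "adjoint_solution G z0 (\<lambda>k j. ?fx k j z0) (\<lambda>k j. ?fp k j z0) (\<lambda>k j. pds G (?fp k j) z0)
      (\<lambda>k j. ?fq k j z0) (\<lambda>k j. pdt G (?fq k j) z0)
      (\<lambda>j z. costate N mu g \<Phi> \<Phi>1 \<Phi>0 x u R z $ j) (\<lambda>j. F G \<Phi> x u j z0)"
    by (rule costate_adjoint_solution[folded G]) (fact f \<Phi> smooth_\<Phi>1 riemann R z0 reg)+
  then have "adjoint_solution G z0 (\<lambda>k j. ?fx k j z0) (\<lambda>k j. ?fp k j z0) (\<lambda>k j. pds G (?fp k j) z0)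
      (\<lambda>k j. ?fq k j z0) (\<lambda>k j. pdt G (?fq k j) z0) (\<lambda>j z. \<psi> z $ j) (\<lambda>j. F G \<Phi> x u j z0)"
    by (rule adjoint_solution_cong[OF _ z0]) (use costate in simp)
  then obtain \<psi>t \<psi>s \<psi>st where
    \<psi>t: "\<forall>\<^sub>F z in nhds z0. z \<in> G \<longrightarrow> (\<forall>j.
        ((\<lambda>t. \<psi> (fst z, t) $ j) has_real_derivative \<psi>t j z) (at (snd z) within {t. (fst z, t) \<in> G}))"
    and \<psi>s: "\<And>j. ((\<lambda>s. \<psi> (s, snd z0) $ j) has_real_derivative \<psi>s j) (at (fst z0) within {s. (s, snd z0) \<in> G})"
    and \<psi>st: "\<And>j. ((\<lambda>s. \<psi>t j (s, snd z0)) has_real_derivative \<psi>st j) (at (fst z0) within {s. (s, snd z0) \<in> G})"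
    and adjoint: "\<And>j. \<psi>st j = F G \<Phi> x u j z0 + (\<Sum>k\<in>UNIV. ?fx k j z0 * \<psi> z0 $ k)
        - (\<Sum>k\<in>UNIV. pds G (?fp k j) z0 * \<psi> z0 $ k + ?fp k j z0 * \<psi>s k)
        - (\<Sum>k\<in>UNIV. pdt G (?fq k j) z0 * \<psi> z0 $ k + ?fq k j z0 * \<psi>t k z0)"
    unfolding adjoint_solution_def by blast
  have \<psi>t0: "((\<lambda>t. \<psi> (fst z0, t) $ j) has_real_derivative \<psi>t j z0) (at (snd z0) within {t. (fst z0, t) \<in> G})" for j
    using eventually_nhds_x_imp_x[OF \<psi>t] z0 by blast
  obtain d where d: "0 < d" "\<And>z j. dist z z0 < d \<Longrightarrow> z \<in> G \<Longrightarrow>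
      ((\<lambda>t. \<psi> (fst z, t) $ j) has_real_derivative \<psi>t j z) (at (snd z) within {t. (fst z, t) \<in> G})"
    using \<psi>t unfolding eventually_nhds_metric by blast
  \<comment> \<open>\<open>\<psi>t\<close> is the partial derivative \<open>pdt\<close> at points of
    \<open>G\<close> on this line within distance \<open>d\<close>, which is all that a derivative
    at \<open>fst z0\<close> uses.\<close>
  have mixed: "((\<lambda>s. pdt G (\<lambda>z. \<psi> z $ i) (s, snd z0)) has_real_derivative \<psi>st i)
      (at (fst z0) within {s. (s, snd z0) \<in> G})"
  proof (rule has_field_derivative_transform_within[OF \<psi>st d(1)])
    fix s assume s: "s \<in> {s. (s, snd z0) \<in> G}" "dist s (fst z0) < d"
    have "dist (s, snd z0) z0 < d" using s(2) by (cases z0) (simp add: dist_Pair_Pair)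
    from d(2)[OF this, of i] s(1) have "((\<lambda>t. \<psi> (s, t) $ i) has_real_derivative \<psi>t i (s, snd z0))
        (at (snd z0) within {t. (s, t) \<in> G})" by simp
    then show "\<psi>t i (s, snd z0) = pdt G (\<lambda>z. \<psi> z $ i) (s, snd z0)"
      using s(1) pos by (intro pdt_eq_derivative[symmetric, folded G]) auto
  qed (use z0 in auto)
  have H_p: "D_p i (H \<Phi> f (\<psi> z)) (jet G x u z) = D_p i \<Phi> (jet G x u z) + (\<Sum>k\<in>UNIV. \<psi> z $ k * ?fp k i z)"
    and H_q: "D_q i (H \<Phi> f (\<psi> z)) (jet G x u z) = D_q i \<Phi> (jet G x u z) + (\<Sum>k\<in>UNIV. \<psi> z $ k * ?fq k i z)"
    and H_x: "D_x i (H \<Phi> f (\<psi> z)) (jet G x u z) = D_x i \<Phi> (jet G x u z) + (\<Sum>k\<in>UNIV. \<psi> z $ k * ?fx k i z)"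
    if "z \<in> G" for z
  proof -
    have "jet G x u z \<in> jets G U" using that admissible by (simp add: jet_def jets_def)
    from hamiltonian_partials[OF \<Phi> f this]
    show "D_p i (H \<Phi> f (\<psi> z)) (jet G x u z) = D_p i \<Phi> (jet G x u z) + (\<Sum>k\<in>UNIV. \<psi> z $ k * ?fp k i z)"
      "D_q i (H \<Phi> f (\<psi> z)) (jet G x u z) = D_q i \<Phi> (jet G x u z) + (\<Sum>k\<in>UNIV. \<psi> z $ k * ?fq k i z)"
      "D_x i (H \<Phi> f (\<psi> z)) (jet G x u z) = D_x i \<Phi> (jet G x u z) + (\<Sum>k\<in>UNIV. \<psi> z $ k * ?fx k i z)"
      by simp_all
  qed
  \<comment> \<open>In the total derivative the co-state is differentiated as well: the product rule
    is applied to the formula \<open>H_p\<close>, which holds on all of \<open>G\<close>.\<close>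
  have p: "((\<lambda>s. D_p i (H \<Phi> f (\<psi> (s, snd z0))) (jet G x u (s, snd z0))) has_real_derivative
      pds G (\<lambda>z. D_p i \<Phi> (jet G x u z)) z0 + (\<Sum>k\<in>UNIV. \<psi> (fst z0, snd z0) $ k * pds G (?fp k i) z0
        + \<psi>s k * ?fp k i (fst z0, snd z0)))
      (at (fst z0) within {s. (s, snd z0) \<in> G})"
    by (rule has_field_derivative_transform_within[OF DERIV_add[OF D_p_along_jet[folded G, OF \<Phi> z0c]
          DERIV_sum[OF DERIV_mult'[OF \<psi>s D_p_along_jet[folded G, OF fk z0c]]]] zero_less_one])
      (use z0 H_p in auto)
  have q: "((\<lambda>t. D_q i (H \<Phi> f (\<psi> (fst z0, t))) (jet G x u (fst z0, t))) has_real_derivative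
      pdt G (\<lambda>z. D_q i \<Phi> (jet G x u z)) z0 + (\<Sum>k\<in>UNIV. \<psi> (fst z0, snd z0) $ k * pdt G (?fq k i) z0
        + \<psi>t k z0 * ?fq k i (fst z0, snd z0)))
      (at (snd z0) within {t. (fst z0, t) \<in> G})"
    by (rule has_field_derivative_transform_within[OF DERIV_add[OF D_q_along_jet[folded G, OF \<Phi> z0c]
          DERIV_sum[OF DERIV_mult'[OF \<psi>t0 D_q_along_jet[folded G, OF fk z0c]]]] zero_less_one])
      (use z0 H_q in auto)
  note pds = pds_eq_derivative[folded G, OF z0c] and pdt = pdt_eq_derivative[folded G, OF z0c]
  \<comment> \<open>The part of the right-hand side coming from \<open>\<Phi>\<close> is
    \<open>F\<close>, and the part from \<open>f\<close> is the adjoint expression with the product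
    rule already carried out, so both sides agree term by term.\<close>
  have "pds G (pdt G (\<lambda>\<zeta>. \<psi> \<zeta> $ i)) z0 =
        D_x i (H \<Phi> f (\<psi> z0)) (jet G x u z0)
        - pds G (\<lambda>\<zeta>. D_p i (H \<Phi> f (\<psi> \<zeta>)) (jet G x u \<zeta>)) z0
        - pdt G (\<lambda>\<zeta>. D_q i (H \<Phi> f (\<psi> \<zeta>)) (jet G x u \<zeta>)) z0"
    unfolding pds[OF mixed] pds[OF p] pdt[OF q] H_x[OF z0] adjoint F_def
    by (simp add: sum.distrib algebra_simps)
  then show "s_differentiable G (\<lambda>\<zeta>. \<psi> \<zeta> $ i) z0 \<and>
      t_differentiable G (\<lambda>\<zeta>. \<psi> \<zeta> $ i) z0 \<and>
      s_differentiable G (pdt G (\<lambda>\<zeta>. \<psi> \<zeta> $ i)) z0 \<and>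
      s_differentiable G (\<lambda>\<zeta>. D_p i (H \<Phi> f (\<psi> \<zeta>)) (jet G x u \<zeta>)) z0 \<and>
      t_differentiable G (\<lambda>\<zeta>. D_q i (H \<Phi> f (\<psi> \<zeta>)) (jet G x u \<zeta>)) z0 \<and>
      pds G (pdt G (\<lambda>\<zeta>. \<psi> \<zeta> $ i)) z0 =
        D_x i (H \<Phi> f (\<psi> z0)) (jet G x u z0)
        - pds G (\<lambda>\<zeta>. D_p i (H \<Phi> f (\<psi> \<zeta>)) (jet G x u \<zeta>)) z0
        - pdt G (\<lambda>\<zeta>. D_q i (H \<Phi> f (\<psi> \<zeta>)) (jet G x u \<zeta>)) z0"
    using \<psi>s[of i] \<psi>t0[of i] mixed p q
    unfolding s_differentiable_def t_differentiable_def by (auto simp: real_differentiable_def)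
qed

end
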